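(* Let $\mathcal{A}$ be a commutative $C^*$-algebra. Then the Varopoulos algebra $V_{\mathcal{A}}=\mathcal{A}\otimes_\gamma\mathcal{A}$ is Arens regular if and only if $\mathcal{A}$ is scattered.
   Context: $\mathcal{A}\otimes_\gamma\mathcal{A}$ is the projective Banach space tensor product (completion of $\mathcal{A}\otimes\mathcal{A}$ in $\|u\|_\gamma=\inf\{\sum_k\|x_k\|\|y_k\|:u=\sum_kx_k\otimes y_k\}$), a Banach algebra with product determined by $(a\otimes b)(c\otimes d)=ac\otimes bd$. For a Banach algebra $\mathcal{C}$, the left Arens product on $\mathcal{C}^{**}$ is $\langle X\Box Y,f\rangle=\langle X,Y\Box f\rangle$, $\langle Y\Box f,a\rangle=\langle Y,f\Box a\rangle$, $\langle f\Box a,b\rangle=\langle f,ab\rangle$ for $X,Y\in\mathcal{C}^{**}$, $f\in\mathcal{C}^*$, $a,b\in\mathcal{C}$. $\mathcal{C}$ is Arens regular if for every $X\in\mathcal{C}^{**}$ the map $Y\mapsto X\Box Y$ is $w^*$-$w^*$-continuous on $\mathcal{C}^{**}$. A $C^*$-algebra is scattered if every positive functional on it is a finite or countable (pointwise) sum of pure functionals (non-negative multiples of pure states). *)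

theory Defs
  imports "HOL-Analysis.Analysis"
begin

section \<open>Complex Banach algebras and C*-algebras\<close>

class complex_vector = real_vector +
  fixes scaleC :: "complex \<Rightarrow> 'a \<Rightarrow> 'a"  (infixr \<open>*\<^sub>C\<close> 75)
  assumes scaleC_add_right: "c *\<^sub>C (x + y) = c *\<^sub>C x + c *\<^sub>C y"
    and scaleC_add_left: "(c + d) *\<^sub>C x = c *\<^sub>C x + d *\<^sub>C x"
    and scaleC_scaleC: "c *\<^sub>C (d *\<^sub>C x) = (c * d) *\<^sub>C x"
    and scaleR_scaleC: "r *\<^sub>R x = complex_of_real r *\<^sub>C x"

class complex_normed_vector = complex_vector + real_normed_vector +
  assumes norm_scaleC: "norm (c *\<^sub>C x) = cmod c * norm x"

class complex_normed_algebra = complex_normed_vector + real_normed_algebra +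
  assumes mult_scaleC_left: "(c *\<^sub>C x) * y = c *\<^sub>C (x * y)"
    and mult_scaleC_right: "x * (c *\<^sub>C y) = c *\<^sub>C (x * y)"

text \<open>Algebras are not assumed to be unital.\<close>

class complex_banach_algebra = complex_normed_algebra + complete_space

class cstar_algebra = complex_banach_algebra +
  fixes adj :: "'a \<Rightarrow> 'a"
  assumes adj_adj: "adj (adj x) = x"
    and adj_add: "adj (x + y) = adj x + adj y"
    and adj_scaleC: "adj (c *\<^sub>C x) = cnj c *\<^sub>C adj x"
    and adj_mult: "adj (x * y) = adj y * adj x"
    and cstar_identity: "norm (adj x * x) = (norm x)\<^sup>2"

instantiation complex :: cstar_algebra
begin

definition scaleC_complex :: "complex \<Rightarrow> complex \<Rightarrow> complex"
  where "scaleC_complex c z = c * z"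

definition adj_complex :: "complex \<Rightarrow> complex"
  where "adj_complex = cnj"

instance
proof
  fix x :: complex
  show "norm (adj x * x) = (norm x)\<^sup>2"
    by (simp add: adj_complex_def norm_mult power2_eq_square)
qed (auto simp: scaleC_complex_def adj_complex_def algebra_simps scaleR_conv_of_real norm_mult)

end

lemma scaleC_one [simp]: "1 *\<^sub>C x = (x::'a::complex_vector)"
  using scaleR_scaleC[of 1 x] by simp

lemma scaleC_zero_left [simp]: "0 *\<^sub>C x = (0::'a::complex_vector)"
  using scaleR_scaleC[of 0 x] by simp

lemma scaleC_zero_right [simp]: "c *\<^sub>C (0::'a::complex_vector) = 0"
  using scaleC_add_right[of c 0 0] by simp

lemma scaleC_minus_right: "c *\<^sub>C (- x) = - (c *\<^sub>C (x::'a::complex_vector))"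
  using scaleC_add_right[of c x "- x"] by (simp add: eq_neg_iff_add_eq_0 add.commute)

lemma scaleC_diff_right: "c *\<^sub>C (x - y) = c *\<^sub>C x - c *\<^sub>C (y::'a::complex_vector)"
  using scaleC_add_right[of c x "- y"] by (simp add: scaleC_minus_right)

lemma scaleC_minus1: "(-1) *\<^sub>C x = - (x::'a::complex_vector)"
  using scaleR_scaleC[of "-1" x] by simp

definition clinear :: "('a::complex_vector \<Rightarrow> 'b::complex_vector) \<Rightarrow> bool"
  where "clinear f \<longleftrightarrow> (\<forall>x y. f (x + y) = f x + f y) \<and> (\<forall>c x. f (c *\<^sub>C x) = c *\<^sub>C f x)"


section \<open>The Banach dual and the weak* topology\<close>

typedef (overloaded) 'a dual =
  "{f :: 'a::complex_normed_vector \<Rightarrow>\<^sub>L complex. clinear (blinfun_apply f)}"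
  by (rule exI[of _ 0]) (simp add: clinear_def)

setup_lifting type_definition_dual

lift_definition dual_apply :: "'a::complex_normed_vector dual \<Rightarrow> 'a \<Rightarrow> complex"
  is blinfun_apply .

lemma blinfun_cmult:
  fixes f :: "'a::real_normed_vector \<Rightarrow>\<^sub>L complex"
  shows "blinfun_apply (Blinfun (\<lambda>x. c * blinfun_apply f x)) = (\<lambda>x. c * blinfun_apply f x)"
  by (rule bounded_linear_Blinfun_apply) (rule bounded_linear_const_mult[OF blinfun.bounded_linear_right])

instantiation dual :: (complex_normed_vector) complex_normed_vector
begin

lift_definition zero_dual :: "'a dual" is 0
  by (simp add: clinear_def)

lift_definition plus_dual :: "'a dual \<Rightarrow> 'a dual \<Rightarrow> 'a dual" is "(+)"
  by (auto simp: clinear_def blinfun.add_left scaleC_complex_def algebra_simps)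

lift_definition minus_dual :: "'a dual \<Rightarrow> 'a dual \<Rightarrow> 'a dual" is "(-)"
  by (auto simp: clinear_def blinfun.diff_left scaleC_complex_def algebra_simps)

lift_definition uminus_dual :: "'a dual \<Rightarrow> 'a dual" is uminus
  by (auto simp: clinear_def blinfun.minus_left scaleC_complex_def)

lift_definition scaleR_dual :: "real \<Rightarrow> 'a dual \<Rightarrow> 'a dual" is scaleR
  by (auto simp: clinear_def blinfun.scaleR_left scaleC_complex_def scaleR_conv_of_real algebra_simps)

lift_definition scaleC_dual :: "complex \<Rightarrow> 'a dual \<Rightarrow> 'a dual"
  is "\<lambda>c f. Blinfun (\<lambda>x. c * blinfun_apply f x)"
  by (auto simp: clinear_def scaleC_complex_def blinfun_cmult algebra_simps)

lift_definition norm_dual :: "'a dual \<Rightarrow> real" is norm .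

definition dist_dual :: "'a dual \<Rightarrow> 'a dual \<Rightarrow> real"
  where "dist_dual f g = norm (f - g)"

definition sgn_dual :: "'a dual \<Rightarrow> 'a dual"
  where "sgn_dual f = inverse (norm f) *\<^sub>R f"

definition uniformity_dual :: "('a dual \<times> 'a dual) filter"
  where "uniformity_dual = (INF e\<in>{0<..}. principal {(f, g). dist f g < e})"

definition open_dual :: "'a dual set \<Rightarrow> bool"
  where "open_dual U \<longleftrightarrow> (\<forall>f\<in>U. \<forall>\<^sub>F (f', g) in uniformity. f' = f \<longrightarrow> g \<in> U)"

instance
proof
  fix f g h :: "'a dual" and r s :: real and c d :: complex
  show "f + g + h = f + (g + h)" by transfer simp
  show "f + g = g + f" by transfer simp
  show "0 + f = f" by transfer simp
  show "- f + f = 0" by transfer simp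
  show "f - g = f + - g" by transfer simp
  show "r *\<^sub>R (f + g) = r *\<^sub>R f + r *\<^sub>R g" by transfer (simp add: algebra_simps)
  show "(r + s) *\<^sub>R f = r *\<^sub>R f + s *\<^sub>R f" by transfer (simp add: algebra_simps)
  show "r *\<^sub>R s *\<^sub>R f = (r * s) *\<^sub>R f" by transfer simp
  show "1 *\<^sub>R f = f" by transfer simp
  show "c *\<^sub>C (f + g) = c *\<^sub>C f + c *\<^sub>C g"
    by transfer (rule blinfun_eqI, simp only: blinfun_cmult, simp only: blinfun.add_left blinfun_cmult distrib_left distrib_right)
  show "(c + d) *\<^sub>C f = c *\<^sub>C f + d *\<^sub>C f"
    by transfer (rule blinfun_eqI, simp only: blinfun_cmult, simp only: blinfun.add_left blinfun_cmult distrib_left distrib_right)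
  show "c *\<^sub>C d *\<^sub>C f = (c * d) *\<^sub>C f"
    by transfer (rule blinfun_eqI, (subst blinfun_cmult)+, simp only: mult.assoc)
  show "r *\<^sub>R f = complex_of_real r *\<^sub>C f"
    by transfer (rule blinfun_eqI, simp only: blinfun_cmult, simp only: blinfun.scaleR_left scaleR_conv_of_real)
  show "dist f g = norm (f - g)" by (rule dist_dual_def)
  show "sgn f = inverse (norm f) *\<^sub>R f" by (rule sgn_dual_def)
  show "uniformity = (INF e\<in>{0<..}. principal {(f, g::'a dual). dist f g < e})"
    by (rule uniformity_dual_def)
  show "open U \<longleftrightarrow> (\<forall>f\<in>U. \<forall>\<^sub>F (f', g) in uniformity. f' = f \<longrightarrow> g \<in> U)" for U :: "'a dual set"
    by (rule open_dual_def)
  show "norm f = 0 \<longleftrightarrow> f = 0" by transfer simp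
  show "norm (f + g) \<le> norm f + norm g" by transfer (rule norm_triangle_ineq)
  show "norm (r *\<^sub>R f) = \<bar>r\<bar> * norm f" by transfer simp
  show "norm (c *\<^sub>C f) = cmod c * norm f"
  proof transfer
    fix c :: complex and f :: "'a \<Rightarrow>\<^sub>L complex"
    have le: "norm (Blinfun (\<lambda>x. c * blinfun_apply f x)) \<le> cmod c * norm f" for c and f :: "'a \<Rightarrow>\<^sub>L complex"
    proof (rule norm_blinfun_bound)
      fix x
      have "cmod (blinfun_apply f x) \<le> norm f * norm x" by (rule norm_blinfun)
      then show "norm (blinfun_apply (Blinfun (\<lambda>x. c * blinfun_apply f x)) x) \<le> cmod c * norm f * norm x"
        by (simp add: blinfun_cmult norm_mult
            mult_left_mono mult.assoc)
    qed simp
    show "norm (Blinfun (\<lambda>x. c * blinfun_apply f x)) = cmod c * norm f"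
    proof (cases "c = 0")
      case True
      then show ?thesis using le[of 0 f] by simp
    next
      case False
      let ?g = "Blinfun (\<lambda>x. c * blinfun_apply f x)"
      have "Blinfun (\<lambda>x. inverse c * blinfun_apply ?g x) = f"
        using False by (simp add: blinfun_cmult
            blinfun_apply_inverse mult.assoc[symmetric])
      then have "norm f \<le> cmod (inverse c) * norm ?g" using le[of "inverse c" ?g] by simp
      then have "norm f \<le> norm ?g / cmod c" by (simp only: norm_inverse divide_inverse mult.commute)
      then have "cmod c * norm f \<le> norm ?g"
        using False by (simp add: pos_le_divide_eq mult.commute)
      then show ?thesis using le[of c f] by simp
    qed
  qed
qed

end

lemma dual_apply_add_right [simp]: "dual_apply f (x + y) = dual_apply f x + dual_apply f y"
  and dual_apply_scaleC_right [simp]: "dual_apply f (c *\<^sub>C x) = c * dual_apply f x"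
  by (transfer, simp add: clinear_def scaleC_complex_def)+

lemma dual_apply_add_left [simp]: "dual_apply (f + g) x = dual_apply f x + dual_apply g x"
  by transfer (simp add: blinfun.add_left)

lemma dual_apply_scaleC_left [simp]: "dual_apply (c *\<^sub>C f) x = c * dual_apply f x"
  by transfer (simp add: blinfun_cmult)

lemma norm_dual_apply: "cmod (dual_apply f x) \<le> norm f * norm x"
  by transfer (rule norm_blinfun)

lemma dual_eqI: "(\<And>x. dual_apply f x = dual_apply g x) \<Longrightarrow> f = g"
  by transfer (rule blinfun_eqI)

lemma norm_dual_bound:
  "0 \<le> b \<Longrightarrow> (\<And>x. cmod (dual_apply f x) \<le> b * norm x) \<Longrightarrow> norm f \<le> b"
  by transfer (rule norm_blinfun_bound)

text \<open>The functional with prescribed values; meaningful for bounded complex-linear functions only.\<close>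

definition Dual :: "('a::complex_normed_vector \<Rightarrow> complex) \<Rightarrow> 'a dual"
  where "Dual f = Abs_dual (Blinfun f)"

lemma dual_apply_Dual:
  assumes "clinear f" and "\<And>x. cmod (f x) \<le> K * norm x"
  shows "dual_apply (Dual f) = f"
proof -
  have "bounded_linear f"
  proof (rule bounded_linear_intro)
    show "f (x + y) = f x + f y" for x y using assms(1) by (simp add: clinear_def)
    show "f (r *\<^sub>R x) = r *\<^sub>R f x" for r x
      using assms(1) by (simp add: clinear_def scaleR_scaleC)
    show "norm (f x) \<le> norm x * K" for x using assms(2)[of x] by (simp add: mult.commute)
  qed
  then show ?thesis
    using assms(1) by (simp add: Dual_def dual_apply.rep_eq Abs_dual_inverse bounded_linear_Blinfun_apply)
qed

definition weak_star :: "'a::complex_normed_vector dual topology"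
  where "weak_star = pullback_topology UNIV dual_apply (product_topology (\<lambda>_. euclidean) UNIV)"


section \<open>The left Arens product\<close>

definition arens_fa :: "'a::complex_normed_algebra dual \<Rightarrow> 'a \<Rightarrow> 'a dual"
  where "arens_fa f a = Dual (\<lambda>b. dual_apply f (a * b))"

definition arens_Yf :: "'a::complex_normed_algebra dual dual \<Rightarrow> 'a dual \<Rightarrow> 'a dual"
  where "arens_Yf Y f = Dual (\<lambda>a. dual_apply Y (arens_fa f a))"

definition arens_mult ::
    "'a::complex_normed_algebra dual dual \<Rightarrow> 'a dual dual \<Rightarrow> 'a dual dual"  (infixl \<open>\<box>\<close> 70)
  where "X \<box> Y = Dual (\<lambda>f. dual_apply X (arens_Yf Y f))"

lemma bound_chain: "r \<le> K * s \<Longrightarrow> s \<le> p * q \<Longrightarrow> 0 \<le> K \<Longrightarrow> r \<le> K * p * (q::real)"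
  using mult_left_mono[of s "p * q" K] by (simp add: mult.assoc)

lemma arens_fa_apply: "dual_apply (arens_fa f a) b = dual_apply f (a * b)"
proof -
  have "cmod (dual_apply f (a * b)) \<le> (norm f * norm a) * norm b" for b
    by (rule bound_chain[OF norm_dual_apply[of f "a * b"] norm_mult_ineq[of a b] norm_ge_zero])
  moreover have "clinear (\<lambda>b. dual_apply f (a * b))"
    by (simp add: clinear_def distrib_left mult_scaleC_right scaleC_complex_def)
  ultimately show ?thesis
    unfolding arens_fa_def by (subst dual_apply_Dual) auto
qed

lemma norm_arens_fa: "norm (arens_fa f a) \<le> norm f * norm a"
proof (rule norm_dual_bound)
  show "cmod (dual_apply (arens_fa f a) b) \<le> norm f * norm a * norm b" for b
    unfolding arens_fa_apply by (rule bound_chain[OF norm_dual_apply[of f "a * b"] norm_mult_ineq[of a b] norm_ge_zero])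
qed simp

lemma arens_Yf_apply: "dual_apply (arens_Yf Y f) a = dual_apply Y (arens_fa f a)"
proof -
  have "cmod (dual_apply Y (arens_fa f a)) \<le> (norm Y * norm f) * norm a" for a
    by (rule bound_chain[OF norm_dual_apply[of Y "arens_fa f a"] norm_arens_fa[of f a] norm_ge_zero])
  moreover have "clinear (\<lambda>a. dual_apply Y (arens_fa f a))"
  proof -
    have "arens_fa f (a + b) = arens_fa f a + arens_fa f b" for a b
      by (rule dual_eqI) (simp add: arens_fa_apply distrib_right)
    moreover have "arens_fa f (c *\<^sub>C a) = c *\<^sub>C arens_fa f a" for a c
      by (rule dual_eqI) (simp add: arens_fa_apply mult_scaleC_left)
    ultimately show ?thesis by (simp add: clinear_def scaleC_complex_def)
  qed
  ultimately show ?thesis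
    unfolding arens_Yf_def by (subst dual_apply_Dual) auto
qed

lemma norm_arens_Yf: "norm (arens_Yf Y f) \<le> norm Y * norm f"
proof (rule norm_dual_bound)
  show "cmod (dual_apply (arens_Yf Y f) a) \<le> norm Y * norm f * norm a" for a
    unfolding arens_Yf_apply by (rule bound_chain[OF norm_dual_apply[of Y "arens_fa f a"] norm_arens_fa[of f a] norm_ge_zero])
qed simp

lemma arens_mult_apply:
  fixes X Y :: "'a::complex_normed_algebra dual dual"
  shows "dual_apply (X \<box> Y) f = dual_apply X (arens_Yf Y f)"
proof -
  have "cmod (dual_apply X (arens_Yf Y f)) \<le> (norm X * norm Y) * norm f" for f
    by (rule bound_chain[OF norm_dual_apply[of X "arens_Yf Y f"] norm_arens_Yf[of Y f] norm_ge_zero])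
  moreover have "clinear (\<lambda>f. dual_apply X (arens_Yf Y f))"
  proof -
    have "arens_fa (f + g) a = arens_fa f a + arens_fa g a" for f g :: "'a dual" and a
      by (rule dual_eqI) (simp add: arens_fa_apply)
    then have "arens_Yf Y (f + g) = arens_Yf Y f + arens_Yf Y g" for f g
      by (intro dual_eqI) (simp only: arens_Yf_apply dual_apply_add_left dual_apply_add_right)
    moreover have "arens_fa (c *\<^sub>C f) a = c *\<^sub>C arens_fa f a" for c and f :: "'a dual" and a
      by (rule dual_eqI) (simp add: arens_fa_apply)
    then have "arens_Yf Y (c *\<^sub>C f) = c *\<^sub>C arens_Yf Y f" for c f
      by (intro dual_eqI) (simp only: arens_Yf_apply dual_apply_scaleC_left dual_apply_scaleC_right)
    ultimately show ?thesis by (simp add: clinear_def scaleC_complex_def)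
  qed
  ultimately show ?thesis
    unfolding arens_mult_def by (subst dual_apply_Dual) auto
qed

definition arens_regular :: "'a::complex_banach_algebra itself \<Rightarrow> bool"
  where "arens_regular _ \<longleftrightarrow>
    (\<forall>X :: 'a dual dual. continuous_map weak_star weak_star (\<lambda>Y. X \<box> Y))"


section \<open>Scattered C*-algebras\<close>

text \<open>Boundedness is not required, since positive functionals are automatically bounded.\<close>

definition positive_functional :: "('a::cstar_algebra \<Rightarrow> complex) \<Rightarrow> bool"
  where "positive_functional f \<longleftrightarrow> clinear f \<and> (\<forall>a. f (adj a * a) \<in> \<real>\<^sub>\<ge>\<^sub>0)"

definition states :: "'a::cstar_algebra dual set"
  where "states = {\<phi>. positive_functional (dual_apply \<phi>) \<and> norm \<phi> = 1}"

definition pure_state :: "'a::cstar_algebra dual \<Rightarrow> bool"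
  where "pure_state \<phi> \<longleftrightarrow> \<phi> extreme_point_of states"

definition pure_functional :: "('a::cstar_algebra \<Rightarrow> complex) \<Rightarrow> bool"
  where "pure_functional p \<longleftrightarrow> (\<exists>r \<phi>. 0 \<le> r \<and> pure_state \<phi> \<and> p = dual_apply (r *\<^sub>R \<phi>))"

text \<open>The finite case with \<open>n = 0\<close> matters for the zero algebra, which has no pure states.\<close>

definition scattered :: "'a::cstar_algebra itself \<Rightarrow> bool"
  where "scattered _ \<longleftrightarrow>
    (\<forall>f :: 'a \<Rightarrow> complex. positive_functional f \<longrightarrow>
      (\<exists>p (n::nat). (\<forall>i<n. pure_functional (p i)) \<and> (\<forall>a. f a = (\<Sum>i<n. p i a))) \<or>
      (\<exists>p :: nat \<Rightarrow> 'a \<Rightarrow> complex. (\<forall>i. pure_functional (p i)) \<and> (\<forall>a. (\<lambda>i. p i a) sums f a)))"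


section \<open>The algebraic tensor product\<close>

definition bilinear_form :: "('a::complex_vector \<Rightarrow> 'b::complex_vector \<Rightarrow> complex) \<Rightarrow> bool"
  where "bilinear_form B \<longleftrightarrow> (\<forall>x. clinear (B x)) \<and> (\<forall>y. clinear (\<lambda>x. B x y))"

text \<open>
  The elementary tensor of \<open>x\<close> and \<open>y\<close> is the evaluation \<open>B \<mapsto> B x y\<close> on the space of all bilinear
  forms, and the algebraic tensor product consists of the finite sums of elementary tensors. The
  value at functions that are not bilinear is fixed to be \<open>0\<close>. That this is the algebraic tensor
  product is confirmed by its universal property, lemma \<open>alg_tensor_universal\<close> below.
\<close>

definition tensor_sum ::
    "('a::complex_vector \<times> 'b::complex_vector) list \<Rightarrow> ('a \<Rightarrow> 'b \<Rightarrow> complex) \<Rightarrow> complex"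
  where "tensor_sum xs B = (if bilinear_form B then \<Sum>(x, y)\<leftarrow>xs. B x y else 0)"

typedef (overloaded) ('a::complex_vector, 'b::complex_vector) alg_tensor =
  "range (tensor_sum :: ('a \<times> 'b) list \<Rightarrow> _)"
  morphisms tensor_eval Abs_alg_tensor
  by blast

setup_lifting type_definition_alg_tensor

lemma bilinear_formD:
  assumes "bilinear_form B"
  shows "B (x + x') y = B x y + B x' y" "B x (y + y') = B x y + B x y'"
    "B (c *\<^sub>C x) y = c * B x y" "B x (c *\<^sub>C y) = c * B x y"
    "B (- x) y = - B x y" "B x (- y) = - B x y" "B 0 y = 0" "B x 0 = 0"
proof -
  show *: "B (x + x') y = B x y + B x' y" "B x (y + y') = B x y + B x y'"
    "B (c *\<^sub>C x) y = c * B x y" "B x (c *\<^sub>C y) = c * B x y" for x x' y y' c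
    using assms by (auto simp: bilinear_form_def clinear_def scaleC_complex_def)
  show "B (- x) y = - B x y" using *(3)[of "-1" x y] by (simp add: scaleC_minus1)
  show "B x (- y) = - B x y" using *(4)[of x "-1" y] by (simp add: scaleC_minus1)
  show "B 0 y = 0" using *(3)[of 0 0 y] by simp
  show "B x 0 = 0" using *(4)[of x 0 0] by simp
qed

lemma bilinear_formI:
  assumes "\<And>x x' y. B (x + x') y = B x y + B x' y" "\<And>x y y'. B x (y + y') = B x y + B x y'"
    "\<And>c x y. B (c *\<^sub>C x) y = c * B x y" "\<And>c x y. B x (c *\<^sub>C y) = c * B x y"
  shows "bilinear_form B"
  using assms by (simp add: bilinear_form_def clinear_def scaleC_complex_def)

lemma tensor_sum_append: "tensor_sum (xs @ ys) = (\<lambda>B. tensor_sum xs B + tensor_sum ys B)"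
  by (rule ext) (simp add: tensor_sum_def)

lemma tensor_sum_scale: "tensor_sum (map (\<lambda>(x, y). (c *\<^sub>C x, y)) xs) = (\<lambda>B. c * tensor_sum xs B)"
proof (rule ext)
  fix B
  show "tensor_sum (map (\<lambda>(x, y). (c *\<^sub>C x, y)) xs) B = c * tensor_sum xs B"
    by (induction xs) (auto simp: tensor_sum_def bilinear_formD algebra_simps)
qed

instantiation alg_tensor :: (complex_vector, complex_vector) complex_vector
begin

lift_definition zero_alg_tensor :: "('a, 'b) alg_tensor" is "\<lambda>_. 0"
  by (rule range_eqI[of _ _ "[]"]) (simp add: tensor_sum_def fun_eq_iff)

lift_definition plus_alg_tensor ::
    "('a, 'b) alg_tensor \<Rightarrow> ('a, 'b) alg_tensor \<Rightarrow> ('a, 'b) alg_tensor"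
  is "\<lambda>u v B. u B + v B"
  by (auto simp: tensor_sum_append[symmetric])

lift_definition scaleC_alg_tensor :: "complex \<Rightarrow> ('a, 'b) alg_tensor \<Rightarrow> ('a, 'b) alg_tensor"
  is "\<lambda>c u B. c * u B"
  by (auto simp: tensor_sum_scale[symmetric])

definition scaleR_alg_tensor :: "real \<Rightarrow> ('a, 'b) alg_tensor \<Rightarrow> ('a, 'b) alg_tensor"
  where "scaleR_alg_tensor r u = complex_of_real r *\<^sub>C u"

definition uminus_alg_tensor :: "('a, 'b) alg_tensor \<Rightarrow> ('a, 'b) alg_tensor"
  where "uminus_alg_tensor u = (-1) *\<^sub>C u"

definition minus_alg_tensor ::
    "('a, 'b) alg_tensor \<Rightarrow> ('a, 'b) alg_tensor \<Rightarrow> ('a, 'b) alg_tensor"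
  where "minus_alg_tensor u v = u + - v"

instance
proof
  fix u v w :: "('a, 'b) alg_tensor" and r s :: real and c d :: complex
  show "u + v + w = u + (v + w)" by transfer (simp add: add.assoc)
  show "u + v = v + u" by transfer (simp add: add.commute)
  show "0 + u = u" by transfer simp
  show "- u + u = 0" unfolding uminus_alg_tensor_def by transfer simp
  show "u - v = u + - v" by (rule minus_alg_tensor_def)
  show "r *\<^sub>R (u + v) = r *\<^sub>R u + r *\<^sub>R v"
    unfolding scaleR_alg_tensor_def by transfer (simp add: algebra_simps)
  show "(r + s) *\<^sub>R u = r *\<^sub>R u + s *\<^sub>R u"
    unfolding scaleR_alg_tensor_def by transfer (simp add: algebra_simps)
  show "r *\<^sub>R s *\<^sub>R u = (r * s) *\<^sub>R u"
    unfolding scaleR_alg_tensor_def by transfer (simp add: algebra_simps)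
  show "1 *\<^sub>R u = u"
    unfolding scaleR_alg_tensor_def by transfer simp
  show "c *\<^sub>C (u + v) = c *\<^sub>C u + c *\<^sub>C v" by transfer (simp add: algebra_simps)
  show "(c + d) *\<^sub>C u = c *\<^sub>C u + d *\<^sub>C u" by transfer (simp add: algebra_simps)
  show "c *\<^sub>C d *\<^sub>C u = (c * d) *\<^sub>C u" by transfer (simp add: algebra_simps)
  show "r *\<^sub>R u = complex_of_real r *\<^sub>C u" by (rule scaleR_alg_tensor_def)
qed

end

lift_definition tensor ::
    "'a::complex_vector \<Rightarrow> 'b::complex_vector \<Rightarrow> ('a, 'b) alg_tensor"  (infixr \<open>\<otimes>\<close> 76)
  is "\<lambda>x y. tensor_sum [(x, y)]"
  by blast

lemma tensor_eval_tensor: "bilinear_form B \<Longrightarrow> tensor_eval (x \<otimes> y) B = B x y"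
  by transfer (simp add: tensor_sum_def)

lemma tensor_eval_add: "tensor_eval (u + v) B = tensor_eval u B + tensor_eval v B"
  by transfer simp

lemma tensor_eval_scaleC: "tensor_eval (c *\<^sub>C u) B = c * tensor_eval u B"
  by transfer simp

lemma tensor_eval_sum_list: "tensor_eval (\<Sum>(x, y)\<leftarrow>xs. x \<otimes> y) = tensor_sum xs"
proof (induction xs)
  case Nil
  then show ?case by (simp add: zero_alg_tensor.rep_eq tensor_sum_def fun_eq_iff)
next
  case (Cons p xs)
  obtain x y where p: "p = (x, y)" by (cases p)
  show ?case
    using Cons tensor_sum_append[of "[p]" xs]
    by (auto simp: p plus_alg_tensor.rep_eq tensor.rep_eq fun_eq_iff)
qed

lemma alg_tensor_eqI:
  assumes "\<And>B. bilinear_form B \<Longrightarrow> tensor_eval u B = tensor_eval v B"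
  shows "u = v"
proof -
  have "tensor_eval u B = tensor_eval v B" for B
  proof (cases "bilinear_form B")
    case False
    then have "tensor_eval w B = 0" for w :: "('a, 'b) alg_tensor"
      using tensor_eval[of w] by (auto simp: tensor_sum_def)
    then show ?thesis by simp
  qed (rule assms)
  then show ?thesis by (simp add: tensor_eval_inject[symmetric] fun_eq_iff)
qed

lemma alg_tensor_repr: "\<exists>xs. u = (\<Sum>(x, y)\<leftarrow>xs. x \<otimes> y)"
proof -
  obtain xs where "tensor_eval u = tensor_sum xs" using tensor_eval[of u] by auto
  then have "u = (\<Sum>(x, y)\<leftarrow>xs. x \<otimes> y)"
    by (simp add: tensor_eval_inject[symmetric] tensor_eval_sum_list)
  then show ?thesis ..
qed

lemma tensor_bilinear:
  "(x + x') \<otimes> y = x \<otimes> y + x' \<otimes> y" "x \<otimes> (y + y') = x \<otimes> y + x \<otimes> y'"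
  "(c *\<^sub>C x) \<otimes> y = c *\<^sub>C (x \<otimes> y)" "x \<otimes> (c *\<^sub>C y) = c *\<^sub>C (x \<otimes> y)"
  by (auto intro!: alg_tensor_eqI
      simp: tensor_eval_tensor tensor_eval_add tensor_eval_scaleC bilinear_formD)

lemma clinear_functional_separates:
  fixes w :: "'a::complex_vector"
  assumes "w \<noteq> 0"
  obtains \<phi> :: "'a \<Rightarrow> complex" where "clinear \<phi>" "\<phi> w \<noteq> 0"
proof -
  interpret V: vector_space "scaleC :: complex \<Rightarrow> 'a \<Rightarrow> 'a"
    by standard (simp_all add: scaleC_add_right scaleC_add_left scaleC_scaleC)
  interpret W: vector_space "(*) :: complex \<Rightarrow> complex \<Rightarrow> complex"
    by standard (simp_all add: algebra_simps)
  interpret P: vector_space_pair "scaleC :: complex \<Rightarrow> 'a \<Rightarrow> 'a" "(*) :: complex \<Rightarrow> complex \<Rightarrow> complex"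
    by standard
  have "\<not> V.dependent {w}" using assms by simp
  from P.linear_independent_extend[OF this, of "\<lambda>_. 1"] obtain g
    where g: "Vector_Spaces.linear scaleC (*) g" "g w = 1" by auto
  interpret g: Vector_Spaces.linear scaleC "(*)" g by (rule g(1))
  show ?thesis
    by (rule that[of g]) (simp_all add: clinear_def scaleC_complex_def g.add g.scale g(2))
qed

lemma alg_tensor_universal:
  fixes \<Phi> :: "'a::complex_vector \<Rightarrow> 'b::complex_vector \<Rightarrow> 'c::complex_vector"
  assumes "\<And>x. clinear (\<Phi> x)" "\<And>y. clinear (\<lambda>x. \<Phi> x y)"
  shows "\<exists>!L. clinear L \<and> (\<forall>x y. L (x \<otimes> y) = \<Phi> x y)"
proof -
  define val where "val xs = (\<Sum>(x, y)\<leftarrow>xs. \<Phi> x y)" for xs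
  have val: "val xs = val ys" if eq: "tensor_sum xs = tensor_sum ys" for xs ys
  proof (rule ccontr)
    assume "val xs \<noteq> val ys"
    then obtain \<phi> :: "'c \<Rightarrow> complex" where \<phi>: "clinear \<phi>" "\<phi> (val xs - val ys) \<noteq> 0"
      using clinear_functional_separates[of "val xs - val ys"] by auto
    have add: "\<phi> (a + b) = \<phi> a + \<phi> b" for a b using \<phi>(1) by (simp add: clinear_def)
    have \<phi>0: "\<phi> 0 = 0" using add[of 0 0] by simp
    have B: "bilinear_form (\<lambda>x y. \<phi> (\<Phi> x y))"
      using \<phi>(1) assms by (auto simp: bilinear_form_def clinear_def)
    have "\<phi> (val zs) = tensor_sum zs (\<lambda>x y. \<phi> (\<Phi> x y))" for zs
      by (induction zs) (auto simp: val_def tensor_sum_def B add \<phi>0)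
    then have "\<phi> (val xs) = \<phi> (val ys)" using eq by simp
    then show False using \<phi>(2) add[of "val xs - val ys" "val ys"] by simp
  qed
  define L where "L u = val (SOME xs. tensor_eval u = tensor_sum xs)" for u
  have L: "L u = val xs" if "tensor_eval u = tensor_sum xs" for u xs
    unfolding L_def
    by (rule someI2[where P = "\<lambda>zs. tensor_eval u = tensor_sum zs" and Q = "\<lambda>zs. val zs = val xs"])
      (auto intro!: val simp: that)
  have ex: "\<exists>xs. tensor_eval u = tensor_sum xs" for u :: "('a, 'b) alg_tensor"
    using tensor_eval[of u] by auto
  have scale: "val (map (\<lambda>(x, y). (c *\<^sub>C x, y)) xs) = c *\<^sub>C val xs" for c xs
    using assms(2) by (induction xs) (auto simp: val_def clinear_def scaleC_add_right)
  have lin: "clinear L"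
    unfolding clinear_def
  proof (intro conjI allI)
    fix u v :: "('a, 'b) alg_tensor" and c
    obtain xs ys where xs: "tensor_eval u = tensor_sum xs" and ys: "tensor_eval v = tensor_sum ys"
      using ex by metis
    have "tensor_eval (u + v) = tensor_sum (xs @ ys)"
      by (simp add: plus_alg_tensor.rep_eq xs ys tensor_sum_append)
    then show "L (u + v) = L u + L v" using L xs ys by (simp add: val_def)
    have "tensor_eval (c *\<^sub>C u) = tensor_sum (map (\<lambda>(x, y). (c *\<^sub>C x, y)) xs)"
      by (simp add: scaleC_alg_tensor.rep_eq xs tensor_sum_scale)
    then show "L (c *\<^sub>C u) = c *\<^sub>C L u" using L xs scale by metis
  qed
  have LT: "L (x \<otimes> y) = \<Phi> x y" for x y
    using L[OF tensor.rep_eq] by (simp add: val_def)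
  show ?thesis
  proof (rule ex1I[of _ L])
    show "clinear L \<and> (\<forall>x y. L (x \<otimes> y) = \<Phi> x y)" using lin LT by simp
  next
    fix M assume M: "clinear M \<and> (\<forall>x y. M (x \<otimes> y) = \<Phi> x y)"
    have zero: "F 0 = 0" if "clinear F" for F :: "('a, 'b) alg_tensor \<Rightarrow> 'c"
      using that unfolding clinear_def by (metis add_cancel_right_right)
    have eq: "M (\<Sum>(x, y)\<leftarrow>xs. x \<otimes> y) = L (\<Sum>(x, y)\<leftarrow>xs. x \<otimes> y)" for xs
    proof (induction xs)
      case Nil
      have "M 0 = 0" "L 0 = 0" using zero M lin by blast+
      then show ?case by simp
    next
      case (Cons p xs)
      then show ?case using M lin LT by (cases p) (auto simp: clinear_def)
    qed
    show "M = L"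
    proof
      fix u show "M u = L u" using alg_tensor_repr[of u] eq by auto
    qed
  qed
qed


text \<open>The product is determined by \<open>(a \<otimes> b) * (c \<otimes> d) = (a * c) \<otimes> (b * d)\<close>, lemma \<open>tensor_mult\<close> below.\<close>

lemma bilinear_form_mult:
  fixes B :: "'a::complex_normed_algebra \<Rightarrow> 'b::complex_normed_algebra \<Rightarrow> complex"
  assumes "bilinear_form B"
  shows "bilinear_form (\<lambda>c d. B (a * c) (b * d))"
  using assms by (intro bilinear_formI) (simp_all add: bilinear_formD distrib_left mult_scaleC_right)

lemma bilinear_form_tensor_sum:
  fixes B :: "'a::complex_normed_algebra \<Rightarrow> 'b::complex_normed_algebra \<Rightarrow> complex"
  assumes B: "bilinear_form B"
  shows "bilinear_form (\<lambda>a b. tensor_sum ys (\<lambda>c d. B (a * c) (b * d)))"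
proof (induction ys)
  case Nil
  show ?case by (rule bilinear_formI) (simp_all add: tensor_sum_def)
next
  case (Cons p ys)
  have eq: "tensor_sum (p # ys) (\<lambda>c d. B (a * c) (b * d)) =
      B (a * fst p) (b * snd p) + tensor_sum ys (\<lambda>c d. B (a * c) (b * d))" for a b
    by (simp add: tensor_sum_def bilinear_form_mult[OF B] case_prod_beta)
  note IH = bilinear_formD[OF Cons]
  show ?case
    unfolding eq
    by (intro bilinear_formI)
      (simp_all only: IH, simp_all add: bilinear_formD[OF B] distrib_right distrib_left mult_scaleC_left)
qed

lemma tensor_sum_times:
  fixes B :: "'a::complex_normed_algebra \<Rightarrow> 'b::complex_normed_algebra \<Rightarrow> complex"
  assumes B: "bilinear_form B"
  shows "tensor_sum (concat (map (\<lambda>(a, b). map (\<lambda>(c, d). (a * c, b * d)) ys) xs)) B =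
    tensor_sum xs (\<lambda>a b. tensor_sum ys (\<lambda>c d. B (a * c) (b * d)))"
proof (induction xs)
  case Nil
  show ?case by (simp add: tensor_sum_def)
next
  case (Cons p xs)
  let ?F = "\<lambda>a b. tensor_sum ys (\<lambda>c d. B (a * c) (b * d))"
  have 1: "tensor_sum (p # xs) ?F = ?F (fst p) (snd p) + tensor_sum xs ?F"
    using bilinear_form_tensor_sum[OF B, of ys] by (simp add: tensor_sum_def case_prod_beta)
  have 2: "tensor_sum (map (\<lambda>(c, d). (a * c, b * d)) ys) B = ?F a b" for a b
    by (simp add: tensor_sum_def B bilinear_form_mult[OF B] case_prod_beta' o_def)
  have "tensor_sum (concat (map (\<lambda>(a, b). map (\<lambda>(c, d). (a * c, b * d)) ys) (p # xs))) B =
      tensor_sum (map (\<lambda>(c, d). (fst p * c, snd p * d)) ys) B +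
      tensor_sum (concat (map (\<lambda>(a, b). map (\<lambda>(c, d). (a * c, b * d)) ys) xs)) B"
    by (simp add: tensor_sum_append case_prod_beta)
  then show ?case unfolding 1 2 Cons .
qed

instantiation alg_tensor :: (complex_normed_algebra, complex_normed_algebra) ring
begin

lift_definition times_alg_tensor ::
    "('a, 'b) alg_tensor \<Rightarrow> ('a, 'b) alg_tensor \<Rightarrow> ('a, 'b) alg_tensor"
  is "\<lambda>u v B. if bilinear_form B then u (\<lambda>a b. v (\<lambda>c d. B (a * c) (b * d))) else 0"
proof -
  fix u v :: "('a \<Rightarrow> 'b \<Rightarrow> complex) \<Rightarrow> complex"
  assume "u \<in> range tensor_sum" "v \<in> range tensor_sum"
  then obtain xs ys where uv: "u = tensor_sum xs" "v = tensor_sum ys" by auto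
  have "(\<lambda>B. if bilinear_form B then u (\<lambda>a b. v (\<lambda>c d. B (a * c) (b * d))) else 0) =
      tensor_sum (concat (map (\<lambda>(a, b). map (\<lambda>(c, d). (a * c, b * d)) ys) xs))"
  proof
    fix B :: "'a \<Rightarrow> 'b \<Rightarrow> complex"
    show "(if bilinear_form B then u (\<lambda>a b. v (\<lambda>c d. B (a * c) (b * d))) else 0) =
      tensor_sum (concat (map (\<lambda>(a, b). map (\<lambda>(c, d). (a * c, b * d)) ys) xs)) B"
    proof (cases "bilinear_form B")
      case True
      then show ?thesis by (simp add: uv tensor_sum_times)
    next
      case False
      then show ?thesis by (simp add: tensor_sum_def)
    qed
  qed
  then show "(\<lambda>B. if bilinear_form B then u (\<lambda>a b. v (\<lambda>c d. B (a * c) (b * d))) else 0)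
      \<in> range tensor_sum" by (metis rangeI)
qed

instance
proof
  fix u v w :: "('a, 'b) alg_tensor"
  have bil: "bilinear_form (\<lambda>a b. tensor_eval v (\<lambda>c d. B (a * c) (b * d)))"
    if "bilinear_form B" for v :: "('a, 'b) alg_tensor" and B
    using tensor_eval[of v] bilinear_form_tensor_sum[OF that] by auto
  have lin: "tensor_eval u (\<lambda>a b. F a b + G a b) = tensor_eval u F + tensor_eval u G"
    if "bilinear_form F" "bilinear_form G" for u :: "('a, 'b) alg_tensor" and F G
  proof -
    obtain xs where xs: "tensor_eval u = tensor_sum xs" using tensor_eval[of u] by auto
    have "bilinear_form (\<lambda>a b. F a b + G a b)"
      by (intro bilinear_formI) (simp_all add: bilinear_formD[OF that(1)] bilinear_formD[OF that(2)] algebra_simps)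
    then show ?thesis
      unfolding xs by (induction xs) (auto simp: tensor_sum_def that)
  qed
  show "u * v * w = u * (v * w)"
    by (rule alg_tensor_eqI)
      (simp add: times_alg_tensor.rep_eq bil bilinear_form_mult mult.assoc)
  show "(u + v) * w = u * w + v * w"
    by (rule alg_tensor_eqI) (simp add: times_alg_tensor.rep_eq plus_alg_tensor.rep_eq)
  show "u * (v + w) = u * v + u * w"
    by (rule alg_tensor_eqI) (simp add: times_alg_tensor.rep_eq plus_alg_tensor.rep_eq lin bil)
qed

end

lemma tensor_mult: "(a \<otimes> b) * (c \<otimes> d) = (a * c) \<otimes> (b * d)"
  for a c :: "'a::complex_normed_algebra" and b d :: "'b::complex_normed_algebra"
proof (rule alg_tensor_eqI)
  fix B :: "'a \<Rightarrow> 'b \<Rightarrow> complex"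
  assume B: "bilinear_form B"
  have "bilinear_form (\<lambda>a b. tensor_eval (c \<otimes> d) (\<lambda>c d. B (a * c) (b * d)))"
    using bilinear_form_tensor_sum[OF B, of "[(c, d)]"] by (simp add: tensor.rep_eq)
  then show "tensor_eval ((a \<otimes> b) * (c \<otimes> d)) B = tensor_eval ((a * c) \<otimes> (b * d)) B"
    by (simp add: times_alg_tensor.rep_eq B tensor_eval_tensor bilinear_form_mult)
qed

lemma alg_tensor_mult_scaleC:
  fixes u v :: "('a::complex_normed_algebra, 'b::complex_normed_algebra) alg_tensor"
  shows "(c *\<^sub>C u) * v = c *\<^sub>C (u * v)" and "u * (c *\<^sub>C v) = c *\<^sub>C (u * v)"
proof -
  show "(c *\<^sub>C u) * v = c *\<^sub>C (u * v)"
    by (rule alg_tensor_eqI) (simp add: times_alg_tensor.rep_eq scaleC_alg_tensor.rep_eq)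
  have hom: "tensor_eval u (\<lambda>a b. c * F a b) = c * tensor_eval u F" if "bilinear_form F" for F
  proof -
    obtain xs where xs: "tensor_eval u = tensor_sum xs" using tensor_eval[of u] by auto
    have "bilinear_form (\<lambda>a b. c * F a b)"
      by (intro bilinear_formI) (simp_all add: bilinear_formD[OF that] algebra_simps)
    then show ?thesis
      unfolding xs by (induction xs) (auto simp: tensor_sum_def that algebra_simps)
  qed
  show "u * (c *\<^sub>C v) = c *\<^sub>C (u * v)"
  proof (rule alg_tensor_eqI)
    fix B :: "'a \<Rightarrow> 'b \<Rightarrow> complex"
    assume B: "bilinear_form B"
    have "bilinear_form (\<lambda>a b. tensor_eval v (\<lambda>c d. B (a * c) (b * d)))"
      using tensor_eval[of v] bilinear_form_tensor_sum[OF B] by auto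
    then show "tensor_eval (u * (c *\<^sub>C v)) B = tensor_eval (c *\<^sub>C (u * v)) B"
      by (simp add: times_alg_tensor.rep_eq scaleC_alg_tensor.rep_eq B hom)
  qed
qed


section \<open>The projective tensor norm\<close>

definition gamma_norm ::
    "('a::complex_normed_vector, 'b::complex_normed_vector) alg_tensor \<Rightarrow> real"
  where "gamma_norm u = Inf {\<Sum>(x, y)\<leftarrow>xs. norm x * norm y | xs. u = (\<Sum>(x, y)\<leftarrow>xs. x \<otimes> y)}"

lemma cost_nonneg: "0 \<le> (\<Sum>(x, y)\<leftarrow>xs. norm x * norm y)"
  by (rule sum_list_nonneg) auto

lemma gamma_norm_le:
  assumes "u = (\<Sum>(x, y)\<leftarrow>xs. x \<otimes> y)"
  shows "gamma_norm u \<le> (\<Sum>(x, y)\<leftarrow>xs. norm x * norm y)"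
  unfolding gamma_norm_def
proof (rule cInf_lower)
  show "bdd_below {\<Sum>(x, y)\<leftarrow>xs. norm x * norm y | xs. u = (\<Sum>(x, y)\<leftarrow>xs. x \<otimes> y)}"
    by (rule bdd_belowI[of _ 0]) (auto intro: cost_nonneg)
qed (use assms in auto)

lemma gamma_norm_approx:
  assumes "0 < e"
  obtains xs where "u = (\<Sum>(x, y)\<leftarrow>xs. x \<otimes> y)" "(\<Sum>(x, y)\<leftarrow>xs. norm x * norm y) < gamma_norm u + e"
proof -
  have "{\<Sum>(x, y)\<leftarrow>xs. norm x * norm y | xs. u = (\<Sum>(x, y)\<leftarrow>xs. x \<otimes> y)} \<noteq> {}"
    using alg_tensor_repr[of u] by blast
  from cInf_lessD[OF this, of "gamma_norm u + e"] assms that show thesis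
    unfolding gamma_norm_def by auto
qed

lemma gamma_norm_nonneg: "0 \<le> gamma_norm u"
  unfolding gamma_norm_def
  by (rule cInf_greatest) (use alg_tensor_repr[of u] in \<open>auto intro: cost_nonneg\<close>)

lemma gamma_norm_zero [simp]: "gamma_norm 0 = 0"
proof (rule antisym)
  show "gamma_norm 0 \<le> 0" by (rule order_trans[OF gamma_norm_le[of _ "[]"]]) simp_all
qed (rule gamma_norm_nonneg)

lemma gamma_norm_triangle: "gamma_norm (u + v) \<le> gamma_norm u + gamma_norm v"
proof (rule field_le_epsilon)
  fix e :: real
  assume "0 < e"
  then have e: "0 < e / 2" by simp
  obtain xs where xs: "u = (\<Sum>(x, y)\<leftarrow>xs. x \<otimes> y)" "(\<Sum>(x, y)\<leftarrow>xs. norm x * norm y) < gamma_norm u + e / 2"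
    using gamma_norm_approx[OF e] .
  obtain ys where ys: "v = (\<Sum>(x, y)\<leftarrow>ys. x \<otimes> y)" "(\<Sum>(x, y)\<leftarrow>ys. norm x * norm y) < gamma_norm v + e / 2"
    using gamma_norm_approx[OF e] .
  have "gamma_norm (u + v) \<le> (\<Sum>(x, y)\<leftarrow>xs @ ys. norm x * norm y)"
    by (rule gamma_norm_le) (simp add: xs(1) ys(1))
  then show "gamma_norm (u + v) \<le> gamma_norm u + gamma_norm v + e"
    using xs(2) ys(2) by simp
qed

lemma gamma_norm_scaleC: "gamma_norm (c *\<^sub>C u) = cmod c * gamma_norm u"
proof -
  have le: "gamma_norm (c *\<^sub>C u) \<le> cmod c * gamma_norm u" if "c \<noteq> 0" for c and u :: "('a, 'b) alg_tensor"
  proof (rule field_le_epsilon)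
    fix e :: real
    assume "0 < e"
    then have e: "0 < e / cmod c" using that by simp
    obtain xs where xs: "u = (\<Sum>(x, y)\<leftarrow>xs. x \<otimes> y)" "(\<Sum>(x, y)\<leftarrow>xs. norm x * norm y) < gamma_norm u + e / cmod c"
      using gamma_norm_approx[OF e] .
    have 1: "c *\<^sub>C (\<Sum>(x, y)\<leftarrow>xs. x \<otimes> y) = (\<Sum>(x, y)\<leftarrow>map (\<lambda>(x, y). (c *\<^sub>C x, y)) xs. x \<otimes> y)"
      for xs :: "('a \<times> 'b) list"
      by (induction xs) (auto simp: scaleC_add_right tensor_bilinear)
    have 2: "(\<Sum>(x, y)\<leftarrow>map (\<lambda>(x, y). (c *\<^sub>C x, y)) xs. norm x * norm y) =
        cmod c * (\<Sum>(x, y)\<leftarrow>xs. norm x * norm y)" for xs :: "('a \<times> 'b) list"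
      by (induction xs) (auto simp: norm_scaleC algebra_simps)
    have "gamma_norm (c *\<^sub>C u) \<le> cmod c * (\<Sum>(x, y)\<leftarrow>xs. norm x * norm y)"
      unfolding 2[symmetric] by (rule gamma_norm_le) (simp only: xs(1) 1)
    also have "\<dots> \<le> cmod c * (gamma_norm u + e / cmod c)"
      using xs(2) by (intro mult_left_mono) auto
    also have "\<dots> = cmod c * gamma_norm u + e" using that by (simp add: distrib_left)
    finally show "gamma_norm (c *\<^sub>C u) \<le> cmod c * gamma_norm u + e" .
  qed
  show ?thesis
  proof (cases "c = 0")
    case False
    have "gamma_norm (inverse c *\<^sub>C (c *\<^sub>C u)) \<le> cmod (inverse c) * gamma_norm (c *\<^sub>C u)"
      using False by (intro le) simp
    then have "gamma_norm u \<le> gamma_norm (c *\<^sub>C u) / cmod c"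
      using False by (simp add: scaleC_scaleC norm_inverse divide_inverse mult.commute)
    then have "cmod c * gamma_norm u \<le> gamma_norm (c *\<^sub>C u)"
      using False by (simp add: pos_le_divide_eq mult.commute)
    then show ?thesis using le[OF False, of u] by simp
  qed simp
qed

lemma gamma_norm_minus [simp]: "gamma_norm (- u) = gamma_norm u"
  using gamma_norm_scaleC[of "-1" u] by (simp add: scaleC_minus1)

lemma gamma_norm_minus_commute: "gamma_norm (u - v) = gamma_norm (v - u)"
  using gamma_norm_minus[of "u - v"] by simp

lemma gamma_norm_diff_triangle: "gamma_norm (u - w) \<le> gamma_norm (u - v) + gamma_norm (v - w)"
  using gamma_norm_triangle[of "u - v" "v - w"] by simp

lemma gamma_norm_abs_diff: "\<bar>gamma_norm u - gamma_norm v\<bar> \<le> gamma_norm (u - v)"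
  using gamma_norm_triangle[of "u - v" v] gamma_norm_triangle[of "v - u" u]
  by (simp add: gamma_norm_minus_commute[of v u])

lemma gamma_norm_mult:
  fixes u v :: "('a::complex_normed_algebra, 'b::complex_normed_algebra) alg_tensor"
  shows "gamma_norm (u * v) \<le> gamma_norm u * gamma_norm v"
proof -
  have *: "gamma_norm (u * v) \<le> (gamma_norm u + e) * (gamma_norm v + e)" if e: "0 < e" for e
  proof -
    obtain xs where xs: "u = (\<Sum>(x, y)\<leftarrow>xs. x \<otimes> y)" "(\<Sum>(x, y)\<leftarrow>xs. norm x * norm y) < gamma_norm u + e"
      using gamma_norm_approx[OF e] .
    obtain ys where ys: "v = (\<Sum>(x, y)\<leftarrow>ys. x \<otimes> y)" "(\<Sum>(x, y)\<leftarrow>ys. norm x * norm y) < gamma_norm v + e"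
      using gamma_norm_approx[OF e] .
    let ?c = "\<lambda>xs. \<Sum>(x, y)\<leftarrow>xs. norm x * norm y :: real"
    let ?p = "\<lambda>(a, b) ys. map (\<lambda>(c, d). (a * c, b * d)) ys"
    have 1: "(a \<otimes> b) * (\<Sum>(x, y)\<leftarrow>ys. x \<otimes> y) = (\<Sum>(x, y)\<leftarrow>?p (a, b) ys. x \<otimes> y)"
      for a b and ys :: "('a \<times> 'b) list"
      by (induction ys) (auto simp: distrib_left tensor_mult)
    have 2: "(\<Sum>(x, y)\<leftarrow>xs. x \<otimes> y) * (\<Sum>(x, y)\<leftarrow>ys. x \<otimes> y) =
        (\<Sum>(x, y)\<leftarrow>concat (map (\<lambda>p. ?p p ys) xs). x \<otimes> y)" for xs ys :: "('a \<times> 'b) list"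
    proof (induction xs)
      case (Cons p xs)
      obtain a b where "p = (a, b)" by (cases p)
      then show ?case using Cons 1[of a b ys] by (simp add: distrib_right)
    qed simp
    have 3: "?c (?p (a, b) ys) \<le> norm a * norm b * ?c ys" for a b and ys :: "('a \<times> 'b) list"
    proof (induction ys)
      case (Cons p ys)
      obtain c d where p: "p = (c, d)" by (cases p)
      have "norm (a * c) * norm (b * d) \<le> (norm a * norm c) * (norm b * norm d)"
        by (intro mult_mono norm_mult_ineq) auto
      then show ?case using Cons by (simp add: p algebra_simps)
    qed simp
    have 4: "?c (concat (map (\<lambda>p. ?p p ys) xs)) \<le> ?c xs * ?c ys" for xs ys :: "('a \<times> 'b) list"
    proof (induction xs)
      case (Cons p xs)
      obtain a b where p: "p = (a, b)" by (cases p)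
      show ?case using Cons 3[of a b ys] by (simp add: p distrib_right)
    qed simp
    have "gamma_norm (u * v) \<le> ?c (concat (map (\<lambda>p. ?p p ys) xs))"
      by (rule gamma_norm_le) (simp only: xs(1) ys(1) 2)
    also have "\<dots> \<le> ?c xs * ?c ys" by (rule 4)
    also have "\<dots> \<le> (gamma_norm u + e) * (gamma_norm v + e)"
      using xs(2) ys(2) cost_nonneg[of xs] cost_nonneg[of ys] by (intro mult_mono) linarith+
    finally show ?thesis .
  qed
  have lim: "((\<lambda>e. (gamma_norm u + e) * (gamma_norm v + e)) \<longlongrightarrow> (gamma_norm u + 0) * (gamma_norm v + 0))
      (at_right 0)"
    by (intro tendsto_intros)
  have "gamma_norm (u * v) \<le> (gamma_norm u + 0) * (gamma_norm v + 0)"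
    by (rule tendsto_lowerbound[OF lim]) (auto simp: eventually_at_right_less * intro!: eventually_mono[OF eventually_at_right_less])
  then show ?thesis by simp
qed


section \<open>The projective tensor product\<close>

text \<open>
  The completion of \<open>(alg_tensor, gamma_norm)\<close>, as Cauchy sequences modulo null sequences. This
  construction works for a seminorm; that \<open>gamma_norm\<close> is a norm is not needed here.
\<close>

lifting_forget alg_tensor.lifting

definition gamma_Cauchy ::
    "(nat \<Rightarrow> ('a::complex_normed_vector, 'b::complex_normed_vector) alg_tensor) \<Rightarrow> bool"
  where "gamma_Cauchy U \<longleftrightarrow> (\<forall>e>0. \<exists>N. \<forall>m\<ge>N. \<forall>n\<ge>N. gamma_norm (U m - U n) < e)"

definition gamma_equiv ::
    "(nat \<Rightarrow> ('a::complex_normed_vector, 'b::complex_normed_vector) alg_tensor) \<Rightarrow>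
     (nat \<Rightarrow> ('a, 'b) alg_tensor) \<Rightarrow> bool"
  where "gamma_equiv U V \<longleftrightarrow>
    gamma_Cauchy U \<and> gamma_Cauchy V \<and> (\<lambda>n. gamma_norm (U n - V n)) \<longlonglongrightarrow> 0"

lemma gamma_CauchyD:
  "gamma_Cauchy U \<Longrightarrow> 0 < e \<Longrightarrow> \<exists>N. \<forall>m\<ge>N. \<forall>n\<ge>N. gamma_norm (U m - U n) < e"
  by (simp add: gamma_Cauchy_def)

lemma gamma_Cauchy_const [simp]: "gamma_Cauchy (\<lambda>_. u)"
  by (simp add: gamma_Cauchy_def)

lemma gamma_null_le:
  assumes "\<And>n. gamma_norm (W n) \<le> f n" "f \<longlonglongrightarrow> 0"
  shows "(\<lambda>n. gamma_norm (W n)) \<longlonglongrightarrow> 0"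
  by (rule tendsto_sandwich[OF _ _ tendsto_const assms(2)]) (auto simp: assms(1) gamma_norm_nonneg)

lemma gamma_equiv_refl: "gamma_equiv U U \<longleftrightarrow> gamma_Cauchy U"
  by (simp add: gamma_equiv_def)

lemma part_equivp_gamma_equiv:
  "part_equivp (gamma_equiv ::
    (nat \<Rightarrow> ('a::complex_normed_vector, 'b::complex_normed_vector) alg_tensor) \<Rightarrow> _)"
proof (rule part_equivpI)
  show "\<exists>U. gamma_equiv U (U :: nat \<Rightarrow> ('a, 'b) alg_tensor)" by (rule exI[of _ "\<lambda>_. 0"]) (simp add: gamma_equiv_refl)
  show "symp (gamma_equiv :: (nat \<Rightarrow> ('a, 'b) alg_tensor) \<Rightarrow> _)"
  proof (rule sympI)
    fix U V :: "nat \<Rightarrow> ('a, 'b) alg_tensor"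
    assume "gamma_equiv U V"
    moreover have "gamma_norm (U n - V n) = gamma_norm (V n - U n)" for n
      by (rule gamma_norm_minus_commute)
    ultimately show "gamma_equiv V U" by (simp add: gamma_equiv_def)
  qed
  show "transp (gamma_equiv :: (nat \<Rightarrow> ('a, 'b) alg_tensor) \<Rightarrow> _)"
  proof (rule transpI)
    fix U V W :: "nat \<Rightarrow> ('a, 'b) alg_tensor"
    assume UV: "gamma_equiv U V" and VW: "gamma_equiv V W"
    have "(\<lambda>n. gamma_norm (U n - V n) + gamma_norm (V n - W n)) \<longlonglongrightarrow> 0 + 0"
      using UV VW unfolding gamma_equiv_def by (intro tendsto_add) auto
    then have "(\<lambda>n. gamma_norm (U n - W n)) \<longlonglongrightarrow> 0"
      by (intro gamma_null_le[OF gamma_norm_diff_triangle]) simp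
    then show "gamma_equiv U W" using UV VW by (simp add: gamma_equiv_def)
  qed
qed

quotient_type (overloaded) ('a, 'b) proj_tensor =
  "nat \<Rightarrow> ('a::complex_normed_vector, 'b::complex_normed_vector) alg_tensor" / partial: gamma_equiv
  by (rule part_equivp_gamma_equiv)

lemma gamma_Cauchy_add:
  assumes "gamma_Cauchy U" "gamma_Cauchy V"
  shows "gamma_Cauchy (\<lambda>n. U n + V n)"
  unfolding gamma_Cauchy_def
proof (intro allI impI)
  fix e :: real
  assume "0 < e"
  then have e: "0 < e / 2" by simp
  obtain M where M: "\<forall>m\<ge>M. \<forall>n\<ge>M. gamma_norm (U m - U n) < e / 2"
    using gamma_CauchyD[OF assms(1) e] ..
  obtain N where N: "\<forall>m\<ge>N. \<forall>n\<ge>N. gamma_norm (V m - V n) < e / 2"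
    using gamma_CauchyD[OF assms(2) e] ..
  have "gamma_norm (U m + V m - (U n + V n)) < e" if "m \<ge> max M N" "n \<ge> max M N" for m n
  proof -
    have "gamma_norm (U m + V m - (U n + V n)) \<le> gamma_norm (U m - U n) + gamma_norm (V m - V n)"
      using gamma_norm_triangle[of "U m - U n" "V m - V n"] by (simp add: algebra_simps)
    moreover have "gamma_norm (U m - U n) < e / 2" "gamma_norm (V m - V n) < e / 2"
      using M N that by auto
    ultimately show ?thesis by linarith
  qed
  then show "\<exists>N. \<forall>m\<ge>N. \<forall>n\<ge>N. gamma_norm (U m + V m - (U n + V n)) < e" by blast
qed

lemma gamma_Cauchy_scaleC:
  assumes "gamma_Cauchy U"
  shows "gamma_Cauchy (\<lambda>n. c *\<^sub>C U n)"
  unfolding gamma_Cauchy_def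
proof (intro allI impI)
  fix e :: real
  assume e: "0 < e"
  have c: "0 < cmod c + 1" using norm_ge_zero[of c] by linarith
  obtain N where N: "\<forall>m\<ge>N. \<forall>n\<ge>N. gamma_norm (U m - U n) < e / (cmod c + 1)"
    using gamma_CauchyD[OF assms, of "e / (cmod c + 1)"] e c by auto
  have "gamma_norm (c *\<^sub>C U m - c *\<^sub>C U n) < e" if "m \<ge> N" "n \<ge> N" for m n
  proof -
    have "gamma_norm (c *\<^sub>C U m - c *\<^sub>C U n) = cmod c * gamma_norm (U m - U n)"
      by (simp add: scaleC_diff_right[symmetric] gamma_norm_scaleC)
    also have "\<dots> \<le> (cmod c + 1) * gamma_norm (U m - U n)"
      by (intro mult_right_mono gamma_norm_nonneg) simp
    also have "\<dots> < e" using N that c by (simp add: pos_less_divide_eq mult.commute)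
    finally show ?thesis .
  qed
  then show "\<exists>N. \<forall>m\<ge>N. \<forall>n\<ge>N. gamma_norm (c *\<^sub>C U m - c *\<^sub>C U n) < e" by blast
qed

lemma gamma_Cauchy_norm_convergent:
  assumes "gamma_Cauchy U"
  shows "convergent (\<lambda>n. gamma_norm (U n))"
proof (rule Cauchy_convergent, rule CauchyI)
  fix e :: real
  assume "0 < e"
  then obtain N where "\<forall>m\<ge>N. \<forall>n\<ge>N. gamma_norm (U m - U n) < e"
    using gamma_CauchyD[OF assms] by blast
  then show "\<exists>N. \<forall>m\<ge>N. \<forall>n\<ge>N. norm (gamma_norm (U m) - gamma_norm (U n)) < e"
    using gamma_norm_abs_diff order.strict_trans1 unfolding real_norm_def by blast
qed

lemma gamma_Cauchy_bounded:
  assumes "gamma_Cauchy U"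
  obtains K where "0 < K" "\<And>n. gamma_norm (U n) \<le> K"
proof -
  have "Bseq (\<lambda>n. gamma_norm (U n))"
    by (rule convergent_imp_Bseq[OF gamma_Cauchy_norm_convergent[OF assms]])
  then obtain K where "0 < K" "\<forall>n. norm (gamma_norm (U n)) \<le> K" unfolding Bseq_def by auto
  then show thesis by (intro that[of K]) (auto dest: spec simp: abs_le_iff)
qed

lemma gamma_norm_mult_diff:
  fixes u v :: "('a::complex_normed_algebra, 'b::complex_normed_algebra) alg_tensor"
  assumes "gamma_norm u \<le> K" "gamma_norm v' \<le> L"
  shows "gamma_norm (u * v - u' * v') \<le> K * gamma_norm (v - v') + gamma_norm (u - u') * L"
proof -
  have "u * v - u' * v' = u * (v - v') + (u - u') * v'" by (simp add: algebra_simps)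
  then have "gamma_norm (u * v - u' * v') \<le> gamma_norm (u * (v - v')) + gamma_norm ((u - u') * v')"
    by (simp only: gamma_norm_triangle)
  also have "\<dots> \<le> gamma_norm u * gamma_norm (v - v') + gamma_norm (u - u') * gamma_norm v'"
    by (intro add_mono gamma_norm_mult)
  also have "\<dots> \<le> K * gamma_norm (v - v') + gamma_norm (u - u') * L"
    by (intro add_mono mult_left_mono mult_right_mono assms gamma_norm_nonneg)
  finally show ?thesis .
qed

lemma gamma_Cauchy_mult:
  fixes U V :: "nat \<Rightarrow> ('a::complex_normed_algebra, 'b::complex_normed_algebra) alg_tensor"
  assumes "gamma_Cauchy U" "gamma_Cauchy V"
  shows "gamma_Cauchy (\<lambda>n. U n * V n)"
  unfolding gamma_Cauchy_def
proof (intro allI impI)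
  fix e :: real
  assume e: "0 < e"
  obtain K where K: "0 < K" "\<And>n. gamma_norm (U n) \<le> K"
    using gamma_Cauchy_bounded[OF assms(1)] by blast
  obtain L where L: "0 < L" "\<And>n. gamma_norm (V n) \<le> L"
    using gamma_Cauchy_bounded[OF assms(2)] by blast
  obtain M where M: "\<forall>m\<ge>M. \<forall>n\<ge>M. gamma_norm (U m - U n) < e / (2 * L)"
    using gamma_CauchyD[OF assms(1), of "e / (2 * L)"] e L by auto
  obtain N where N: "\<forall>m\<ge>N. \<forall>n\<ge>N. gamma_norm (V m - V n) < e / (2 * K)"
    using gamma_CauchyD[OF assms(2), of "e / (2 * K)"] e K by auto
  have "gamma_norm (U m * V m - U n * V n) < e" if "m \<ge> max M N" "n \<ge> max M N" for m n
  proof -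
    have "gamma_norm (U m * V m - U n * V n) \<le> K * gamma_norm (V m - V n) + gamma_norm (U m - U n) * L"
      by (rule gamma_norm_mult_diff[OF K(2) L(2)])
    moreover have "K * gamma_norm (V m - V n) < K * (e / (2 * K))"
      using N that K by (intro mult_strict_left_mono) auto
    moreover have "gamma_norm (U m - U n) * L < e / (2 * L) * L"
      using M that L by (intro mult_strict_right_mono) auto
    ultimately show ?thesis using K(1) L(1) by simp
  qed
  then show "\<exists>N. \<forall>m\<ge>N. \<forall>n\<ge>N. gamma_norm (U m * V m - U n * V n) < e" by blast
qed

lemma gamma_equiv_lim:
  assumes "gamma_equiv U V"
  shows "lim (\<lambda>n. gamma_norm (U n)) = lim (\<lambda>n. gamma_norm (V n))"
proof -
  obtain l where l: "(\<lambda>n. gamma_norm (V n)) \<longlonglongrightarrow> l"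
    using assms gamma_Cauchy_norm_convergent unfolding gamma_equiv_def convergent_def by blast
  have "(\<lambda>n. gamma_norm (U n) - gamma_norm (V n)) \<longlonglongrightarrow> 0"
    by (rule Lim_null_comparison[of _ "\<lambda>n. gamma_norm (U n - V n)"])
      (use assms in \<open>auto simp: gamma_norm_abs_diff gamma_equiv_def\<close>)
  from tendsto_add[OF this l] have "(\<lambda>n. gamma_norm (U n)) \<longlonglongrightarrow> l" by simp
  then show ?thesis using l by (simp only: limI)
qed

instantiation proj_tensor :: (complex_normed_vector, complex_normed_vector) complex_normed_vector
begin

lift_definition zero_proj_tensor :: "('a, 'b) proj_tensor" is "\<lambda>_. 0"
  by (simp add: gamma_equiv_refl)

lift_definition plus_proj_tensor ::
    "('a, 'b) proj_tensor \<Rightarrow> ('a, 'b) proj_tensor \<Rightarrow> ('a, 'b) proj_tensor"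
  is "\<lambda>U V n. U n + V n"
proof -
  fix U U' V V' :: "nat \<Rightarrow> ('a, 'b) alg_tensor"
  assume U: "gamma_equiv U U'" and V: "gamma_equiv V V'"
  have "(\<lambda>n. gamma_norm (U n - U' n) + gamma_norm (V n - V' n)) \<longlonglongrightarrow> 0 + 0"
    using U V unfolding gamma_equiv_def by (intro tendsto_add) auto
  moreover have "gamma_norm (U n + V n - (U' n + V' n)) \<le>
      gamma_norm (U n - U' n) + gamma_norm (V n - V' n)" for n
    using gamma_norm_triangle[of "U n - U' n" "V n - V' n"] by (simp add: algebra_simps)
  ultimately have "(\<lambda>n. gamma_norm (U n + V n - (U' n + V' n))) \<longlonglongrightarrow> 0"
    by (intro gamma_null_le) auto
  then show "gamma_equiv (\<lambda>n. U n + V n) (\<lambda>n. U' n + V' n)"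
    using U V by (simp add: gamma_equiv_def gamma_Cauchy_add)
qed

lift_definition scaleC_proj_tensor :: "complex \<Rightarrow> ('a, 'b) proj_tensor \<Rightarrow> ('a, 'b) proj_tensor"
  is "\<lambda>c U n. c *\<^sub>C U n"
proof -
  fix c and U U' :: "nat \<Rightarrow> ('a, 'b) alg_tensor"
  assume U: "gamma_equiv U U'"
  have "(\<lambda>n. cmod c * gamma_norm (U n - U' n)) \<longlonglongrightarrow> cmod c * 0"
    using U unfolding gamma_equiv_def by (intro tendsto_mult_left) auto
  then have "(\<lambda>n. gamma_norm (c *\<^sub>C U n - c *\<^sub>C U' n)) \<longlonglongrightarrow> 0"
    by (simp add: scaleC_diff_right[symmetric] gamma_norm_scaleC)
  then show "gamma_equiv (\<lambda>n. c *\<^sub>C U n) (\<lambda>n. c *\<^sub>C U' n)"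
    using U by (simp add: gamma_equiv_def gamma_Cauchy_scaleC)
qed

definition scaleR_proj_tensor :: "real \<Rightarrow> ('a, 'b) proj_tensor \<Rightarrow> ('a, 'b) proj_tensor"
  where "scaleR_proj_tensor r u = complex_of_real r *\<^sub>C u"

definition uminus_proj_tensor :: "('a, 'b) proj_tensor \<Rightarrow> ('a, 'b) proj_tensor"
  where "uminus_proj_tensor u = (-1) *\<^sub>C u"

definition minus_proj_tensor ::
    "('a, 'b) proj_tensor \<Rightarrow> ('a, 'b) proj_tensor \<Rightarrow> ('a, 'b) proj_tensor"
  where "minus_proj_tensor u v = u + - v"

lift_definition norm_proj_tensor :: "('a, 'b) proj_tensor \<Rightarrow> real"
  is "\<lambda>U. lim (\<lambda>n. gamma_norm (U n))"
  by (rule gamma_equiv_lim)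

definition dist_proj_tensor :: "('a, 'b) proj_tensor \<Rightarrow> ('a, 'b) proj_tensor \<Rightarrow> real"
  where "dist_proj_tensor u v = norm (u - v)"

definition sgn_proj_tensor :: "('a, 'b) proj_tensor \<Rightarrow> ('a, 'b) proj_tensor"
  where "sgn_proj_tensor u = inverse (norm u) *\<^sub>R u"

definition uniformity_proj_tensor :: "(('a, 'b) proj_tensor \<times> ('a, 'b) proj_tensor) filter"
  where "uniformity_proj_tensor = (INF e\<in>{0<..}. principal {(u, v). dist u v < e})"

definition open_proj_tensor :: "('a, 'b) proj_tensor set \<Rightarrow> bool"
  where "open_proj_tensor S \<longleftrightarrow> (\<forall>u\<in>S. \<forall>\<^sub>F (u', v) in uniformity. u' = u \<longrightarrow> v \<in> S)"

instance
proof
  fix u v w :: "('a, 'b) proj_tensor" and r s :: real and c d :: complex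
  have refl: "gamma_Cauchy U" if "gamma_equiv U U" for U :: "nat \<Rightarrow> ('a, 'b) alg_tensor"
    using that by (simp add: gamma_equiv_refl)
  note C = gamma_equiv_refl gamma_Cauchy_add gamma_Cauchy_scaleC
  show "u + v + w = u + (v + w)" by transfer (simp add: add.assoc C)
  show "u + v = v + u" by transfer (simp add: add.commute C)
  show "0 + u = u" by transfer simp
  show "- u + u = 0"
    unfolding uminus_proj_tensor_def by transfer (simp add: scaleC_minus1 C)
  show "u - v = u + - v" by (rule minus_proj_tensor_def)
  show cadd: "c *\<^sub>C (u + v) = c *\<^sub>C u + c *\<^sub>C v" for c and u v :: "('a, 'b) proj_tensor"
    by transfer (simp add: scaleC_add_right C)
  show cadd': "(c + d) *\<^sub>C u = c *\<^sub>C u + d *\<^sub>C u" for c d and u :: "('a, 'b) proj_tensor"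
    by transfer (simp add: scaleC_add_left C)
  show cc: "c *\<^sub>C d *\<^sub>C u = (c * d) *\<^sub>C u" for c d and u :: "('a, 'b) proj_tensor"
    by transfer (simp add: scaleC_scaleC C)
  show "r *\<^sub>R (u + v) = r *\<^sub>R u + r *\<^sub>R v" by (simp only: scaleR_proj_tensor_def cadd)
  show "(r + s) *\<^sub>R u = r *\<^sub>R u + s *\<^sub>R u" by (simp only: scaleR_proj_tensor_def of_real_add cadd')
  show "r *\<^sub>R s *\<^sub>R u = (r * s) *\<^sub>R u" by (simp only: scaleR_proj_tensor_def of_real_mult cc)
  show "1 *\<^sub>R u = u" unfolding scaleR_proj_tensor_def by transfer simp
  show "r *\<^sub>R u = complex_of_real r *\<^sub>C u" by (rule scaleR_proj_tensor_def)
  show "dist u v = norm (u - v)" by (rule dist_proj_tensor_def)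
  show "sgn u = inverse (norm u) *\<^sub>R u" by (rule sgn_proj_tensor_def)
  show "uniformity = (INF e\<in>{0<..}. principal {(u, v::('a, 'b) proj_tensor). dist u v < e})"
    by (rule uniformity_proj_tensor_def)
  show "open S \<longleftrightarrow> (\<forall>u\<in>S. \<forall>\<^sub>F (u', v) in uniformity. u' = u \<longrightarrow> v \<in> S)"
    for S :: "('a, 'b) proj_tensor set"
    by (rule open_proj_tensor_def)
  have tends: "(\<lambda>n. gamma_norm (U n)) \<longlonglongrightarrow> lim (\<lambda>n. gamma_norm (U n))"
    if "gamma_equiv U U" for U :: "nat \<Rightarrow> ('a, 'b) alg_tensor"
    using gamma_Cauchy_norm_convergent[OF refl[OF that]] by (simp add: convergent_LIMSEQ_iff)
  show "norm u = 0 \<longleftrightarrow> u = 0"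
  proof transfer
    fix U :: "nat \<Rightarrow> ('a, 'b) alg_tensor"
    assume U: "gamma_equiv U U"
    show "lim (\<lambda>n. gamma_norm (U n)) = 0 \<longleftrightarrow> gamma_equiv U (\<lambda>_. 0)"
    proof
      assume "lim (\<lambda>n. gamma_norm (U n)) = 0"
      then show "gamma_equiv U (\<lambda>_. 0)"
        using tends[OF U] refl[OF U] by (simp add: gamma_equiv_def)
    next
      assume "gamma_equiv U (\<lambda>_. 0)"
      then have "(\<lambda>n. gamma_norm (U n)) \<longlonglongrightarrow> 0" by (simp add: gamma_equiv_def)
      then show "lim (\<lambda>n. gamma_norm (U n)) = 0" by (rule limI)
    qed
  qed
  show "norm (u + v) \<le> norm u + norm v"
  proof transfer
    fix U V :: "nat \<Rightarrow> ('a, 'b) alg_tensor"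
    assume U: "gamma_equiv U U" and V: "gamma_equiv V V"
    have "gamma_equiv (\<lambda>n. U n + V n) (\<lambda>n. U n + V n)" using U V by (simp add: C)
    from tends[OF this] tendsto_add[OF tends[OF U] tends[OF V]]
    show "lim (\<lambda>n. gamma_norm (U n + V n)) \<le> lim (\<lambda>n. gamma_norm (U n)) + lim (\<lambda>n. gamma_norm (V n))"
      by (rule LIMSEQ_le) (auto intro: gamma_norm_triangle)
  qed
  show normC: "norm (c *\<^sub>C u) = cmod c * norm u" for c and u :: "('a, 'b) proj_tensor"
  proof transfer
    fix c and U :: "nat \<Rightarrow> ('a, 'b) alg_tensor"
    assume U: "gamma_equiv U U"
    show "lim (\<lambda>n. gamma_norm (c *\<^sub>C U n)) = cmod c * lim (\<lambda>n. gamma_norm (U n))"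
      unfolding gamma_norm_scaleC by (rule limI) (rule tendsto_mult_left[OF tends[OF U]])
  qed
  show "norm (r *\<^sub>R u) = \<bar>r\<bar> * norm u" by (simp only: scaleR_proj_tensor_def normC norm_of_real)
qed

end

instantiation proj_tensor :: (complex_normed_algebra, complex_normed_algebra) complex_normed_algebra
begin

lift_definition times_proj_tensor ::
    "('a, 'b) proj_tensor \<Rightarrow> ('a, 'b) proj_tensor \<Rightarrow> ('a, 'b) proj_tensor"
  is "\<lambda>U V n. U n * V n"
proof -
  fix U U' V V' :: "nat \<Rightarrow> ('a, 'b) alg_tensor"
  assume U: "gamma_equiv U U'" and V: "gamma_equiv V V'"
  obtain K where K: "0 < K" "\<And>n. gamma_norm (U n) \<le> K"
    using U gamma_Cauchy_bounded unfolding gamma_equiv_def by blast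
  obtain L where L: "0 < L" "\<And>n. gamma_norm (V' n) \<le> L"
    using V gamma_Cauchy_bounded unfolding gamma_equiv_def by blast
  have "(\<lambda>n. K * gamma_norm (V n - V' n) + gamma_norm (U n - U' n) * L) \<longlonglongrightarrow> K * 0 + 0 * L"
    using U V unfolding gamma_equiv_def by (intro tendsto_intros) auto
  then have "(\<lambda>n. gamma_norm (U n * V n - U' n * V' n)) \<longlonglongrightarrow> 0"
    by (intro gamma_null_le[OF gamma_norm_mult_diff[OF K(2) L(2)]]) simp
  then show "gamma_equiv (\<lambda>n. U n * V n) (\<lambda>n. U' n * V' n)"
    using U V by (simp add: gamma_equiv_def gamma_Cauchy_mult)
qed

instance
proof
  fix u v w :: "('a, 'b) proj_tensor" and r :: real and c :: complex
  have refl: "gamma_Cauchy U" if "gamma_equiv U U" for U :: "nat \<Rightarrow> ('a, 'b) alg_tensor"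
    using that by (simp add: gamma_equiv_refl)
  note C = gamma_equiv_refl gamma_Cauchy_add gamma_Cauchy_scaleC gamma_Cauchy_mult
  show "u * v * w = u * (v * w)" by transfer (simp add: mult.assoc C)
  show "(u + v) * w = u * w + v * w" by transfer (simp add: distrib_right C)
  show "u * (v + w) = u * v + u * w" by transfer (simp add: distrib_left C)
  show left: "(c *\<^sub>C u) * v = c *\<^sub>C (u * v)" for c and u v :: "('a, 'b) proj_tensor"
    by transfer (simp add: alg_tensor_mult_scaleC C)
  show right: "u * (c *\<^sub>C v) = c *\<^sub>C (u * v)" for c and u v :: "('a, 'b) proj_tensor"
    by transfer (simp add: alg_tensor_mult_scaleC C)
  show "(r *\<^sub>R u) * v = r *\<^sub>R (u * v)" by (simp only: scaleR_scaleC left)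
  show "u * (r *\<^sub>R v) = r *\<^sub>R (u * v)" by (simp only: scaleR_scaleC right)
  show "norm (u * v) \<le> norm u * norm v"
  proof transfer
    fix U V :: "nat \<Rightarrow> ('a, 'b) alg_tensor"
    assume U: "gamma_equiv U U" and V: "gamma_equiv V V"
    have tends: "(\<lambda>n. gamma_norm (U n)) \<longlonglongrightarrow> lim (\<lambda>n. gamma_norm (U n))"
      if "gamma_equiv U U" for U :: "nat \<Rightarrow> ('a, 'b) alg_tensor"
      using gamma_Cauchy_norm_convergent[OF refl[OF that]] by (simp add: convergent_LIMSEQ_iff)
    have "gamma_equiv (\<lambda>n. U n * V n) (\<lambda>n. U n * V n)" using U V by (simp add: C)
    from tends[OF this] tendsto_mult[OF tends[OF U] tends[OF V]]
    show "lim (\<lambda>n. gamma_norm (U n * V n)) \<le> lim (\<lambda>n. gamma_norm (U n)) * lim (\<lambda>n. gamma_norm (V n))"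
      by (rule LIMSEQ_le) (auto intro: gamma_norm_mult)
  qed
qed

end

lift_definition proj_embed ::
    "('a::complex_normed_vector, 'b::complex_normed_vector) alg_tensor \<Rightarrow> ('a, 'b) proj_tensor"
  is "\<lambda>u _. u"
  by (simp add: gamma_equiv_refl)

lemma norm_proj_embed: "norm (proj_embed u) = gamma_norm u"
  by transfer (rule limI, rule tendsto_const)

lemma proj_embed_add: "proj_embed (u + v) = proj_embed u + proj_embed v"
  by transfer (simp add: gamma_equiv_refl)

lemma proj_embed_scaleC: "proj_embed (c *\<^sub>C u) = c *\<^sub>C proj_embed u"
  by transfer (simp add: gamma_equiv_refl)

lemma proj_embed_diff: "proj_embed (u - v) = proj_embed u - proj_embed v"
  using proj_embed_add[of "u - v" v] by (simp add: algebra_simps)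

lemma proj_embed_mult:
  fixes u v :: "('a::complex_normed_algebra, 'b::complex_normed_algebra) alg_tensor"
  shows "proj_embed (u * v) = proj_embed u * proj_embed v"
  by transfer (simp add: gamma_equiv_refl)

lemma norm_proj_tensor_abs:
  "gamma_Cauchy U \<Longrightarrow> norm (abs_proj_tensor U) = lim (\<lambda>n. gamma_norm (U n))"
  by (simp add: norm_proj_tensor.abs_eq gamma_equiv_refl)

lemma proj_embed_tendsto:
  assumes "gamma_Cauchy U"
  shows "(\<lambda>n. proj_embed (U n)) \<longlonglongrightarrow> abs_proj_tensor U"
proof (rule LIMSEQ_I)
  fix e :: real
  assume "0 < e"
  then have e: "0 < e / 2" by simp
  obtain N where N: "\<forall>m\<ge>N. \<forall>n\<ge>N. gamma_norm (U m - U n) < e / 2"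
    using gamma_CauchyD[OF assms e] ..
  have "norm (proj_embed (U n) - abs_proj_tensor U) < e" if n: "n \<ge> N" for n
  proof -
    have C: "gamma_Cauchy (\<lambda>m. U n + (-1) *\<^sub>C U m)"
      by (intro gamma_Cauchy_add gamma_Cauchy_scaleC gamma_Cauchy_const assms)
    have "proj_embed (U n) - abs_proj_tensor U = abs_proj_tensor (\<lambda>m. U n + (-1) *\<^sub>C U m)"
      unfolding minus_proj_tensor_def uminus_proj_tensor_def
      by (simp add: proj_embed.abs_eq plus_proj_tensor.abs_eq scaleC_proj_tensor.abs_eq
          gamma_equiv_refl gamma_Cauchy_scaleC assms)
    then have "norm (proj_embed (U n) - abs_proj_tensor U) = lim (\<lambda>m. gamma_norm (U n - U m))"
      using norm_proj_tensor_abs[OF C] by (simp add: scaleC_minus1)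
    moreover have "(\<lambda>m. gamma_norm (U n - U m)) \<longlonglongrightarrow> lim (\<lambda>m. gamma_norm (U n - U m))"
      using gamma_Cauchy_norm_convergent[OF C] by (simp add: convergent_LIMSEQ_iff scaleC_minus1)
    then have "lim (\<lambda>m. gamma_norm (U n - U m)) \<le> e / 2"
      by (rule LIMSEQ_le_const2) (use N n in \<open>auto intro!: exI[of _ N] less_imp_le\<close>)
    ultimately show ?thesis using \<open>0 < e\<close> by simp
  qed
  then show "\<exists>N. \<forall>n\<ge>N. norm (proj_embed (U n) - abs_proj_tensor U) < e" by blast
qed

lemma proj_embed_dense:
  "closure (range proj_embed) =
    (UNIV :: ('a::complex_normed_vector, 'b::complex_normed_vector) proj_tensor set)"
proof -
  have "u \<in> closure (range proj_embed)" for u :: "('a, 'b) proj_tensor"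
  proof -
    define U where "U = rep_proj_tensor u"
    have "u = abs_proj_tensor U" "gamma_equiv U U"
      unfolding U_def
      by (simp_all only: Quotient3_abs_rep[OF Quotient3_proj_tensor] Quotient3_rep_reflp[OF Quotient3_proj_tensor])
    then have "(\<lambda>n. proj_embed (U n)) \<longlonglongrightarrow> u"
      using proj_embed_tendsto[of U] by (simp add: gamma_equiv_def)
    then show ?thesis
      unfolding closure_sequential by (intro exI[of _ "\<lambda>n. proj_embed (U n)"]) simp
  qed
  then show ?thesis by auto
qed

instance proj_tensor :: (complex_normed_vector, complex_normed_vector) complete_space
proof
  fix X :: "nat \<Rightarrow> ('a, 'b) proj_tensor"
  assume X: "Cauchy X"
  have "\<exists>a. norm (X k - proj_embed a) < 1 / real (Suc k)" for k
  proof -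
    have "X k \<in> closure (range proj_embed)" by (simp add: proj_embed_dense)
    moreover have "0 < 1 / real (Suc k)" by simp
    ultimately have "\<exists>v\<in>range proj_embed. dist v (X k) < 1 / real (Suc k)"
      unfolding closure_approachable by simp
    then obtain a where "dist (proj_embed a) (X k) < 1 / real (Suc k)" by (elim bexE rangeE) simp
    then have "norm (X k - proj_embed a) < 1 / real (Suc k)"
      by (simp only: dist_norm norm_minus_commute)
    then show ?thesis ..
  qed
  then obtain a where a: "\<And>k. norm (X k - proj_embed (a k)) < 1 / real (Suc k)" by metis
  have "(\<lambda>k. 1 / real (Suc k)) \<longlonglongrightarrow> 0" by (rule LIMSEQ_Suc[OF lim_1_over_n])
  then have null: "(\<lambda>k. X k - proj_embed (a k)) \<longlonglongrightarrow> 0"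
    by (rule Lim_null_comparison[OF always_eventually, rotated]) (simp only: a less_imp_le simp_thms)
  have aC: "gamma_Cauchy a"
    unfolding gamma_Cauchy_def
  proof (intro allI impI)
    fix e :: real
    assume "0 < e"
    then have e: "0 < e / 3" by simp
    obtain M where M: "\<And>m n. m \<ge> M \<Longrightarrow> n \<ge> M \<Longrightarrow> norm (X m - X n) < e / 3"
      using X e unfolding Cauchy_iff by blast
    obtain N where N: "\<And>n. n \<ge> N \<Longrightarrow> norm (X n - proj_embed (a n)) < e / 3"
      using LIMSEQ_D[OF null e] by auto
    have "gamma_norm (a m - a n) < e" if "m \<ge> max M N" "n \<ge> max M N" for m n
    proof -
      have "proj_embed (a m - a n) =
          (X n - proj_embed (a n)) + (X m - X n) - (X m - proj_embed (a m))"
        by (simp add: proj_embed_diff)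
      then have "gamma_norm (a m - a n) \<le>
          norm (X n - proj_embed (a n)) + norm (X m - X n) + norm (X m - proj_embed (a m))"
        unfolding norm_proj_embed[symmetric]
        by (simp only: order_trans[OF norm_triangle_ineq4 add_right_mono[OF norm_triangle_ineq]])
      moreover have "norm (X n - proj_embed (a n)) < e / 3" "norm (X m - X n) < e / 3"
        "norm (X m - proj_embed (a m)) < e / 3"
        using that M N by auto
      ultimately show ?thesis by linarith
    qed
    then show "\<exists>N. \<forall>m\<ge>N. \<forall>n\<ge>N. gamma_norm (a m - a n) < e" by blast
  qed
  from tendsto_add[OF null proj_embed_tendsto[OF aC]] have "X \<longlonglongrightarrow> abs_proj_tensor a" by simp
  then show "convergent X" by (rule convergentI)
qed

instance proj_tensor :: (complex_banach_algebra, complex_banach_algebra) complex_banach_algebra ..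

type_synonym 'a varopoulos = "('a, 'a) proj_tensor"

end

theory Submission
  imports Defs
begin

text \<open>
  Both directions are reduced to bounded bilinear forms \<open>B\<close> on a commutative C*-algebra \<open>A\<close>, the
  functionals on \<open>V\<^sub>A\<close>; pure states are the same as characters.

  If \<open>A\<close> is not scattered, removing from a bad positive functional its pure parts leaves a nonzero one
  that dominates no multiple of a character. Such a functional can be split again and again into
  disjointly supported pieces, and the resulting dyadic tree carries elements \<open>w\<^sub>n\<close> of the unit ball that
  behave like independent signs. The products \<open>w\<^sub>2\<^sub>i w\<^sub>2\<^sub>j\<^sub>+\<^sub>1\<close> are then orthonormal, and the orthogonal
  projection onto those with \<open>i \<le> j\<close> is a form \<open>B\<close> for which the two iterated limits of
  \<open>B (w\<^sub>2\<^sub>i w\<^sub>2\<^sub>j\<^sub>+\<^sub>1) (w\<^sub>2\<^sub>i w\<^sub>2\<^sub>j\<^sub>+\<^sub>1)\<close> are \<open>1\<close> and \<open>0\<close>.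

  If \<open>A\<close> is scattered, every \<open>B\<close> satisfies \<open>|B x y|\<^sup>2 \<le> 2 f |x|\<close> on the unit ball for some positive
  functional \<open>f\<close>. As \<open>f\<close> is a sum of point masses, \<open>B\<close> is small on elements vanishing at finitely many
  characters, in either variable, and hence a norm limit of combinations of products \<open>\<omega> x * \<theta> y\<close> of
  characters. These are characters of \<open>V\<^sub>A\<close>, for which weak* continuity of the Arens product is trivial.
\<close>

text \<open>The algebra has no unit and no function model of it is constructed. Identities, norm
  bounds and positivity are tested at one character at a time (\<open>gelfand_eqI\<close>,
  \<open>gelfand_norm_le\<close>, \<open>pos\<close>), and functions of elements come from
  \<open>fcalc\<close>, whose condition \<open>g 0 = 0\<close> is the price of the missing unit.
  Positive functionals stand in for measures and multiples of characters for point masses.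

  Limits are taken along filters finer than \<open>sequentially\<close>, because bounded sets in the
  duals concerned are weak* compact but need not be sequentially compact.

  Grothendieck's inequality would dominate a bilinear form by two states at once. Here a one-sided
  estimate, with \<open>|x|\<close> to the first power, is enough: it only has to make
  \<open>B\<close> small on elements vanishing on a finite set of characters, and the transposed
  form takes care of the second variable. Such an estimate amounts to (2,1)-summability, which Riesz
  products give by elementary means.\<close>

section \<open>Cluster points along filters, and linear preliminaries\<close>

text \<open>Tychonoff: the sequence lives in a product of closed discs, so it clusters at some
  \<open>l\<close>. Joining \<open>sequentially\<close> with the pulled-back neighbourhoods of
  \<open>l\<close> gives a proper filter that does the work of a convergent subsequence.\<close>

lemma pointwise_bounded_cluster:
  fixes g :: "nat \<Rightarrow> 'b \<Rightarrow> complex"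
  assumes "\<And>n x. cmod (g n x) \<le> M x"
  obtains F l where "F \<noteq> bot" "F \<le> sequentially" "\<And>x. ((\<lambda>n. g n x) \<longlongrightarrow> l x) F"
proof -
  define K where "K = (\<Pi>\<^sub>E x\<in>UNIV. cball (0::complex) (M x))"
  have "compactin (product_topology (\<lambda>_. euclidean) UNIV) K"
    unfolding K_def compactin_PiE by (simp add: compact_cball)
  then have K: "compact K" by (simp add: euclidean_product_topology)
  have "filtermap g sequentially \<noteq> bot" by (simp add: filtermap_bot_iff)
  moreover have "eventually (\<lambda>h. h \<in> K) (filtermap g sequentially)"
    unfolding eventually_filtermap by (rule always_eventually) (use assms in \<open>simp add: K_def PiE_iff\<close>)
  ultimately have "\<exists>l\<in>K. inf (nhds l) (filtermap g sequentially) \<noteq> bot"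
    using K[unfolded compact_filter, rule_format] by simp
  then obtain l where l: "inf (nhds l) (filtermap g sequentially) \<noteq> bot" ..
  define F where "F = inf (filtercomap g (nhds l)) sequentially"
  have "F \<noteq> bot"
  proof
    assume "F = bot"
    then have "eventually (\<lambda>_. False) F" by simp
    then obtain P Q where P: "eventually P (filtercomap g (nhds l))" and Q: "eventually Q sequentially"
      and PQ: "\<And>n. P n \<Longrightarrow> Q n \<Longrightarrow> False"
      unfolding F_def eventually_inf by auto
    obtain R where R: "eventually R (nhds l)" "\<And>n. R (g n) \<Longrightarrow> P n"
      using P unfolding eventually_filtercomap by auto
    have "eventually (\<lambda>h. \<not> R h) (filtermap g sequentially)"
      unfolding eventually_filtermap by (rule eventually_mono[OF Q]) (metis R(2) PQ)
    then have "eventually (\<lambda>_. False) (inf (nhds l) (filtermap g sequentially))"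
      unfolding eventually_inf by (intro exI[of _ R] exI[of _ "\<lambda>h. \<not> R h"]) (simp add: R(1))
    then show False using l by (simp add: eventually_False)
  qed
  moreover have "F \<le> sequentially" by (simp add: F_def)
  moreover have gl: "(g \<longlongrightarrow> l) F"
    unfolding F_def filterlim_iff_le_filtercomap by simp
  have "((\<lambda>n. g n x) \<longlongrightarrow> l x) F" for x
  proof -
    have c: "continuous_on UNIV (\<lambda>h::'b \<Rightarrow> complex. h x)"
      by (rule continuous_on_product_then_coordinatewise[OF continuous_on_id])
    show ?thesis
    proof (rule topological_tendstoI)
      fix U :: "complex set" assume U: "open U" "l x \<in> U"
      have "open ((\<lambda>h::'b \<Rightarrow> complex. h x) -` U)"
        by (rule open_vimage[OF U(1) c])
      from topological_tendstoD[OF gl this] U(2) show "eventually (\<lambda>n. g n x \<in> U) F" by simp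
    qed
  qed
  ultimately show thesis by (rule that)
qed

lemma clinearD:
  assumes "clinear f"
  shows "f (x + y) = f x + f y" "f (c *\<^sub>C x) = c *\<^sub>C f x" "f 0 = 0" "f (- x) = - f x"
    "f (x - y) = f x - f y" "f (r *\<^sub>R x) = r *\<^sub>R f x" "f (sum h I) = (\<Sum>i\<in>I. f (h i))"
proof -
  show add: "f (x + y) = f x + f y" and sc: "f (c *\<^sub>C x) = c *\<^sub>C f x" for x y c
    using assms by (auto simp: clinear_def)
  show z: "f 0 = 0" using sc[of 0 0] by simp
  show m: "f (- x) = - f x" for x using sc[of "-1" x] by (simp add: scaleC_minus1)
  show "f (x - y) = f x - f y" using add[of x "- y"] by (simp add: m)
  show "f (r *\<^sub>R x) = r *\<^sub>R f x" by (simp add: scaleR_scaleC sc)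
  show "f (sum h I) = (\<Sum>i\<in>I. f (h i))"
    by (induction I rule: infinite_finite_induct) (auto simp: z add)
qed

lemma clinear_complexD:
  fixes f :: "'a::complex_vector \<Rightarrow> complex"
  assumes "clinear f"
  shows "f (c *\<^sub>C x) = c * f x"
  using clinearD(2)[OF assms] by (simp add: scaleC_complex_def)

lemma clinear_dual_apply: "clinear (dual_apply f)"
  by (simp add: clinear_def scaleC_complex_def)

section \<open>Characters of a commutative C*-algebra\<close>

text \<open>The square identity already holds for the norm of a commutative C*-algebra and passes to
  infima of chains and to \<open>reduce\<close>. So Zorn's lemma can run in this class, and
  multiplicativity then comes from minimality.\<close>

definition power_mult_seminorm :: "('a::{complex_normed_algebra, comm_ring} \<Rightarrow> real) \<Rightarrow> bool"
  where "power_mult_seminorm p \<longleftrightarrow> (\<forall>x y. p (x + y) \<le> p x + p y) \<and> (\<forall>c x. p (c *\<^sub>C x) = cmod c * p x)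
    \<and> (\<forall>x y. p (x * y) \<le> p x * p y) \<and> (\<forall>x. p (x * x) = (p x)\<^sup>2) \<and> (\<forall>x. p x \<le> norm x)"

lemma power_mult_seminormD:
  assumes "power_mult_seminorm p"
  shows "p (x + y) \<le> p x + p y" "p (c *\<^sub>C x) = cmod c * p x" "p (x * y) \<le> p x * p y"
    "p (x * x) = (p x)\<^sup>2" "p x \<le> norm x" "p 0 = 0" "p (- x) = p x" "0 \<le> p x"
    "p (x - y) \<le> p x + p y" "\<bar>p x - p y\<bar> \<le> p (x - y)"
proof -
  show add: "p (x + y) \<le> p x + p y" and sc: "p (c *\<^sub>C x) = cmod c * p x" and "p (x * y) \<le> p x * p y"
    and "p (x * x) = (p x)\<^sup>2" and "p x \<le> norm x" for x y c
    using assms by (auto simp: power_mult_seminorm_def)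
  show z: "p 0 = 0" using sc[of 0 0] by simp
  show m: "p (- x) = p x" for x using sc[of "-1" x] by (simp add: scaleC_minus1)
  show "0 \<le> p x" using add[of x "- x"] by (simp add: z m)
  show "p (x - y) \<le> p x + p y" using add[of x "- y"] by (simp add: m)
  have "p x - p y \<le> p (x - y)" for x y using add[of "x - y" y] by simp
  from this[of x y] this[of y x] show "\<bar>p x - p y\<bar> \<le> p (x - y)"
    using m[of "x - y"] by simp
qed

text \<open>This is \<open>y\<close> to the power \<open>2 ^ k\<close>. Repeated squaring needs no
  unit, and on these powers the square identity determines \<open>p\<close> exactly.\<close>

primrec sq :: "nat \<Rightarrow> 'a::times \<Rightarrow> 'a"
  where "sq 0 y = y" | "sq (Suc k) y = sq k y * sq k y"

lemma power_two_power_Suc: "(a::'a::monoid_mult) ^ (2 ^ Suc k) = a ^ (2 ^ k) * a ^ (2 ^ k)"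
  by (simp add: power_add[symmetric] mult_2)

lemma power_mult_seminorm_sq: "power_mult_seminorm p \<Longrightarrow> p (sq k y) = p y ^ (2 ^ k)"
  by (induction k) (simp_all only: sq.simps power_mult_seminormD(4) power_two_power_Suc power2_eq_square power_0 power_one_right)

text \<open>A seminorm \<open>p\<close> that is minimal subject to \<open>p h = norm h\<close> coincides with each \<open>reduce p y\<close>, hence is
  multiplicative.\<close>

definition reduce :: "('a::{complex_normed_algebra, comm_ring} \<Rightarrow> real) \<Rightarrow> 'a \<Rightarrow> 'a \<Rightarrow> real"
  where "reduce p y x = (INF k. p (x * sq k y) / p y ^ (2 ^ k))"

text \<open>Submultiplicativity makes the quotients decrease in \<open>k\<close>, so the infimum is
  a limit. The limit form transfers the seminorm axioms, the infimum form gives the upper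
  bounds.\<close>

lemma reduce_lim:
  assumes p: "power_mult_seminorm p" and y: "p y > 0"
  shows "(\<lambda>k. p (x * sq k y) / p y ^ (2 ^ k)) \<longlonglongrightarrow> reduce p y x"
    and "reduce p y x \<le> p (x * sq k y) / p y ^ (2 ^ k)"
proof -
  have bdd: "bdd_below (range (\<lambda>k. p (x * sq k y) / p y ^ (2 ^ k)))"
    by (rule bdd_belowI[of _ 0]) (use y power_mult_seminormD(8)[OF p] in auto)
  show "reduce p y x \<le> p (x * sq k y) / p y ^ (2 ^ k)"
    unfolding reduce_def by (rule cINF_lower[OF bdd]) simp
  have "p (x * sq (Suc k) y) / p y ^ (2 ^ Suc k) \<le> p (x * sq k y) / p y ^ (2 ^ k)" for k
  proof -
    have "p (x * sq (Suc k) y) \<le> p (x * sq k y) * p y ^ (2 ^ k)"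
      using power_mult_seminormD(3)[OF p, of "x * sq k y" "sq k y"] power_mult_seminorm_sq[OF p, of k y]
      by (simp add: mult.assoc)
    then have "p (x * sq (Suc k) y) / (p y ^ (2 ^ k) * p y ^ (2 ^ k))
        \<le> p (x * sq k y) * p y ^ (2 ^ k) / (p y ^ (2 ^ k) * p y ^ (2 ^ k))"
      by (rule divide_right_mono) (use y in simp)
    also have "\<dots> = p (x * sq k y) / p y ^ (2 ^ k)" using y by simp
    finally show ?thesis by (simp only: power_two_power_Suc)
  qed
  then show "(\<lambda>k. p (x * sq k y) / p y ^ (2 ^ k)) \<longlonglongrightarrow> reduce p y x"
    unfolding reduce_def by (intro LIMSEQ_decseq_INF bdd decseq_SucI)
qed

lemma reduce_le:
  assumes p: "power_mult_seminorm p" and y: "p y > 0"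
  shows "reduce p y x \<le> p x"
proof -
  have "reduce p y x \<le> p (x * y) / p y" using reduce_lim(2)[OF assms, of x 0] by simp
  also have "\<dots> \<le> p x" using power_mult_seminormD(3)[OF p, of x y] y by (simp add: field_simps)
  finally show ?thesis .
qed

lemma power_mult_seminorm_reduce:
  assumes p: "power_mult_seminorm p" and y: "p y > 0"
  shows "power_mult_seminorm (reduce p y)"
  unfolding power_mult_seminorm_def
proof (intro conjI allI)
  note L = reduce_lim(1)[OF assms]
  fix x z c
  show "reduce p y (x + z) \<le> reduce p y x + reduce p y z"
  proof (rule LIMSEQ_le[OF L tendsto_add[OF L L]], intro exI allI impI)
    fix k
    show "p ((x + z) * sq k y) / p y ^ (2 ^ k) \<le> p (x * sq k y) / p y ^ (2 ^ k) + p (z * sq k y) / p y ^ (2 ^ k)"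
      using power_mult_seminormD(1)[OF p, of "x * sq k y" "z * sq k y"] y
      by (simp add: distrib_right divide_right_mono add_divide_distrib[symmetric])
  qed
  have "(\<lambda>k. p ((c *\<^sub>C x) * sq k y) / p y ^ (2 ^ k)) \<longlonglongrightarrow> cmod c * reduce p y x"
    using tendsto_mult_left[OF L, of "cmod c" x] by (simp add: mult_scaleC_left power_mult_seminormD(2)[OF p])
  then show "reduce p y (c *\<^sub>C x) = cmod c * reduce p y x"
    using L LIMSEQ_unique by blast
  show "reduce p y (x * z) \<le> reduce p y x * reduce p y z"
  proof (rule LIMSEQ_le[OF LIMSEQ_Suc[OF L] tendsto_mult[OF L L]], intro exI allI impI)
    fix k
    \<comment> \<open>Commutativity shares the \<open>2 ^ Suc k\<close> factors \<open>y\<close>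
      equally between \<open>x\<close> and \<open>z\<close>; hence the shift by one index on the
      left.\<close>
    have "x * z * sq (Suc k) y = (x * sq k y) * (z * sq k y)" by (simp add: ac_simps)
    then have "p (x * z * sq (Suc k) y) \<le> p (x * sq k y) * p (z * sq k y)"
      by (simp only: power_mult_seminormD(3)[OF p])
    then show "p (x * z * sq (Suc k) y) / p y ^ (2 ^ Suc k)
        \<le> p (x * sq k y) / p y ^ (2 ^ k) * (p (z * sq k y) / p y ^ (2 ^ k))"
      unfolding power_two_power_Suc times_divide_times_eq by (rule divide_right_mono) (use y in simp)
  qed
  have "(\<lambda>k. p (x * x * sq (Suc k) y) / p y ^ (2 ^ Suc k)) \<longlonglongrightarrow> (reduce p y x)\<^sup>2"
  proof -
    have "x * x * sq (Suc k) y = (x * sq k y) * (x * sq k y)" for k by (simp add: ac_simps)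
    then have "p (x * x * sq (Suc k) y) / p y ^ (2 ^ Suc k) = (p (x * sq k y) / p y ^ (2 ^ k))\<^sup>2" for k
      by (simp only: power_mult_seminormD(4)[OF p] power_divide power_two_power_Suc power2_eq_square times_divide_times_eq)
    then show ?thesis using tendsto_power[OF L, of x 2] by simp
  qed
  then show "reduce p y (x * x) = (reduce p y x)\<^sup>2"
    using LIMSEQ_Suc[OF L[of "x * x"]] LIMSEQ_unique by blast
  show "reduce p y x \<le> norm x"
    using reduce_le[OF assms, of x] power_mult_seminormD(5)[OF p, of x] by linarith
qed

lemma minimal_power_mult_seminorm:
  fixes h :: "'a::{complex_normed_algebra, comm_ring}"
  assumes norm: "power_mult_seminorm (norm :: 'a \<Rightarrow> real)"
  obtains p where "power_mult_seminorm p" "p h = norm h"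
    "\<And>q. power_mult_seminorm q \<Longrightarrow> q h = norm h \<Longrightarrow> (\<And>x. q x \<le> p x) \<Longrightarrow> q = p"
proof -
  define A where "A = {p. power_mult_seminorm p \<and> p h = norm h}"
  have "\<exists>m\<in>A. \<forall>a\<in>A. a \<le> m \<longrightarrow> a = m"
  proof (rule predicate_Zorn)
    show "partial_order_on A (relation_of (\<lambda>p q. q \<le> p) A)"
      by (rule partial_order_on_relation_ofI) auto
    fix C assume C: "C \<in> Chains (relation_of (\<lambda>p q. q \<le> p) A)"
    have CA: "power_mult_seminorm p" "p h = norm h" if "p \<in> C" for p
      using C that by (auto simp: Chains_def relation_of_def A_def)
    have ch: "p \<le> q \<or> q \<le> p" if "p \<in> C" "q \<in> C" for p q
      using C that by (auto simp: Chains_def relation_of_def)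
    show "\<exists>u\<in>A. \<forall>a\<in>C. u \<le> a"
    proof (cases "C = {}")
      case True
      then show ?thesis using norm by (auto simp: A_def)
    next
      case False
      define q where "q x = (INF p\<in>C. p x)" for x
      have bdd: "bdd_below ((\<lambda>p. p x) ` C)" for x
        by (rule bdd_belowI2[of _ 0]) (rule power_mult_seminormD(8)[OF CA(1)])
      have qle: "q x \<le> p x" if "p \<in> C" for p x
        unfolding q_def by (rule cINF_lower[OF bdd that])
      have qge: "b \<le> q x" if "\<And>p. p \<in> C \<Longrightarrow> b \<le> p x" for b x
        unfolding q_def by (rule cINF_greatest[OF False that])
      have qnn: "0 \<le> q x" for x by (rule qge) (rule power_mult_seminormD(8)[OF CA(1)])
      \<comment> \<open>Since \<open>C\<close> is a chain, a single member is close to the infimum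
        at both points. This is what lets the axioms in two variables pass to
        \<open>q\<close>.\<close>
      have ex: "\<exists>p\<in>C. p x < q x + e \<and> p y < q y + e" if "e > 0" for x y e
      proof -
        have *: "\<exists>p\<in>C. p x < q x + e" for x
          using \<open>e > 0\<close> cINF_less_iff[OF False bdd, of x "q x + e"] by (auto simp: q_def)
        obtain p1 p2 where p: "p1 \<in> C" "p1 x < q x + e" "p2 \<in> C" "p2 y < q y + e"
          using *[of x] *[of y] by auto
        show ?thesis
        proof (cases "p1 \<le> p2")
          case True
          then have "p1 y \<le> p2 y" by (simp add: le_fun_def)
          then show ?thesis using p by (intro bexI[of _ p1]) auto
        next
          case False
          then have "p2 x \<le> p1 x" using ch p by (auto simp: le_fun_def)
          then show ?thesis using p by (intro bexI[of _ p2]) auto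
        qed
      qed
      have "power_mult_seminorm q"
        unfolding power_mult_seminorm_def
      proof (intro conjI allI)
        fix x y c
        show "q (x + y) \<le> q x + q y"
        proof (rule field_le_epsilon)
          fix e :: real assume "e > 0"
          then obtain p where p: "p \<in> C" "p x < q x + e / 2" "p y < q y + e / 2"
            using ex[of "e / 2" x y] by auto
          then show "q (x + y) \<le> q x + q y + e"
            using qle[OF p(1), of "x + y"] power_mult_seminormD(1)[OF CA(1)[OF p(1)], of x y] by linarith
        qed
        show "q (c *\<^sub>C x) = cmod c * q x"
        proof (rule antisym)
          have "cmod c * q x \<le> p (c *\<^sub>C x)" if "p \<in> C" for p
            unfolding power_mult_seminormD(2)[OF CA(1)[OF that]] by (rule mult_left_mono[OF qle[OF that]]) simp
          then show "cmod c * q x \<le> q (c *\<^sub>C x)" by (rule qge)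
          have "q (c *\<^sub>C x) \<le> cmod c * q x + e" if "e > 0" for e
          proof -
            have e: "e / (cmod c + 1) > 0" using that by (simp add: add_nonneg_pos)
            then obtain p where p: "p \<in> C" "p x < q x + e / (cmod c + 1)" using ex by blast
            have "q (c *\<^sub>C x) \<le> cmod c * p x"
              using qle[OF p(1), of "c *\<^sub>C x"] power_mult_seminormD(2)[OF CA(1)[OF p(1)]] by simp
            also have "\<dots> \<le> cmod c * (q x + e / (cmod c + 1))"
              using p(2) by (intro mult_left_mono) auto
            also have "\<dots> \<le> cmod c * q x + e"
            proof -
              have "cmod c * (e / (cmod c + 1)) \<le> (cmod c + 1) * (e / (cmod c + 1))"
                using e by (intro mult_right_mono) auto
              also have "\<dots> = e" using norm_ge_zero[of c] by (simp add: add_nonneg_eq_0_iff)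
              finally show ?thesis by (simp add: distrib_left)
            qed
            finally show ?thesis .
          qed
          then show "q (c *\<^sub>C x) \<le> cmod c * q x" by (rule field_le_epsilon)
        qed
        have mm: "q z \<le> q x * q y" if "\<And>p. p \<in> C \<Longrightarrow> p z \<le> p x * p y" for z x y
        proof -
          have "q z \<le> (q x + e) * (q y + e)" if e: "e > 0" for e
          proof -
            obtain p where p: "p \<in> C" "p x < q x + e" "p y < q y + e" using ex[OF e] by blast
            have "q z \<le> p x * p y" using qle[OF p(1), of z] \<open>\<And>p. p \<in> C \<Longrightarrow> p z \<le> p x * p y\<close>[OF p(1)] by linarith
            also have "\<dots> \<le> (q x + e) * (q y + e)"
              using p power_mult_seminormD(8)[OF CA(1)[OF p(1)]] qnn[of x] e by (intro mult_mono) auto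
            finally show ?thesis .
          qed
          then have ev: "eventually (\<lambda>e. q z \<le> (q x + e) * (q y + e)) (at_right 0)"
            using eventually_at_right_less[of "0::real"] by (rule eventually_mono[rotated]) auto
          have "((\<lambda>e. (q x + e) * (q y + e)) \<longlongrightarrow> (q x + 0) * (q y + 0)) (at_right 0)"
            by (intro tendsto_intros)
          from tendsto_lowerbound[OF this ev] show ?thesis by simp
        qed
        show "q (x * y) \<le> q x * q y" by (rule mm[OF power_mult_seminormD(3)[OF CA(1)]])
        show "q (x * x) = (q x)\<^sup>2"
        proof (rule antisym)
          show "q (x * x) \<le> (q x)\<^sup>2"
            unfolding power2_eq_square by (rule mm[OF power_mult_seminormD(3)[OF CA(1)]])
          have "(q x)\<^sup>2 \<le> p (x * x)" if "p \<in> C" for p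
            using qle[OF that, of x] qnn[of x] power_mult_seminormD(4)[OF CA(1)[OF that]] by (simp add: power_mono)
          then show "(q x)\<^sup>2 \<le> q (x * x)" by (rule qge)
        qed
        obtain p where "p \<in> C" using False by blast
        then show "q x \<le> norm x"
          using qle[of p x] CA(1)[of p] power_mult_seminormD(5)[of p x] by linarith
      qed
      moreover have "q h = norm h"
      proof -
        have "(\<lambda>p. p h) ` C = {norm h}" using CA(2) False by auto
        then show ?thesis by (simp add: q_def)
      qed
      ultimately show ?thesis
        using qle by (intro bexI[of _ q]) (auto simp: A_def le_fun_def)
    qed
  qed
  then obtain p where "power_mult_seminorm p" "p h = norm h"
    and "\<And>q. power_mult_seminorm q \<Longrightarrow> q h = norm h \<Longrightarrow> q \<le> p \<Longrightarrow> q = p"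
    by (auto simp: A_def)
  then show thesis by (intro that[of p]) (auto simp: le_fun_def)
qed

text \<open>Multiplicativity is obtained in two rounds: minimality yields it for the factor
  \<open>h\<close>, and this exactness is the condition under which minimality yields it for every
  other factor.\<close>

lemma multiplicative_seminorm_exists:
  fixes h :: "'a::{complex_normed_algebra, comm_ring}"
  assumes norm: "power_mult_seminorm (norm :: 'a \<Rightarrow> real)"
  obtains p where "power_mult_seminorm p" "p h = norm h" "\<And>x y. p (x * y) = p x * p y"
proof (cases "h = 0")
  case True
  show thesis
    by (rule that[of "\<lambda>_. 0"]) (simp_all add: power_mult_seminorm_def True)
next
  case False
  obtain p where p: "power_mult_seminorm p" "p h = norm h"
    and min: "\<And>q. power_mult_seminorm q \<Longrightarrow> q h = norm h \<Longrightarrow> (\<And>x. q x \<le> p x) \<Longrightarrow> q = p"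
    using minimal_power_mult_seminorm[OF norm] by blast
  note D = power_mult_seminormD[OF p(1)]
  have ph: "p h > 0" using p(2) False by simp
  \<comment> \<open>Under \<open>eq\<close> the seminorm \<open>reduce p y\<close> keeps its value
    at \<open>h\<close> and lies below \<open>p\<close>, so it equals \<open>p\<close> by
    minimality. The term \<open>k = 0\<close> of the infimum is then the claim.\<close>
  have mult: "p (x * y) \<ge> p x * p y" if y: "p y > 0" and eq: "\<And>k. p (h * sq k y) = p h * p y ^ (2 ^ k)" for x y
  proof -
    have "reduce p y h = p h"
    proof (rule LIMSEQ_unique[OF reduce_lim(1)[OF p(1) y]])
      show "(\<lambda>k. p (h * sq k y) / p y ^ 2 ^ k) \<longlonglongrightarrow> p h" using y by (simp add: eq)
    qed
    then have "reduce p y = p"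
      using p(2) by (intro min power_mult_seminorm_reduce[OF p(1) y] reduce_le[OF p(1) y]) auto
    then have "p x \<le> p (x * y) / p y" using reduce_lim(2)[OF p(1) y, of x 0] by simp
    then show ?thesis using y by (simp add: field_simps)
  qed
  \<comment> \<open>\<open>r\<close> is \<open>h\<close> to the power \<open>2 ^ Suc k - 1\<close>.
    It completes \<open>h * sq k h\<close>, an exponent on which the square identity says nothing,
    to a power of two.\<close>
  have rest: "\<exists>r. h * r = sq (Suc k) h \<and> p r \<le> p h ^ (2 ^ Suc k - 1)" for k
  proof (induction k)
    case 0
    show ?case by (rule exI[of _ h]) simp
  next
    case (Suc k)
    then obtain r where r: "h * r = sq (Suc k) h" "p r \<le> p h ^ (2 ^ Suc k - 1)" by blast
    have "p (r * sq (Suc k) h) \<le> p r * p h ^ (2 ^ Suc k)"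
      using D(3)[of r "sq (Suc k) h"] power_mult_seminorm_sq[OF p(1), of "Suc k" h] by simp
    also have "\<dots> \<le> p h ^ (2 ^ Suc k - 1) * p h ^ (2 ^ Suc k)"
      using r(2) ph by (intro mult_right_mono) auto
    also have "\<dots> = p h ^ (2 ^ Suc (Suc k) - 1)"
    proof -
      have "2 ^ Suc k - 1 + 2 ^ Suc k = (2 ^ Suc (Suc k) - 1 :: nat)" using one_le_power[of "2::nat" k] by simp
      then show ?thesis by (simp only: power_add[symmetric])
    qed
    finally show ?case using r(1) by (intro exI[of _ "r * sq (Suc k) h"]) (simp add: mult.assoc[symmetric])
  qed
  have hh: "p (h * sq k h) = p h * p h ^ (2 ^ k)" for k
  proof (rule antisym)
    show "p (h * sq k h) \<le> p h * p h ^ (2 ^ k)" using D(3)[of h "sq k h"] power_mult_seminorm_sq[OF p(1), of k h] by simp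
    show "p h * p h ^ (2 ^ k) \<le> p (h * sq k h)"
    proof (cases k)
      case 0
      then show ?thesis by (simp add: D(4) power2_eq_square)
    next
      case (Suc j)
      obtain r where r: "h * r = sq k h" "p r \<le> p h ^ (2 ^ k - 1)" using rest[of j] Suc by blast
      have "(h * sq k h) * r = (h * r) * sq k h" by (simp only: ac_simps)
      then have "sq (Suc k) h = (h * sq k h) * r" by (simp only: r(1) sq.simps)
      then have "p h ^ (2 ^ Suc k) \<le> p (h * sq k h) * p r"
        using power_mult_seminorm_sq[OF p(1), of "Suc k" h] D(3)[of "h * sq k h" r] by simp
      also have "\<dots> \<le> p (h * sq k h) * p h ^ (2 ^ k - 1)"
        using r(2) D(8) by (intro mult_left_mono) auto
      finally have "p h ^ (2 ^ Suc k) \<le> p (h * sq k h) * p h ^ (2 ^ k - 1)" .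
      moreover have "(2::nat) ^ Suc k = Suc (2 ^ k) + (2 ^ k - 1)" by simp
      ultimately have "p h ^ Suc (2 ^ k) * p h ^ (2 ^ k - 1) \<le> p (h * sq k h) * p h ^ (2 ^ k - 1)"
        by (simp only: power_add)
      then show ?thesis using ph by simp
    qed
  qed
  have hx: "p (h * x) = p h * p x" for x
    using mult[OF ph hh, of x] D(3)[of h x] by (simp add: mult.commute)
  have "p (x * y) = p x * p y" for x y
  proof (cases "p y > 0")
    case True
    show ?thesis
      by (rule antisym[OF D(3) mult[OF True]]) (simp add: hx power_mult_seminorm_sq[OF p(1)])
  next
    case False
    then have "p y = 0" using D(8)[of y] by simp
    then show ?thesis using D(3)[of x y] D(8)[of "x * y"] by simp
  qed
  with p show thesis by (rule that)
qed

text \<open>If the minimum \<open>M\<close> of \<open>p (a * h - z *\<^sub>C h)\<close> were positive, the factorisation of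
  \<open>c\<^sup>m - w\<^sup>m h\<^sup>m\<close>, with \<open>m = 2\<^sup>k\<close> large, would show that it is attained on a whole disc of radius \<open>M / p h\<close>
  around each minimiser, and so everywhere.\<close>

lemma gelfand_mazur:
  fixes a h :: "'a::{complex_normed_algebra, comm_ring}"
  assumes p: "power_mult_seminorm p" and mult: "\<And>x y. p (x * y) = p x * p y" and h: "p h > 0"
  shows "\<exists>z. p (a * h - z *\<^sub>C h) = 0"
proof -
  note D = power_mult_seminormD[OF p]
  define F where "F z = p (a * h - z *\<^sub>C h)" for z
  have diff: "a * h - z *\<^sub>C h - (a * h - w *\<^sub>C h) = (w - z) *\<^sub>C h" for z w
    using scaleC_add_left[of "w - z" z h] by (simp add: algebra_simps)
  have lip: "\<bar>F z - F w\<bar> \<le> p h * cmod (z - w)" for z w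
    using D(10)[of "a * h - z *\<^sub>C h" "a * h - w *\<^sub>C h"]
    unfolding F_def diff D(2) by (simp add: norm_minus_commute mult.commute)
  have cont: "continuous_on UNIV F"
    by (rule lipschitz_on_continuous_on[of "p h"], rule lipschitz_onI)
      (use lip h in \<open>simp_all add: dist_real_def dist_norm\<close>)
  have grow: "cmod z * p h - p (a * h) \<le> F z" for z
    using D(10)[of "a * h" "z *\<^sub>C h"] D(2)[of z h] by (simp add: F_def)
  \<comment> \<open>Outside this disc \<open>grow\<close> pushes \<open>F\<close> above
    \<open>p (a * h) = F 0\<close>, so the minimum over the disc is global.\<close>
  define R where "R = 2 * p (a * h) / p h"
  have "R \<ge> 0" using D(8) h by (simp add: R_def)
  then have "cball (0::complex) R \<noteq> {}" by simp
  from continuous_attains_inf[OF compact_cball this continuous_on_subset[OF cont]]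
  obtain z0 where z0: "z0 \<in> cball 0 R" "\<And>z. z \<in> cball 0 R \<Longrightarrow> F z0 \<le> F z" by auto
  define M where "M = F z0"
  have min: "M \<le> F z" for z
  proof (cases "cmod z \<le> R")
    case True
    then show ?thesis using z0(2)[of z] by (simp add: M_def)
  next
    case False
    then have "cmod z * p h > R * p h" using h by simp
    then have "F z > p (a * h)" using grow[of z] h by (simp add: R_def)
    moreover have "F z0 \<le> F 0" using \<open>R \<ge> 0\<close> by (intro z0(2)) simp
    ultimately show ?thesis by (simp add: M_def F_def)
  qed
  have "M = 0"
  proof (rule ccontr)
    assume "M \<noteq> 0"
    then have M: "M > 0" using D(8) by (simp add: M_def F_def order.strict_iff_order)
    have step: "F (z + w) = M" if z: "F z = M" and w: "cmod w * p h < M" for z w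
    proof -
      define c where "c = a * h - z *\<^sub>C h"
      have pc: "p c = M" using z by (simp add: c_def F_def)
      have cw: "p (c - u *\<^sub>C h) = F (z + u)" for u
        by (simp add: c_def F_def scaleC_add_left algebra_simps)
      have fac: "sq (Suc k) c - (r * r) *\<^sub>C sq (Suc k) h
          = (sq k c - r *\<^sub>C sq k h) * (sq k c - (- r) *\<^sub>C sq k h)" for k r
      proof -
        have "(- r) *\<^sub>C y = - (r *\<^sub>C y)" for y :: 'a
          using scaleC_scaleC[of "-1" r y] by (simp add: scaleC_minus1)
        then show ?thesis
          by (simp add: left_diff_distrib right_diff_distrib distrib_left distrib_right
              mult_scaleC_left mult_scaleC_right scaleC_scaleC mult.commute)
      qed
      \<comment> \<open>With a complex square root \<open>r\<close> of the coefficient, the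
        difference at level \<open>Suc k\<close> is a product of two differences at level
        \<open>k\<close>; at level 0 the bound is the minimality of \<open>M\<close>.\<close>
      have low: "p (sq k c - \<nu> *\<^sub>C sq k h) \<ge> M ^ (2 ^ k)" for k \<nu>
      proof (induction k arbitrary: \<nu>)
        case 0
        show ?case using min by (simp add: cw)
      next
        case (Suc k)
        define r where "r = csqrt \<nu>"
        have "\<nu> = r * r" by (simp add: r_def power2_eq_square[symmetric])
        then have "p (sq (Suc k) c - \<nu> *\<^sub>C sq (Suc k) h)
            = p (sq k c - r *\<^sub>C sq k h) * p (sq k c - (- r) *\<^sub>C sq k h)"
          by (simp only: fac mult)
        then show ?case
          unfolding power_two_power_Suc using mult_mono[OF Suc[of r] Suc[of "- r"]] M D(8) by simp
      qed
      \<comment> \<open>Each level splits off one factor with a plus sign, at least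
        \<open>M ^ (2 ^ k)\<close> by \<open>low\<close>, until only \<open>c - w h\<close> remains.
        The exponents add up to 1 + 2 + ... + \<open>2 ^ (k - 1)\<close> =
        \<open>2 ^ k - 1\<close>.\<close>
      have up: "p (c - w *\<^sub>C h) * M ^ (2 ^ k - 1) \<le> p (sq k c - (w ^ (2 ^ k)) *\<^sub>C sq k h)" for k
      proof (induction k)
        case 0
        show ?case by simp
      next
        case (Suc k)
        define W where "W = w ^ (2 ^ k)"
        have "M ^ (2 ^ Suc k - 1) = M ^ (2 ^ k - 1) * M ^ (2 ^ k)"
        proof -
          have "2 ^ Suc k - 1 = (2 ^ k - 1) + (2 ^ k :: nat)" using one_le_power[of "2::nat" k] by simp
          then show ?thesis by (simp only: power_add)
        qed
        then have "p (c - w *\<^sub>C h) * M ^ (2 ^ Suc k - 1) = (p (c - w *\<^sub>C h) * M ^ (2 ^ k - 1)) * M ^ (2 ^ k)"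
          by (simp only: mult.assoc)
        also have "\<dots> \<le> p (sq k c - W *\<^sub>C sq k h) * p (sq k c - (- W) *\<^sub>C sq k h)"
          using Suc low[of k "- W"] M D(8) by (intro mult_mono) (auto simp: W_def)
        also have "\<dots> = p (sq (Suc k) c - (w ^ (2 ^ Suc k)) *\<^sub>C sq (Suc k) h)"
          by (simp only: fac mult power_two_power_Suc W_def)
        finally show ?case .
      qed
      define \<rho> where "\<rho> = cmod w * p h / M"
      have \<rho>: "0 \<le> \<rho>" "\<rho> < 1" using w M h by (auto simp: \<rho>_def)
      have bound: "F (z + w) \<le> M * (1 + \<rho> ^ (2 ^ k))" for k
      proof -
        have "F (z + w) * M ^ (2 ^ k - 1) \<le> p (sq k c) + p ((w ^ (2 ^ k)) *\<^sub>C sq k h)"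
          using up[of k] D(9)[of "sq k c" "(w ^ (2 ^ k)) *\<^sub>C sq k h"] unfolding cw by linarith
        also have "\<dots> = M ^ (2 ^ k) + (cmod w * p h) ^ (2 ^ k)"
          by (simp add: D(2) power_mult_seminorm_sq[OF p] pc norm_power power_mult_distrib)
        also have "\<dots> = M ^ (2 ^ k) * (1 + \<rho> ^ (2 ^ k))"
          using M by (simp add: \<rho>_def power_divide distrib_left)
        also have "M ^ (2 ^ k) = M * M ^ (2 ^ k - 1)"
          by (simp add: power_Suc[symmetric] del: power_Suc)
        finally show ?thesis using M by (simp add: ac_simps)
      qed
      have "(\<lambda>k. M * (1 + \<rho> ^ (2 ^ k))) \<longlonglongrightarrow> M * (1 + 0)"
      proof (intro tendsto_intros)
        have "strict_mono (\<lambda>k. (2::nat) ^ k)" by (simp add: strict_mono_def)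
        from LIMSEQ_subseq_LIMSEQ[OF LIMSEQ_realpow_zero[OF \<rho>] this]
        show "(\<lambda>k. \<rho> ^ (2 ^ k)) \<longlonglongrightarrow> 0" by (simp add: o_def)
      qed
      then have "F (z + w) \<le> M" using bound LIMSEQ_le_const by fastforce
      then show ?thesis using min[of "z + w"] by simp
    qed
    \<comment> \<open>Half of the admissible radius. Walking in steps of this size keeps
      \<open>F\<close> at \<open>M\<close>, while \<open>grow\<close> makes \<open>F\<close>
      unbounded.\<close>
    define \<delta> where "\<delta> = complex_of_real (M / (2 * p h))"
    have \<delta>: "cmod \<delta> * p h = M / 2" using M h by (simp add: \<delta>_def norm_divide norm_mult)
    have all: "F (z0 + of_nat k * \<delta>) = M" for k
    proof (induction k)
      case (Suc k)
      have "F ((z0 + of_nat k * \<delta>) + \<delta>) = M" by (rule step[OF Suc]) (use \<delta> M in simp)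
      then show ?case by (simp add: algebra_simps)
    qed (simp add: M_def)
    obtain k :: nat where k: "real k * (M / 2) > M + p (a * h) + cmod z0 * p h"
      using ex_less_of_nat_mult[of "M / 2" "M + p (a * h) + cmod z0 * p h"] M by auto
    have "cmod (of_nat k * \<delta>) \<le> cmod (z0 + of_nat k * \<delta>) + cmod z0"
      using norm_triangle_ineq4[of "z0 + of_nat k * \<delta>" z0] by simp
    then have "cmod (of_nat k * \<delta>) * p h \<le> cmod (z0 + of_nat k * \<delta>) * p h + cmod z0 * p h"
      using h by (simp add: distrib_right[symmetric])
    moreover have "cmod (of_nat k * \<delta>) * p h = real k * (M / 2)" using \<delta> by (simp add: norm_mult mult.assoc)
    ultimately show False using grow[of "z0 + of_nat k * \<delta>"] all[of k] k by linarith
  qed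
  then show ?thesis unfolding M_def F_def by blast
qed

section \<open>From multiplicative seminorms to characters\<close>

definition character :: "('a::complex_normed_algebra \<Rightarrow> complex) \<Rightarrow> bool"
  where "character \<omega> \<longleftrightarrow> clinear \<omega> \<and> (\<forall>x y. \<omega> (x * y) = \<omega> x * \<omega> y) \<and>
    (\<forall>x. cmod (\<omega> x) \<le> norm x) \<and> (\<exists>x. \<omega> x \<noteq> 0)"

lemma characterD:
  assumes "character \<omega>"
  shows "clinear \<omega>" "\<omega> (x * y) = \<omega> x * \<omega> y" "cmod (\<omega> x) \<le> norm x"
    "\<omega> (x + y) = \<omega> x + \<omega> y" "\<omega> (x - y) = \<omega> x - \<omega> y" "\<omega> (- x) = - \<omega> x" "\<omega> 0 = 0"
    "\<omega> (c *\<^sub>C x) = c * \<omega> x" "\<omega> (r *\<^sub>R x) = of_real r * \<omega> x" "\<omega> (sum f I) = (\<Sum>i\<in>I. \<omega> (f i))"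
proof -
  show l: "clinear \<omega>" and "\<omega> (x * y) = \<omega> x * \<omega> y" and "cmod (\<omega> x) \<le> norm x"
    using assms by (auto simp: character_def)
  show "\<omega> (x + y) = \<omega> x + \<omega> y" "\<omega> (x - y) = \<omega> x - \<omega> y" "\<omega> (- x) = - \<omega> x" "\<omega> 0 = 0"
    "\<omega> (c *\<^sub>C x) = c * \<omega> x" "\<omega> (r *\<^sub>R x) = of_real r * \<omega> x" "\<omega> (sum f I) = (\<Sum>i\<in>I. \<omega> (f i))"
    using clinearD[OF l] by (simp_all add: scaleC_complex_def scaleR_conv_of_real)
qed

text \<open>The element \<open>h\<close> replaces the unit: modulo the kernel of a multiplicative
  \<open>p\<close>, Gelfand-Mazur makes \<open>a * h\<close> a scalar multiple of \<open>h\<close>,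
  and this scalar is the value at \<open>a\<close>. Uniqueness of the scalar turns every algebraic
  identity into a seminorm estimate.\<close>

lemma character_exists_pm:
  fixes h :: "'a::{complex_normed_algebra, comm_ring}"
  assumes norm: "power_mult_seminorm (norm :: 'a \<Rightarrow> real)" and h: "h \<noteq> 0"
  obtains \<omega> where "character \<omega>" "cmod (\<omega> h) = norm h"
proof -
  obtain p :: "'a \<Rightarrow> real" where p: "power_mult_seminorm p" "p h = norm h" and mult: "\<And>x y. p (x * y) = p x * p y"
    using multiplicative_seminorm_exists[OF norm] by blast
  note D = power_mult_seminormD[OF p(1)]
  have ph: "p h > 0" using h p(2) by simp
  define \<omega> where "\<omega> a = (SOME z. p (a * h - z *\<^sub>C h) = 0)" for a
  have \<omega>: "p (a * h - \<omega> a *\<^sub>C h) = 0" for a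
    unfolding \<omega>_def by (rule someI_ex) (rule gelfand_mazur[OF p(1) mult ph])
  have uniq: "\<omega> a = z" if "p (a * h - z *\<^sub>C h) = 0" for a z
  proof -
    have "(\<omega> a - z) *\<^sub>C h = (a * h - z *\<^sub>C h) - (a * h - \<omega> a *\<^sub>C h)"
      using scaleC_add_left[of "\<omega> a - z" z h] by simp
    then have "p ((\<omega> a - z) *\<^sub>C h) \<le> 0"
      using D(9)[of "a * h - z *\<^sub>C h" "a * h - \<omega> a *\<^sub>C h"] that \<omega>[of a] by simp
    then have "cmod (\<omega> a - z) * p h \<le> 0" by (simp add: D(2))
    then show ?thesis using ph by (simp add: mult_le_0_iff)
  qed
  have zero: "p x = 0" if "p x \<le> 0" for x using that D(8)[of x] by simp
  have norm: "cmod (\<omega> a) = p a" for a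
  proof -
    have "p (a * h) = p (\<omega> a *\<^sub>C h)" using D(10)[of "a * h" "\<omega> a *\<^sub>C h"] \<omega>[of a] by simp
    then show ?thesis using ph by (simp add: mult D(2))
  qed
  have "\<omega> (a + b) = \<omega> a + \<omega> b" for a b
  proof (rule uniq, rule zero)
    have "(a + b) * h - (\<omega> a + \<omega> b) *\<^sub>C h = (a * h - \<omega> a *\<^sub>C h) + (b * h - \<omega> b *\<^sub>C h)"
      by (simp add: scaleC_add_left algebra_simps)
    then show "p ((a + b) * h - (\<omega> a + \<omega> b) *\<^sub>C h) \<le> 0"
      using D(1)[of "a * h - \<omega> a *\<^sub>C h" "b * h - \<omega> b *\<^sub>C h"] \<omega>[of a] \<omega>[of b] by simp
  qed
  moreover have "\<omega> (c *\<^sub>C a) = c * \<omega> a" for a c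
  proof (rule uniq)
    have "(c *\<^sub>C a) * h - (c * \<omega> a) *\<^sub>C h = c *\<^sub>C (a * h - \<omega> a *\<^sub>C h)"
      by (simp add: scaleC_diff_right mult_scaleC_left scaleC_scaleC)
    then show "p ((c *\<^sub>C a) * h - (c * \<omega> a) *\<^sub>C h) = 0"
      using \<omega>[of a] by (simp add: D(2))
  qed
  moreover have "\<omega> (a * b) = \<omega> a * \<omega> b" for a b
  proof (rule uniq, rule zero)
    have "(a * b) * h - (\<omega> a * \<omega> b) *\<^sub>C h = a * (b * h - \<omega> b *\<^sub>C h) + \<omega> b *\<^sub>C (a * h - \<omega> a *\<^sub>C h)"
      by (simp add: right_diff_distrib scaleC_diff_right mult_scaleC_right scaleC_scaleC mult.assoc) (simp add: mult.commute)
    then show "p ((a * b) * h - (\<omega> a * \<omega> b) *\<^sub>C h) \<le> 0"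
      using D(1)[of "a * (b * h - \<omega> b *\<^sub>C h)" "\<omega> b *\<^sub>C (a * h - \<omega> a *\<^sub>C h)"] \<omega>[of a] \<omega>[of b]
      by (simp add: D(2) mult)
  qed
  moreover have "cmod (\<omega> a) \<le> norm a" for a unfolding norm by (rule D(5))
  moreover have n: "cmod (\<omega> h) = norm h" by (simp add: norm p(2))
  then have "\<omega> h \<noteq> 0" using h by auto
  ultimately have "character \<omega>" by (auto simp: character_def clinear_def scaleC_complex_def)
  then show thesis using n by (rule that)
qed

section \<open>The involution and the Gelfand isometry\<close>

lemma norm_adj [simp]: "norm (adj x) = norm (x::'a::cstar_algebra)"
proof -
  have "norm x \<le> norm (adj x)" for x :: 'a
  proof (cases "norm x = 0")
    case False
    have "norm x * norm x \<le> norm (adj x) * norm x"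
      using cstar_identity[of x] norm_mult_ineq[of "adj x" x] by (simp add: power2_eq_square)
    then show ?thesis using False by simp
  qed simp
  from this[of x] this[of "adj x"] show ?thesis by (simp add: adj_adj)
qed

text \<open>By commutativity \<open>adj (x * x) * (x * x)\<close> is the square of the self-adjoint
  element \<open>adj x * x\<close>, so the C*-identity applies twice.\<close>

lemma power_mult_seminorm_cstar: "power_mult_seminorm (norm :: 'a::{cstar_algebra, comm_ring} \<Rightarrow> real)"
  unfolding power_mult_seminorm_def
proof (intro conjI allI)
  fix x :: 'a
  have "(norm (x * x))\<^sup>2 = norm ((adj x * x) * (adj x * x))"
    by (simp add: cstar_identity[symmetric] adj_mult ac_simps)
  also have "\<dots> = norm (adj (adj x * x) * (adj x * x))" by (simp add: adj_mult adj_adj)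
  also have "\<dots> = ((norm x)\<^sup>2)\<^sup>2" by (simp only: cstar_identity)
  finally show "norm (x * x) = (norm x)\<^sup>2" by (subst (asm) power2_eq_iff_nonneg) simp_all
qed (simp_all add: norm_triangle_ineq norm_mult_ineq norm_scaleC)

lemma character_exists:
  fixes h :: "'a::{cstar_algebra, comm_ring}"
  assumes "h \<noteq> 0"
  obtains \<omega> where "character \<omega>" "cmod (\<omega> h) = norm h"
  using character_exists_pm[OF power_mult_seminorm_cstar assms] by blast

text \<open>Arens' argument for the adjoint of a unital algebra, with multiplication by \<open>h + i t\<close> as an
  operator in place of the missing unit.\<close>

lemma character_selfadjoint:
  fixes h :: "'a::{cstar_algebra, comm_ring}"
  assumes \<omega>: "character \<omega>" and h: "adj h = h"
  shows "Im (\<omega> h) = 0"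
proof (rule ccontr)
  assume im: "Im (\<omega> h) \<noteq> 0"
  note X = characterD[OF \<omega>]
  obtain a where a: "\<omega> a \<noteq> 0" using \<omega> by (auto simp: character_def)
  \<comment> \<open>Comparing \<open>|\<omega> h + i t|\<^sup>2\<close> with
    \<open>(norm h)\<^sup>2 + t\<^sup>2\<close> bounds \<open>2 * (Im (\<omega> h) * t)\<close> by
    \<open>(norm h)\<^sup>2\<close>; this \<open>t\<close> makes the left side too large.\<close>
  define t where "t = ((norm h)\<^sup>2 + 1) / Im (\<omega> h)"
  have "(norm h)\<^sup>2 + 1 > 0" by (simp add: add_nonneg_pos)
  then have t0: "t \<noteq> 0" using im unfolding t_def by (metis divide_eq_0_iff less_irrefl)
  define T where "T b = h * b + (\<i> * complex_of_real t) *\<^sub>C b" for b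
  define S where "S = sqrt ((norm h)\<^sup>2 + t\<^sup>2)"
  have S: "S > 0" using t0 by (simp add: S_def add_nonneg_pos)
  have S2: "S\<^sup>2 = (norm h)\<^sup>2 + t\<^sup>2" by (simp add: S_def)
  have T: "norm (T b) \<le> S * norm b" for b
  proof -
    have "adj (T b) * T b = (h * h) * (adj b * b) + complex_of_real (t\<^sup>2) *\<^sub>C (adj b * b)"
    proof -
      have "adj (T b) = h * adj b + (- \<i> * complex_of_real t) *\<^sub>C adj b"
        by (simp add: T_def adj_add adj_mult adj_scaleC h mult.commute)
      then have "adj (T b) * T b = h * adj b * (h * b) + (h * adj b) * ((\<i> * complex_of_real t) *\<^sub>C b)
          + ((- \<i> * complex_of_real t) *\<^sub>C adj b) * (h * b)
          + ((- \<i> * complex_of_real t) *\<^sub>C adj b) * ((\<i> * complex_of_real t) *\<^sub>C b)"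
        by (simp only: T_def distrib_left distrib_right ac_simps)
      also have "((- \<i> * complex_of_real t) *\<^sub>C adj b) * (h * b) = (- \<i> * complex_of_real t) *\<^sub>C (h * adj b * b)"
        unfolding mult_scaleC_left by (simp only: ac_simps)
      also have "(h * adj b) * ((\<i> * complex_of_real t) *\<^sub>C b) = (\<i> * complex_of_real t) *\<^sub>C (h * adj b * b)"
        by (simp only: mult_scaleC_right)
      also have "((- \<i> * complex_of_real t) *\<^sub>C adj b) * ((\<i> * complex_of_real t) *\<^sub>C b)
          = complex_of_real (t\<^sup>2) *\<^sub>C (adj b * b)"
      proof -
        have "(- \<i> * complex_of_real t) * (\<i> * complex_of_real t) = complex_of_real (t\<^sup>2)"
          by (simp add: complex_eq_iff power2_eq_square)
        then show ?thesis by (subst mult_scaleC_left, subst mult_scaleC_right, subst scaleC_scaleC) (simp only:)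
      qed
      also have "h * adj b * (h * b) = (h * h) * (adj b * b)" by (simp only: ac_simps)
      also have "(h * h) * (adj b * b) + (\<i> * complex_of_real t) *\<^sub>C (h * adj b * b)
          + (- \<i> * complex_of_real t) *\<^sub>C (h * adj b * b) = (h * h) * (adj b * b)"
        unfolding add.assoc scaleC_add_left[symmetric] by simp
      finally show ?thesis .
    qed
    then have "(norm (T b))\<^sup>2 = norm ((h * h) * (adj b * b) + complex_of_real (t\<^sup>2) *\<^sub>C (adj b * b))"
      by (simp only: cstar_identity[symmetric])
    also have "\<dots> \<le> norm h * norm h * norm (adj b * b) + t\<^sup>2 * norm (adj b * b)"
    proof (rule norm_triangle_le, rule add_mono)
      have "norm ((h * h) * (adj b * b)) \<le> norm (h * h) * norm (adj b * b)" by (rule norm_mult_ineq)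
      also have "\<dots> \<le> norm h * norm h * norm (adj b * b)"
        by (rule mult_right_mono[OF norm_mult_ineq]) simp
      finally show "norm ((h * h) * (adj b * b)) \<le> norm h * norm h * norm (adj b * b)" .
      show "norm (complex_of_real (t\<^sup>2) *\<^sub>C (adj b * b)) \<le> t\<^sup>2 * norm (adj b * b)"
        unfolding norm_scaleC norm_of_real by simp
    qed
    also have "\<dots> = (S * norm b)\<^sup>2"
      unfolding cstar_identity power_mult_distrib S2 by (simp add: power2_eq_square[of "norm h"] distrib_right)
    finally show ?thesis using S by (simp add: power2_le_iff_abs_le)
  qed
  \<comment> \<open>A single application would leave the factor
    \<open>norm a / cmod (\<omega> a)\<close>, which may exceed 1. Iterating removes it, as it does
    not grow with \<open>n\<close>.\<close>
  have Tn: "norm ((T ^^ n) a) \<le> S ^ n * norm a" for n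
  proof (induction n)
    case (Suc n)
    have "norm (T ((T ^^ n) a)) \<le> S * norm ((T ^^ n) a)" by (rule T)
    also have "\<dots> \<le> S * (S ^ n * norm a)" using Suc S by (intro mult_left_mono) auto
    finally show ?case by (simp add: mult.assoc)
  qed simp
  define u where "u = \<omega> h + \<i> * complex_of_real t"
  have \<omega>n: "\<omega> ((T ^^ n) a) = u ^ n * \<omega> a" for n
    by (induction n) (simp_all add: T_def X u_def algebra_simps)
  have pow: "(cmod u / S) ^ n \<le> norm a / cmod (\<omega> a)" for n
  proof -
    have "cmod u ^ n * cmod (\<omega> a) \<le> S ^ n * norm a"
      using order_trans[OF X(3) Tn, of n] by (simp add: \<omega>n norm_mult norm_power)
    then show ?thesis using S a by (simp add: field_simps power_divide)
  qed
  have "cmod u / S \<le> 1"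
  proof (rule ccontr)
    assume "\<not> cmod u / S \<le> 1"
    then obtain n where "norm a / cmod (\<omega> a) < (cmod u / S) ^ n"
      using real_arch_pow[of "cmod u / S" "norm a / cmod (\<omega> a)"] by auto
    then show False using pow[of n] by simp
  qed
  then have "(cmod u)\<^sup>2 \<le> S\<^sup>2" using S by (intro power_mono) auto
  then have "(Re (\<omega> h))\<^sup>2 + (Im (\<omega> h) + t)\<^sup>2 \<le> (norm h)\<^sup>2 + t\<^sup>2"
    unfolding S2 by (simp add: u_def cmod_power2)
  then have "2 * (Im (\<omega> h) * t) \<le> (norm h)\<^sup>2"
    using zero_le_power2[of "Re (\<omega> h)"] zero_le_power2[of "Im (\<omega> h)"] unfolding power2_sum by linarith
  moreover have "Im (\<omega> h) * t = (norm h)\<^sup>2 + 1" using im by (simp add: t_def)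
  ultimately show False using zero_le_power2[of "norm h"] by linarith
qed

lemma character_adj:
  fixes x :: "'a::{cstar_algebra, comm_ring}"
  assumes \<omega>: "character \<omega>"
  shows "\<omega> (adj x) = cnj (\<omega> x)"
proof -
  note X = characterD[OF \<omega>]
  have "Im (\<omega> (x + adj x)) = 0"
    by (rule character_selfadjoint[OF \<omega>]) (simp add: adj_add adj_adj add.commute)
  moreover have "Im (\<omega> (\<i> *\<^sub>C x + (- \<i>) *\<^sub>C adj x)) = 0"
    by (rule character_selfadjoint[OF \<omega>]) (simp add: adj_add adj_adj adj_scaleC add.commute)
  ultimately show ?thesis by (simp add: X complex_eq_iff)
qed

text \<open>The norm of a nonzero element is attained at a character, so the Gelfand transform is
  isometric and bounds can be verified pointwise.\<close>

lemma gelfand_norm_le: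
  fixes x :: "'a::{cstar_algebra, comm_ring}"
  assumes "0 \<le> M" "\<And>\<omega>. character \<omega> \<Longrightarrow> cmod (\<omega> x) \<le> M"
  shows "norm x \<le> M"
proof (cases "x = 0")
  case False
  then obtain \<omega> where "character \<omega>" "cmod (\<omega> x) = norm x" by (rule character_exists)
  then show ?thesis using assms(2)[of \<omega>] by simp
qed (use assms(1) in simp)

lemma gelfand_eqI:
  fixes x y :: "'a::{cstar_algebra, comm_ring}"
  assumes "\<And>\<omega>. character \<omega> \<Longrightarrow> \<omega> x = \<omega> y"
  shows "x = y"
proof -
  have "norm (x - y) \<le> 0" by (rule gelfand_norm_le) (simp_all add: characterD assms)
  then show ?thesis by simp
qed

section \<open>Continuous functional calculus\<close>

instance complex_banach_algebra \<subseteq> banach ..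

lemma fcalc_exists:
  fixes a :: "'a::{cstar_algebra, comm_ring}"
  assumes g: "continuous_on UNIV (g :: real \<Rightarrow> real)" "g 0 = 0"
  shows "\<exists>b. \<forall>\<omega>. character \<omega> \<longrightarrow> \<omega> b = of_real (g (Re (\<omega> a)))"
proof -
  \<comment> \<open>The self-adjoint part, whose value at a character is
    \<open>Re (\<omega> a)\<close>; through it the calculus accepts every \<open>a\<close>.\<close>
  define s where "s = (1/2) *\<^sub>R (a + adj a)"
  have s: "\<omega> s = of_real (Re (\<omega> a))" if "character \<omega>" for \<omega>
    using that by (simp add: s_def characterD character_adj complex_add_cnj)
  define M where "M = norm a"
  have M: "Re (\<omega> a) \<in> {- M..M}" if "character \<omega>" for \<omega>
    using characterD(3)[OF that, of a] abs_Re_le_cmod[of "\<omega> a"] by (auto simp: M_def)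
  have M0: "0 \<in> {-M..M}" by (simp add: M_def)
  have "\<exists>b. \<forall>\<omega>. character \<omega> \<longrightarrow> cmod (\<omega> b - of_real (g (Re (\<omega> a)))) \<le> 2 / real (Suc n)" for n
  proof -
    have cg: "continuous_on {- M..M} g" using g(1) continuous_on_subset by blast
    obtain q where q: "real_polynomial_function q" "\<And>x. x \<in> {- M..M} \<Longrightarrow> \<bar>g x - q x\<bar> < 1 / real (Suc n)"
      using Stone_Weierstrass_real_polynomial_function[OF compact_Icc cg, of "1 / real (Suc n)"] by auto
    obtain c m where c: "q = (\<lambda>x. \<Sum>i\<le>m. c i * x ^ i)"
      using q(1) unfolding real_polynomial_function_iff_sum by blast
    \<comment> \<open>The constant term is dropped because there is no unit, and powers of
      \<open>s\<close> are iterated products. As \<open>g 0 = 0\<close>, dropping \<open>q 0\<close>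
      costs one more \<open>1 / real (Suc n)\<close>, whence the numerator 2.\<close>
    define b where "b = (\<Sum>i=1..m. c i *\<^sub>R ((*) s ^^ (i - 1)) s)"
    have "cmod (\<omega> b - of_real (g (Re (\<omega> a)))) \<le> 2 / real (Suc n)" if \<omega>: "character \<omega>" for \<omega>
    proof -
      have pw: "\<omega> (((*) s ^^ k) s) = of_real (Re (\<omega> a)) ^ Suc k" for k
        by (induction k) (simp_all add: characterD(2)[OF \<omega>] s[OF \<omega>])
      have "\<omega> b = (\<Sum>i=1..m. of_real (c i * Re (\<omega> a) ^ i))"
        unfolding b_def characterD(9,10)[OF \<omega>] pw
      proof (rule sum.cong[OF refl])
        fix i assume "i \<in> {1..m}"
        then have "Suc (i - 1) = i" by simp
        then show "of_real (c i) * of_real (Re (\<omega> a)) ^ Suc (i - 1) = (of_real (c i * Re (\<omega> a) ^ i) :: complex)"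
          by (simp only: of_real_mult of_real_power)
      qed
      moreover have "q (Re (\<omega> a)) = q 0 + (\<Sum>i=1..m. c i * Re (\<omega> a) ^ i)"
        unfolding c by (simp add: atMost_atLeast0 sum.atLeast_Suc_atMost)
      ultimately have "\<omega> b = of_real (q (Re (\<omega> a)) - q 0)" by simp
      then have "cmod (\<omega> b - of_real (g (Re (\<omega> a)))) = \<bar>(q (Re (\<omega> a)) - q 0) - g (Re (\<omega> a))\<bar>"
        by (simp only: of_real_diff[symmetric] norm_of_real)
      then show ?thesis using q(2)[OF M[OF \<omega>]] q(2)[OF M0] g(2) by simp
    qed
    then show ?thesis by blast
  qed
  then obtain b where b: "\<And>n \<omega>. character \<omega> \<Longrightarrow> cmod (\<omega> (b n) - of_real (g (Re (\<omega> a)))) \<le> 2 / real (Suc n)"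
    by metis
  have diff: "norm (b m - b n) \<le> 2 / real (Suc m) + 2 / real (Suc n)" for m n
  proof (rule gelfand_norm_le)
    fix \<omega> :: "'a \<Rightarrow> complex" assume \<omega>: "character \<omega>"
    have "\<omega> (b m - b n) = (\<omega> (b m) - of_real (g (Re (\<omega> a)))) - (\<omega> (b n) - of_real (g (Re (\<omega> a))))"
      by (simp add: characterD(5)[OF \<omega>])
    then show "cmod (\<omega> (b m - b n)) \<le> 2 / real (Suc m) + 2 / real (Suc n)"
      using order_trans[OF norm_triangle_ineq4 add_mono[OF b[OF \<omega>, of m] b[OF \<omega>, of n]]] by simp
  qed simp
  have "Cauchy b"
  proof (rule CauchyI)
    fix e :: real assume e: "0 < e"
    obtain N where N: "inverse (real (Suc N)) < e / 4" using reals_Archimedean[of "e / 4"] e by auto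
    have "norm (b m - b n) < e" if "m \<ge> N" "n \<ge> N" for m n
    proof -
      have "2 / real (Suc k) < e / 2" if "k \<ge> N" for k
      proof -
        have "inverse (real (Suc k)) \<le> inverse (real (Suc N))"
          by (rule le_imp_inverse_le) (simp_all only: of_nat_le_iff Suc_le_mono that of_nat_0_less_iff zero_less_Suc)
        then have "2 * inverse (real (Suc k)) < e / 2" using N by linarith
        then show ?thesis by (simp only: divide_inverse)
      qed
      from this[OF that(1)] this[OF that(2)] show ?thesis using diff[of m n] by linarith
    qed
    then show "\<exists>N. \<forall>m\<ge>N. \<forall>n\<ge>N. norm (b m - b n) < e" by blast
  qed
  then obtain l where l: "b \<longlonglongrightarrow> l" using Cauchy_convergent_iff convergent_def by blast
  have "\<omega> l = of_real (g (Re (\<omega> a)))" if \<omega>: "character \<omega>" for \<omega>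
  proof (rule LIMSEQ_unique)
    have "(\<lambda>n. norm (b n - l)) \<longlonglongrightarrow> 0" using l by (simp add: LIM_zero tendsto_norm_zero)
    then have "(\<lambda>n. \<omega> (b n) - \<omega> l) \<longlonglongrightarrow> 0"
      by (rule Lim_null_comparison[rotated])
        (intro always_eventually allI, simp only: characterD(5)[OF \<omega>, symmetric] characterD(3)[OF \<omega>])
    then show "(\<lambda>n. \<omega> (b n)) \<longlonglongrightarrow> \<omega> l" by (rule LIM_zero_cancel)
    have "(\<lambda>n. 2 * (1 / real (Suc n))) \<longlonglongrightarrow> 2 * 0"
      by (intro tendsto_intros LIMSEQ_Suc[OF lim_1_over_n])
    then have "(\<lambda>n. 2 / real (Suc n)) \<longlonglongrightarrow> 0" by simp
    then have "(\<lambda>n. \<omega> (b n) - of_real (g (Re (\<omega> a)))) \<longlonglongrightarrow> 0"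
      by (rule Lim_null_comparison[rotated]) (intro always_eventually allI b \<omega>)
    then show "(\<lambda>n. \<omega> (b n)) \<longlonglongrightarrow> of_real (g (Re (\<omega> a)))" by (rule LIM_zero_cancel)
  qed
  then show ?thesis by blast
qed

text \<open>The calculus of the real part of \<open>a\<close>. The chosen element is unique, since
  characters separate points.\<close>

definition fcalc :: "(real \<Rightarrow> real) \<Rightarrow> 'a::{cstar_algebra, comm_ring} \<Rightarrow> 'a"
  where "fcalc g a = (SOME b. \<forall>\<omega>. character \<omega> \<longrightarrow> \<omega> b = of_real (g (Re (\<omega> a))))"

lemma fcalc:
  assumes "character \<omega>" "continuous_on UNIV g" "g 0 = 0"
  shows "\<omega> (fcalc g a) = of_real (g (Re (\<omega> a)))"
  using someI_ex[OF fcalc_exists[OF assms(2,3), of a]] assms(1) unfolding fcalc_def by blast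

definition vabs :: "'a::{cstar_algebra, comm_ring} \<Rightarrow> 'a"
  where "vabs x = fcalc sqrt (adj x * x)"

lemma character_vabs [simp]: "character \<omega> \<Longrightarrow> \<omega> (vabs x) = of_real (cmod (\<omega> x))"
proof -
  assume \<omega>: "character \<omega>"
  have "\<omega> (adj x * x) = of_real ((cmod (\<omega> x))\<^sup>2)"
    by (simp only: characterD(2)[OF \<omega>] character_adj[OF \<omega>] complex_norm_square mult.commute)
  then show ?thesis
    unfolding vabs_def by (subst fcalc[OF \<omega>]) (auto intro: continuous_on_real_sqrt[OF continuous_on_id])
qed

lemma norm_vabs [simp]: "norm (vabs x) = norm x"
proof (rule antisym)
  show "norm (vabs x) \<le> norm x" by (rule gelfand_norm_le) (simp_all add: characterD(3))
  show "norm x \<le> norm (vabs x)"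
  proof (rule gelfand_norm_le)
    fix \<omega> :: "'a \<Rightarrow> complex" assume "character \<omega>"
    then show "cmod (\<omega> x) \<le> norm (vabs x)" using characterD(3)[of \<omega> "vabs x"] by simp
  qed simp
qed

section \<open>Positive elements\<close>

text \<open>Order relations thereby become pointwise inequalities; \<open>pos_adj_mult\<close> and
  \<open>pos_square\<close> identify these elements with those of the form
  \<open>adj b * b\<close>.\<close>

definition pos :: "'a::{cstar_algebra, comm_ring} \<Rightarrow> bool"
  where "pos a \<longleftrightarrow> (\<forall>\<omega>. character \<omega> \<longrightarrow> \<omega> a = of_real (Re (\<omega> a)) \<and> 0 \<le> Re (\<omega> a))"

lemma posI: "(\<And>\<omega>. character \<omega> \<Longrightarrow> \<omega> a = of_real (r \<omega>)) \<Longrightarrow> (\<And>\<omega>. character \<omega> \<Longrightarrow> 0 \<le> r \<omega>) \<Longrightarrow> pos a"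
  unfolding pos_def by (metis Re_complex_of_real)

lemma posD:
  assumes "pos a" "character \<omega>"
  shows "\<omega> a = of_real (Re (\<omega> a))" "0 \<le> Re (\<omega> a)" "cmod (\<omega> a) = Re (\<omega> a)" "Im (\<omega> a) = 0"
proof -
  show 1: "\<omega> a = of_real (Re (\<omega> a))" and 2: "0 \<le> Re (\<omega> a)" using assms by (simp_all add: pos_def)
  show "cmod (\<omega> a) = Re (\<omega> a)" using 2 by (subst 1) simp
  show "Im (\<omega> a) = 0" by (subst 1) simp
qed

lemma posI': "(\<And>\<omega>. character \<omega> \<Longrightarrow> Im (\<omega> a) = 0) \<Longrightarrow> (\<And>\<omega>. character \<omega> \<Longrightarrow> 0 \<le> Re (\<omega> a)) \<Longrightarrow> pos a"
  by (simp add: pos_def complex_eq_iff)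

lemma pos_vabs [simp]: "pos (vabs x)"
  by (rule posI[of _ "\<lambda>\<omega>. cmod (\<omega> x)"]) simp_all

lemma pos_zero [simp]: "pos 0"
  by (simp add: pos_def characterD)

lemma pos_add: "pos a \<Longrightarrow> pos b \<Longrightarrow> pos (a + b)"
  by (rule posI') (simp_all add: characterD posD(2,4))

lemma pos_mult: "pos a \<Longrightarrow> pos b \<Longrightarrow> pos (a * b)"
  by (rule posI') (simp_all add: characterD posD(2,4))

lemma pos_scaleR: "pos a \<Longrightarrow> 0 \<le> r \<Longrightarrow> pos (r *\<^sub>R a)"
  by (rule posI') (simp_all add: characterD posD(2,4))

lemma pos_adj_mult: "pos (adj x * x)"
  by (rule posI[of _ "\<lambda>\<omega>. (cmod (\<omega> x))\<^sup>2"])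
    (simp_all only: characterD(2) character_adj complex_norm_square mult.commute zero_le_power2)

lemma pos_fcalc:
  assumes "continuous_on UNIV g" "g 0 = 0" "\<And>t. 0 \<le> g t"
  shows "pos (fcalc g a)"
  by (rule posI[of _ "\<lambda>\<omega>. g (Re (\<omega> a))"]) (simp_all add: fcalc assms)

lemma pos_square:
  assumes "pos a"
  obtains b where "a = adj b * b"
proof (rule that, rule gelfand_eqI)
  fix \<omega> :: "'a \<Rightarrow> complex" assume \<omega>: "character \<omega>"
  have "\<omega> (fcalc sqrt a) = of_real (sqrt (Re (\<omega> a)))"
    by (rule fcalc[OF \<omega>]) (auto intro: continuous_on_real_sqrt[OF continuous_on_id])
  then show "\<omega> a = \<omega> (adj (fcalc sqrt a) * fcalc sqrt a)"
    using posD[OF assms \<omega>] by (simp add: characterD(2)[OF \<omega>] character_adj[OF \<omega>] of_real_mult[symmetric] del: of_real_mult)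
qed

lemma pos_norm_le:
  assumes "pos a" "\<And>\<omega>. character \<omega> \<Longrightarrow> Re (\<omega> a) \<le> M" "0 \<le> M"
  shows "norm a \<le> M"
  by (rule gelfand_norm_le[OF assms(3)]) (simp add: posD(3)[OF assms(1)] assms(2))

section \<open>Positive functionals\<close>

lemma positive_functional_pos:
  fixes f :: "'a::{cstar_algebra, comm_ring} \<Rightarrow> complex"
  assumes f: "positive_functional f" and a: "pos a"
  shows "Im (f a) = 0" "0 \<le> Re (f a)"
proof -
  obtain b where "a = adj b * b" using pos_square[OF a] .
  then have "f a \<in> \<real>\<^sub>\<ge>\<^sub>0" using f by (simp add: positive_functional_def)
  then show "Im (f a) = 0" "0 \<le> Re (f a)" by (auto simp: complex_nonneg_Reals_iff)
qed

lemma positive_functionalI: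
  fixes f :: "'a::{cstar_algebra, comm_ring} \<Rightarrow> complex"
  assumes "clinear f" "\<And>a. pos a \<Longrightarrow> Im (f a) = 0 \<and> 0 \<le> Re (f a)"
  shows "positive_functional f"
  using assms pos_adj_mult by (auto simp: positive_functional_def complex_nonneg_Reals_iff)

lemma positive_functional_clinear: "positive_functional f \<Longrightarrow> clinear f"
  by (simp add: positive_functional_def)

lemma positive_functional_mono:
  fixes f :: "'a::{cstar_algebra, comm_ring} \<Rightarrow> complex"
  assumes f: "positive_functional f" and "pos (b - a)"
  shows "Re (f a) \<le> Re (f b)"
  using positive_functional_pos(2)[OF assms] clinearD(5)[OF positive_functional_clinear[OF f]] by simp

text \<open>A self-adjoint \<open>h\<close> has real value because \<open>vabs h + h\<close> and
  \<open>vabs h\<close> are positive. The real part of \<open>f y\<close> is therefore controlled by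
  \<open>f (vabs y)\<close>, and a rotation by the phase of \<open>f x\<close> does the
  rest.\<close>

lemma positive_functional_norm_le:
  fixes f :: "'a::{cstar_algebra, comm_ring} \<Rightarrow> complex"
  assumes f: "positive_functional f"
  shows "cmod (f x) \<le> Re (f (vabs x))"
proof -
  note L = clinearD[OF positive_functional_clinear[OF f]]
  have real: "Im (f h) = 0" if "adj h = h" for h
  proof -
    have "pos (vabs h + h)"
    proof (rule posI[of _ "\<lambda>\<omega>. cmod (\<omega> h) + Re (\<omega> h)"])
      fix \<omega> :: "'a \<Rightarrow> complex" assume \<omega>: "character \<omega>"
      have "Im (\<omega> h) = 0" by (rule character_selfadjoint[OF \<omega> that])
      then show "\<omega> (vabs h + h) = of_real (cmod (\<omega> h) + Re (\<omega> h))"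
        by (simp add: characterD[OF \<omega>] \<omega> complex_eq_iff)
      show "0 \<le> cmod (\<omega> h) + Re (\<omega> h)" using abs_Re_le_cmod[of "\<omega> h"] by linarith
    qed
    then have "Im (f (vabs h + h)) = 0" by (rule positive_functional_pos(1)[OF f])
    moreover have "Im (f (vabs h)) = 0" by (rule positive_functional_pos(1)[OF f]) simp
    ultimately show ?thesis by (simp add: L)
  qed
  have Re: "Re (f y) \<le> Re (f (vabs y))" for y
  proof -
    have "adj (\<i> *\<^sub>C (y - adj y)) = \<i> *\<^sub>C (y - adj y)"
    proof (rule gelfand_eqI)
      fix \<omega> :: "'a \<Rightarrow> complex" assume \<omega>: "character \<omega>"
      show "\<omega> (adj (\<i> *\<^sub>C (y - adj y))) = \<omega> (\<i> *\<^sub>C (y - adj y))"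
        by (simp add: characterD[OF \<omega>] character_adj[OF \<omega>] algebra_simps)
    qed
    then have "Im (f (\<i> *\<^sub>C (y - adj y))) = 0" by (rule real)
    then have eq: "Re (f (adj y)) = Re (f y)" by (simp add: L scaleC_complex_def)
    have "pos (vabs y - (1/2) *\<^sub>R (y + adj y))"
      by (rule posI[of _ "\<lambda>\<omega>. cmod (\<omega> y) - Re (\<omega> y)"])
        (simp_all add: characterD character_adj complex_add_cnj complex_Re_le_cmod)
    from positive_functional_mono[OF f this] show ?thesis by (simp add: L eq)
  qed
  show ?thesis
  proof (cases "f x = 0")
    case True
    then show ?thesis using positive_functional_pos(2)[OF f, of "vabs x"] by simp
  next
    case False
    define u where "u = cnj (f x) / of_real (cmod (f x))"
    have u: "cmod u = 1" using False by (simp add: u_def norm_divide)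
    have "vabs (u *\<^sub>C x) = vabs x"
      by (rule gelfand_eqI) (simp add: characterD norm_mult u)
    moreover have "f (u *\<^sub>C x) = of_real (cmod (f x))"
      using False by (simp add: L scaleC_complex_def u_def complex_norm_square power2_eq_square)
        (simp add: mult.commute complex_norm_square[symmetric] power2_eq_square)
    ultimately show ?thesis using Re[of "u *\<^sub>C x"] by simp
  qed
qed

text \<open>If \<open>f\<close> were unbounded on the positive unit ball, elements
  \<open>x n\<close> with values above \<open>2 ^ n * n\<close> could be summed with weights
  \<open>2 ^ -n\<close>. The sum dominates every summand, so its value would exceed every
  \<open>n\<close>.\<close>

lemma positive_functional_bounded:
  fixes f :: "'a::{cstar_algebra, comm_ring} \<Rightarrow> complex"
  assumes f: "positive_functional f"
  obtains K where "0 \<le> K" "\<And>x. cmod (f x) \<le> K * norm x"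
proof -
  note L = clinearD[OF positive_functional_clinear[OF f]]
  have "\<exists>K. \<forall>x. pos x \<longrightarrow> norm x \<le> 1 \<longrightarrow> Re (f x) \<le> K"
  proof (rule ccontr)
    assume "\<nexists>K. \<forall>x. pos x \<longrightarrow> norm x \<le> 1 \<longrightarrow> Re (f x) \<le> K"
    then have "\<exists>x. pos x \<and> norm x \<le> 1 \<and> Re (f x) > K" for K by (metis not_le)
    then have "\<exists>x. \<forall>n::nat. pos (x n) \<and> norm (x n) \<le> 1 \<and> Re (f (x n)) > 2 ^ n * real n"
      by (intro choice allI)
    then obtain x where x: "\<And>n::nat. pos (x n)" "\<And>n. norm (x n) \<le> 1" "\<And>n. Re (f (x n)) > 2 ^ n * real n"
      by blast
    define y where "y n = (1/2) ^ n *\<^sub>R x n" for n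
    have "summable (\<lambda>n. norm (y n))"
      by (rule summable_comparison_test'[of "\<lambda>n. (1/2) ^ n" 0]) (use x(2) in \<open>auto simp: y_def summable_geometric mult_left_le\<close>)
    then have sy: "summable y" by (rule summable_norm_cancel)
    define a where "a = suminf y"
    have le: "pos (a - y n)" for n
    proof (rule posI)
      fix \<omega> :: "'a \<Rightarrow> complex" assume \<omega>: "character \<omega>"
      note X = characterD[OF \<omega>]
      have bl: "bounded_linear \<omega>"
        by (rule bounded_linear_intro[of _ 1]) (simp_all add: X scaleR_conv_of_real)
      have s: "(\<lambda>n. \<omega> (y n)) sums \<omega> a"
        using bounded_linear.sums[OF bl summable_sums[OF sy]] by (simp add: a_def)
      have yr: "\<omega> (y n) = of_real (Re (\<omega> (y n)))" "0 \<le> Re (\<omega> (y n))" for n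
        using posD[OF x(1) \<omega>, of n] unfolding y_def X by (auto simp: complex_eq_iff)
      have re: "(\<lambda>n. Re (\<omega> (y n))) sums Re (\<omega> a)" by (rule sums_Re[OF s])
      have "(\<lambda>n. Im (\<omega> (y n))) sums Im (\<omega> a)" by (rule sums_Im[OF s])
      moreover have "Im (\<omega> (y n)) = 0" for n by (subst yr(1)) simp
      ultimately have "Im (\<omega> a) = 0" by (simp add: sums_unique2[OF _ sums_zero])
      then show "\<omega> (a - y n) = of_real (Re (\<omega> a) - Re (\<omega> (y n)))"
        using yr(1)[of n] by (simp add: X complex_eq_iff)
      have "sum (\<lambda>n. Re (\<omega> (y n))) {n} \<le> (\<Sum>n. Re (\<omega> (y n)))"
        by (rule sum_le_suminf[OF sums_summable[OF re]]) (use yr in auto)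
      then show "0 \<le> Re (\<omega> a) - Re (\<omega> (y n))" using sums_unique[OF re] by simp
    qed
    have "real n \<le> Re (f a)" for n
    proof -
      have "real n = (1/2) ^ n * (2 ^ n * real n)" by (simp add: power_divide)
      also have "\<dots> \<le> (1/2) ^ n * Re (f (x n))" using x(3)[of n] by (intro mult_left_mono) auto
      also have "\<dots> = Re (f (y n))" by (simp add: y_def L)
      also have "\<dots> \<le> Re (f a)" by (rule positive_functional_mono[OF f le])
      finally show ?thesis .
    qed
    then show False using reals_Archimedean2[of "Re (f a)"] by (metis not_le)
  qed
  then obtain K where K: "\<And>x. pos x \<Longrightarrow> norm x \<le> 1 \<Longrightarrow> Re (f x) \<le> K" by blast
  have K0: "0 \<le> K" using K[of 0] by (simp add: L)
  have "cmod (f x) \<le> K * norm x" for x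
  proof (cases "x = 0")
    case False
    have "pos ((1 / norm x) *\<^sub>R vabs x)" by (rule pos_scaleR) simp_all
    then have "Re (f ((1 / norm x) *\<^sub>R vabs x)) \<le> K" by (rule K) (use False in simp)
    then have "Re (f (vabs x)) \<le> K * norm x" using False by (simp add: L field_simps)
    then show ?thesis using positive_functional_norm_le[OF f, of x] by linarith
  qed (simp add: L)
  with K0 show thesis by (rule that)
qed

text \<open>As \<open>|\<phi> x|\<close> is at most \<open>\<phi> (vabs x)\<close>, the norm is
  already approached on the positive part of the unit ball.\<close>

lemma positive_norm_approx:
  fixes \<phi> :: "'a::{cstar_algebra, comm_ring} dual"
  assumes f: "positive_functional (dual_apply \<phi>)" and e: "0 < e"
  obtains a where "pos a" "norm a \<le> 1" "norm \<phi> - e \<le> Re (dual_apply \<phi> a)"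
proof -
  have "\<exists>a. pos a \<and> norm a \<le> 1 \<and> norm \<phi> - e \<le> Re (dual_apply \<phi> a)"
  proof (rule ccontr)
    assume "\<not> ?thesis"
    then have n: "Re (dual_apply \<phi> a) < norm \<phi> - e" if "pos a" "norm a \<le> 1" for a
      using that by (meson not_le)
    have p: "0 < norm \<phi> - e" using n[of 0] by (simp add: clinearD[OF clinear_dual_apply])
    have "norm \<phi> \<le> norm \<phi> - e"
    proof (rule norm_dual_bound)
      fix x
      show "cmod (dual_apply \<phi> x) \<le> (norm \<phi> - e) * norm x"
      proof (cases "x = 0")
        case False
        have "Re (dual_apply \<phi> ((1 / norm x) *\<^sub>R vabs x)) < norm \<phi> - e"
          by (rule n[OF pos_scaleR]) (use False in simp_all)
        then have "Re (dual_apply \<phi> (vabs x)) \<le> (norm \<phi> - e) * norm x"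
          using False by (simp add: clinearD[OF clinear_dual_apply] field_simps)
        then show ?thesis using positive_functional_norm_le[OF f, of x] by linarith
      qed (simp add: clinearD[OF clinear_dual_apply])
    qed (use p in simp)
    then show False using e by simp
  qed
  then show thesis using that by blast
qed

text \<open>Without a unit, the two norms must be approached at a common element.
  \<open>a + b - a * b\<close>, that is 1 - (1 - a)(1 - b), stays in the unit ball and dominates
  both \<open>a\<close> and \<open>b\<close>.\<close>

lemma positive_norm_add:
  fixes \<phi> \<psi> :: "'a::{cstar_algebra, comm_ring} dual"
  assumes \<phi>: "positive_functional (dual_apply \<phi>)" and \<psi>: "positive_functional (dual_apply \<psi>)"
  shows "norm (\<phi> + \<psi>) = norm \<phi> + norm \<psi>"
proof (rule antisym[OF norm_triangle_ineq], rule field_le_epsilon)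
  fix e :: real assume e: "0 < e"
  obtain a where a: "pos a" "norm a \<le> 1" "norm \<phi> - e / 2 \<le> Re (dual_apply \<phi> a)"
    using positive_norm_approx[OF \<phi>, of "e / 2"] e by auto
  obtain b where b: "pos b" "norm b \<le> 1" "norm \<psi> - e / 2 \<le> Re (dual_apply \<psi> b)"
    using positive_norm_approx[OF \<psi>, of "e / 2"] e by auto
  define c where "c = a + b - a * b"
  have ab1: "Re (\<omega> a) \<le> 1" "Re (\<omega> b) \<le> 1" if \<omega>: "character \<omega>" for \<omega>
    using order_trans[OF characterD(3)[OF \<omega>] a(2)] order_trans[OF characterD(3)[OF \<omega>] b(2)]
      posD(3)[OF a(1) \<omega>] posD(3)[OF b(1) \<omega>] by simp_all
  have c: "\<omega> c = of_real (1 - (1 - Re (\<omega> a)) * (1 - Re (\<omega> b)))" if \<omega>: "character \<omega>" for \<omega>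
    unfolding c_def characterD(2,4,5)[OF \<omega>]
    by (subst posD(1)[OF a(1) \<omega>], subst posD(1)[OF b(1) \<omega>], subst posD(1)[OF a(1) \<omega>], subst posD(1)[OF b(1) \<omega>])
      (simp add: algebra_simps)
  have "pos c"
  proof (rule posI[OF c])
    fix \<omega> :: "'a \<Rightarrow> complex" assume \<omega>: "character \<omega>"
    have "(1 - Re (\<omega> a)) * (1 - Re (\<omega> b)) \<le> 1"
      using ab1[OF \<omega>] posD(2)[OF a(1) \<omega>] posD(2)[OF b(1) \<omega>] by (intro mult_le_one) auto
    then show "0 \<le> 1 - (1 - Re (\<omega> a)) * (1 - Re (\<omega> b))" by simp
  qed
  have "norm c \<le> 1" by (rule pos_norm_le[OF \<open>pos c\<close>]) (simp_all add: c ab1)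
  have "pos (c - a)"
  proof (rule posI)
    fix \<omega> :: "'a \<Rightarrow> complex" assume \<omega>: "character \<omega>"
    show "\<omega> (c - a) = of_real (Re (\<omega> b) * (1 - Re (\<omega> a)))"
      using posD(4)[OF a(1) \<omega>] by (simp add: characterD(5)[OF \<omega>] c[OF \<omega>] complex_eq_iff algebra_simps)
    show "0 \<le> Re (\<omega> b) * (1 - Re (\<omega> a))"
      using ab1[OF \<omega>] posD(2)[OF b(1) \<omega>] by simp
  qed
  then have 1: "Re (dual_apply \<phi> a) \<le> Re (dual_apply \<phi> c)" by (rule positive_functional_mono[OF \<phi>])
  have "pos (c - b)"
  proof (rule posI)
    fix \<omega> :: "'a \<Rightarrow> complex" assume \<omega>: "character \<omega>"
    show "\<omega> (c - b) = of_real (Re (\<omega> a) * (1 - Re (\<omega> b)))"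
      using posD(4)[OF b(1) \<omega>] by (simp add: characterD(5)[OF \<omega>] c[OF \<omega>] complex_eq_iff algebra_simps)
    show "0 \<le> Re (\<omega> a) * (1 - Re (\<omega> b))"
      using ab1[OF \<omega>] posD(2)[OF a(1) \<omega>] by simp
  qed
  then have 2: "Re (dual_apply \<psi> b) \<le> Re (dual_apply \<psi> c)" by (rule positive_functional_mono[OF \<psi>])
  have "Re (dual_apply (\<phi> + \<psi>) c) \<le> norm (\<phi> + \<psi>) * norm c"
    using complex_Re_le_cmod norm_dual_apply order_trans by blast
  also have "\<dots> \<le> norm (\<phi> + \<psi>)" using \<open>norm c \<le> 1\<close> by (simp add: mult_left_le)
  finally show "norm \<phi> + norm \<psi> \<le> norm (\<phi> + \<psi>) + e" using 1 2 a(3) b(3) by simp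
qed

section \<open>Pure states and characters\<close>

lemma character_positive:
  fixes \<omega> :: "'a::{cstar_algebra, comm_ring} \<Rightarrow> complex"
  shows "character \<omega> \<Longrightarrow> positive_functional \<omega>"
  by (rule positive_functionalI) (simp_all add: characterD(1) posD(2,4))

lemma character_bump:
  fixes \<omega> :: "'a::{cstar_algebra, comm_ring} \<Rightarrow> complex"
  assumes \<omega>: "character \<omega>"
  obtains e where "pos e" "norm e \<le> 1" "\<omega> e = 1"
proof -
  obtain x where x: "\<omega> x \<noteq> 0" using \<omega> by (auto simp: character_def)
  define g where "g s = min (max s 0 / cmod (\<omega> x)) 1" for s
  have g: "continuous_on UNIV g" "g 0 = 0"
    unfolding g_def by (intro continuous_intros) (use x in auto)
  have g01: "0 \<le> g s" "g s \<le> 1" for s by (auto simp: g_def)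
  show thesis
  proof
    show "pos (fcalc g (vabs x))" by (rule pos_fcalc[OF g g01(1)])
    then show "norm (fcalc g (vabs x)) \<le> 1"
      by (rule pos_norm_le) (simp_all add: fcalc g g01)
    show "\<omega> (fcalc g (vabs x)) = 1" using x by (simp add: fcalc[OF \<omega> g] \<omega> g_def)
  qed
qed

text \<open>A local unit for finitely many characters, used to add up the masses that a functional
  puts on them. The induction joins bumps by 1 - (1 - a)(1 - b), which is 1 wherever
  \<open>a\<close> or \<open>b\<close> is.\<close>

lemma common_bump:
  fixes F :: "('a::{cstar_algebra, comm_ring} \<Rightarrow> complex) set"
  assumes "finite F" "\<And>\<omega>. \<omega> \<in> F \<Longrightarrow> character \<omega>"
  shows "\<exists>e. pos e \<and> norm e \<le> 1 \<and> (\<forall>\<omega>\<in>F. \<omega> e = 1)"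
  using assms
proof (induction F)
  case empty
  show ?case by (rule exI[of _ 0]) simp
next
  case (insert \<omega>0 F)
  then obtain a where a: "pos a" "norm a \<le> 1" "\<forall>\<omega>\<in>F. \<omega> a = 1" by auto
  have \<omega>0: "character \<omega>0" using insert by simp
  obtain b where b: "pos b" "norm b \<le> 1" "\<omega>0 b = 1" using character_bump[OF \<omega>0] .
  define c where "c = a + b - a * b"
  have le1: "Re (\<omega> a) \<le> 1" "Re (\<omega> b) \<le> 1" if \<omega>: "character \<omega>" for \<omega>
    using order_trans[OF characterD(3)[OF \<omega>] a(2)] order_trans[OF characterD(3)[OF \<omega>] b(2)]
      posD(3)[OF a(1) \<omega>] posD(3)[OF b(1) \<omega>] by simp_all
  have c: "\<omega> c = 1 - (1 - \<omega> a) * (1 - \<omega> b)" if "character \<omega>" for \<omega>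
    unfolding c_def characterD(2,4,5)[OF that] by (simp add: algebra_simps)
  have prod: "0 \<le> (1 - Re (\<omega> a)) * (1 - Re (\<omega> b))" "(1 - Re (\<omega> a)) * (1 - Re (\<omega> b)) \<le> 1"
    if \<omega>: "character \<omega>" for \<omega>
    using le1[OF \<omega>] posD(2)[OF a(1) \<omega>] posD(2)[OF b(1) \<omega>] by (auto intro!: mult_le_one)
  have "pos c"
  proof (rule posI)
    fix \<omega> :: "'a \<Rightarrow> complex" assume \<omega>: "character \<omega>"
    show "\<omega> c = of_real (1 - (1 - Re (\<omega> a)) * (1 - Re (\<omega> b)))"
      using posD(4)[OF a(1) \<omega>] posD(4)[OF b(1) \<omega>] by (simp add: c[OF \<omega>] complex_eq_iff)
    show "0 \<le> 1 - (1 - Re (\<omega> a)) * (1 - Re (\<omega> b))" using prod[OF \<omega>] by simp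
  qed
  moreover have "norm c \<le> 1"
  proof (rule pos_norm_le[OF \<open>pos c\<close>])
    fix \<omega> :: "'a \<Rightarrow> complex" assume \<omega>: "character \<omega>"
    show "Re (\<omega> c) \<le> 1"
      using prod[OF \<omega>] posD(4)[OF a(1) \<omega>] posD(4)[OF b(1) \<omega>] by (simp add: c[OF \<omega>])
  qed simp
  moreover have "\<forall>\<omega>\<in>insert \<omega>0 F. \<omega> c = 1"
  proof
    fix \<omega> assume "\<omega> \<in> insert \<omega>0 F"
    then have "character \<omega>" "\<omega> a = 1 \<or> \<omega> b = 1" using a(3) b(3) insert.prems by blast+
    then show "\<omega> c = 1" using c[of \<omega>] by auto
  qed
  ultimately show ?case by blast
qed

lemma character_dual_apply [simp]: "character \<omega> \<Longrightarrow> dual_apply (Dual \<omega>) = \<omega>"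
  using dual_apply_Dual[of \<omega> 1] by (simp add: characterD(1,3))

lemma norm_character_dual:
  fixes \<omega> :: "'a::{cstar_algebra, comm_ring} \<Rightarrow> complex"
  assumes \<omega>: "character \<omega>"
  shows "norm (Dual \<omega>) = 1"
proof (rule antisym)
  show "norm (Dual \<omega>) \<le> 1" by (rule norm_dual_bound) (simp_all add: \<omega> characterD(3))
  obtain e where e: "norm e \<le> 1" "\<omega> e = 1" using character_bump[OF \<omega>] by metis
  have "1 \<le> norm (Dual \<omega>) * norm e" using norm_dual_apply[of "Dual \<omega>" e] e \<omega> by simp
  also have "\<dots> \<le> norm (Dual \<omega>)" using e(1) by (simp add: mult_left_le)
  finally show "1 \<le> norm (Dual \<omega>)" .
qed

text \<open>Domination forces \<open>f\<close> to vanish on the kernel of \<open>\<omega>\<close>,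
  which contains \<open>x - \<omega> x e\<close> for a bump \<open>e\<close> at
  \<open>\<omega>\<close>.\<close>

lemma dominated_by_character:
  fixes f :: "'a::{cstar_algebra, comm_ring} \<Rightarrow> complex"
  assumes f: "positive_functional f" and \<omega>: "character \<omega>"
    and le: "\<And>a. pos a \<Longrightarrow> Re (f a) \<le> C * Re (\<omega> a)"
  obtains c where "0 \<le> c" "f = (\<lambda>x. of_real c * \<omega> x)"
proof -
  obtain e where e: "pos e" "\<omega> e = 1" using character_bump[OF \<omega>] by metis
  note L = clinearD[OF positive_functional_clinear[OF f]]
  have "f x = of_real (Re (f e)) * \<omega> x" for x
  proof -
    have "\<omega> (x - \<omega> x *\<^sub>C e) = 0" by (simp add: characterD[OF \<omega>] e)
    then have "Re (f (vabs (x - \<omega> x *\<^sub>C e))) \<le> 0"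
      using le[OF pos_vabs, of "x - \<omega> x *\<^sub>C e"] \<omega> by simp
    then have "cmod (f (x - \<omega> x *\<^sub>C e)) \<le> 0"
      using positive_functional_norm_le[OF f, of "x - \<omega> x *\<^sub>C e"] by linarith
    then have "f x = \<omega> x * f e" by (simp add: L scaleC_complex_def)
    moreover have "f e = of_real (Re (f e))"
      using positive_functional_pos(1)[OF f e(1)] by (simp add: complex_eq_iff)
    ultimately show ?thesis by (metis mult.commute)
  qed
  then show thesis using that[of "Re (f e)"] positive_functional_pos(2)[OF f e(1)] by blast
qed

text \<open>A state occurring with positive weight in a convex decomposition of
  \<open>\<omega>\<close> is dominated by a multiple of \<open>\<omega>\<close>, hence is a multiple
  of it, hence equals it by normalisation.\<close>

lemma character_pure_state:
  fixes \<omega> :: "'a::{cstar_algebra, comm_ring} \<Rightarrow> complex"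
  assumes \<omega>: "character \<omega>"
  shows "pure_state (Dual \<omega>)"
  unfolding pure_state_def extreme_point_of_def
proof (intro conjI ballI notI)
  show "Dual \<omega> \<in> states"
    using norm_character_dual[OF \<omega>] character_positive[OF \<omega>] \<omega> by (simp add: states_def)
  have eq: "\<phi> = Dual \<omega>" if \<phi>: "\<phi> \<in> states" and \<psi>: "\<psi> \<in> states" and u: "0 < u" "u \<le> 1"
    and *: "Dual \<omega> = u *\<^sub>R \<phi> + (1 - u) *\<^sub>R \<psi>" for \<phi> \<psi> u
  proof -
    have p: "positive_functional (dual_apply \<phi>)" "norm \<phi> = 1" "positive_functional (dual_apply \<psi>)"
      using \<phi> \<psi> by (auto simp: states_def)
    have "Re (dual_apply \<phi> a) \<le> (1 / u) * Re (\<omega> a)" if a: "pos a" for a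
    proof -
      have "\<omega> a = dual_apply (u *\<^sub>R \<phi> + (1 - u) *\<^sub>R \<psi>) a"
        unfolding *[symmetric] using \<omega> by simp
      then have "Re (\<omega> a) = u * Re (dual_apply \<phi> a) + (1 - u) * Re (dual_apply \<psi> a)"
        by (simp add: scaleR_scaleC)
      moreover have "0 \<le> (1 - u) * Re (dual_apply \<psi> a)"
        using positive_functional_pos(2)[OF p(3) a] u by simp
      ultimately show ?thesis using u by (simp add: field_simps)
    qed
    then obtain c where c: "0 \<le> c" "dual_apply \<phi> = (\<lambda>x. of_real c * \<omega> x)"
      using dominated_by_character[OF p(1) \<omega>] by blast
    have "\<phi> = c *\<^sub>R Dual \<omega>" by (rule dual_eqI) (simp add: c(2) scaleR_scaleC \<omega>)
    then have "c = 1" using p(2) norm_character_dual[OF \<omega>] c(1) by simp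
    then show ?thesis using \<open>\<phi> = c *\<^sub>R Dual \<omega>\<close> by simp
  qed
  fix \<phi> \<psi> :: "'a dual" assume s: "\<phi> \<in> states" "\<psi> \<in> states" and "Dual \<omega> \<in> open_segment \<phi> \<psi>"
  then obtain u where u: "\<phi> \<noteq> \<psi>" "0 < u" "u < 1" "Dual \<omega> = (1 - u) *\<^sub>R \<phi> + u *\<^sub>R \<psi>"
    unfolding in_segment by blast
  have "\<phi> = Dual \<omega>" by (rule eq[OF s, of "1 - u"]) (use u in auto)
  moreover have "\<psi> = Dual \<omega>" by (rule eq[OF s(2,1), of u]) (use u in \<open>auto simp: add.commute\<close>)
  ultimately show False using u(1) by simp
qed

lemma pos_decomposition:
  fixes y :: "'a::{cstar_algebra, comm_ring}"
  obtains p q r s where "pos p" "pos q" "pos r" "pos s" "y = (p - q) + \<i> *\<^sub>C (r - s)"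
proof -
  define g where "g t = max t 0" for t :: real
  have g: "continuous_on UNIV g" "g 0 = 0" "\<And>t. 0 \<le> g t"
    unfolding g_def by (auto intro!: continuous_intros)
  have gg: "g t - g (- t) = t" for t by (auto simp: g_def)
  show thesis
  proof
    show "pos (fcalc g y)" "pos (fcalc g (- y))" "pos (fcalc g ((- \<i>) *\<^sub>C y))" "pos (fcalc g (\<i> *\<^sub>C y))"
      by (rule pos_fcalc[OF g])+
    \<comment> \<open>\<open>fcalc\<close> sees only real parts, and the real part of
      \<open>-i y\<close> is the imaginary part of \<open>y\<close>.\<close>
    show "y = (fcalc g y - fcalc g (- y)) + \<i> *\<^sub>C (fcalc g ((- \<i>) *\<^sub>C y) - fcalc g (\<i> *\<^sub>C y))"
    proof (rule gelfand_eqI)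
      fix \<omega> :: "'a \<Rightarrow> complex" assume \<omega>: "character \<omega>"
      show "\<omega> y = \<omega> ((fcalc g y - fcalc g (- y)) + \<i> *\<^sub>C (fcalc g ((- \<i>) *\<^sub>C y) - fcalc g (\<i> *\<^sub>C y)))"
        using gg[of "Re (\<omega> y)"] gg[of "Im (\<omega> y)"]
        by (simp add: characterD[OF \<omega>] fcalc[OF \<omega> g(1,2)] complex_eq_iff)
    qed
  qed
qed

lemma clinear_eq_on_pos:
  fixes f g :: "'a::{cstar_algebra, comm_ring} \<Rightarrow> complex"
  assumes f: "clinear f" and g: "clinear g" and eq: "\<And>a. pos a \<Longrightarrow> f a = g a"
  shows "f y = g y"
proof -
  obtain p q r s where "pos p" "pos q" "pos r" "pos s" "y = (p - q) + \<i> *\<^sub>C (r - s)"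
    by (rule pos_decomposition)
  then show ?thesis by (simp add: clinearD[OF f] clinearD[OF g] eq)
qed

text \<open>Applying the bound to powers of \<open>x\<close> makes the constant \<open>K\<close>
  irrelevant. This supplies the contractivity in \<open>character\<close> for functionals known only
  to be bounded.\<close>

lemma multiplicative_contractive:
  fixes f :: "'a::complex_normed_algebra \<Rightarrow> complex"
  assumes mult: "\<And>x y. f (x * y) = f x * f y" and K: "\<And>x. cmod (f x) \<le> K * norm x"
  shows "cmod (f x) \<le> norm x"
proof (cases "x = 0")
  case True
  then show ?thesis using K[of 0] by simp
next
  case False
  show ?thesis
  proof (rule ccontr)
    assume "\<not> cmod (f x) \<le> norm x"
    then have "1 < cmod (f x) / norm x" using False by simp
    then obtain n where n: "K < (cmod (f x) / norm x) ^ n" using real_arch_pow by blast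
    have pw: "f (((*) x ^^ k) x) = f x ^ Suc k" for k
      by (induction k) (simp_all add: mult)
    have nm: "norm (((*) x ^^ k) x) \<le> norm x ^ Suc k" for k
    proof (induction k)
      case (Suc k)
      have "norm (x * ((*) x ^^ k) x) \<le> norm x * norm (((*) x ^^ k) x)" by (rule norm_mult_ineq)
      also have "\<dots> \<le> norm x * norm x ^ Suc k" using Suc by (intro mult_left_mono) auto
      finally show ?case by simp
    qed simp
    have K0: "0 \<le> K"
    proof (rule ccontr)
      assume "\<not> 0 \<le> K"
      then have "K * norm x < 0" using False by (simp add: mult_less_0_iff)
      then show False using K[of x] norm_ge_zero[of "f x"] by linarith
    qed
    have "cmod (f x) ^ Suc n \<le> K * norm (((*) x ^^ n) x)"
      using K[of "((*) x ^^ n) x"] unfolding pw norm_power .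
    also have "\<dots> \<le> K * norm x ^ Suc n" by (rule mult_left_mono[OF nm K0])
    finally have "(cmod (f x) / norm x) ^ Suc n \<le> K" using False by (simp add: power_divide divide_le_eq)
    moreover have "(cmod (f x) / norm x) ^ n \<le> (cmod (f x) / norm x) ^ Suc n"
      using \<open>1 < cmod (f x) / norm x\<close> by (intro power_increasing) auto
    ultimately show False using n by linarith
  qed
qed

text \<open>Multiplication by \<open>a\<close> between 0 and 1 splits \<open>\<phi>\<close> into two
  positive parts. Additivity of the norm makes \<open>\<phi>\<close> the convex combination of their
  normalisations, and extremality makes the first part proportional to
  \<open>\<phi>\<close>.\<close>

lemma pure_state_split:
  fixes \<phi> :: "'a::{cstar_algebra, comm_ring} dual"
  assumes \<phi>: "pure_state \<phi>" and a: "pos a" "norm a \<le> 1"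
  shows "\<exists>t\<ge>0. \<forall>x. dual_apply \<phi> (a * x) = of_real t * dual_apply \<phi> x"
proof -
  have st: "\<phi> \<in> states" and ext: "\<And>\<psi> \<psi>'. \<psi> \<in> states \<Longrightarrow> \<psi>' \<in> states \<Longrightarrow> \<phi> \<notin> open_segment \<psi> \<psi>'"
    using \<phi> by (auto simp: pure_state_def extreme_point_of_def)
  have p: "positive_functional (dual_apply \<phi>)" and n: "norm \<phi> = 1" using st by (auto simp: states_def)
  note L = clinearD[OF clinear_dual_apply]
  define \<psi> where "\<psi> = Dual (\<lambda>x. dual_apply \<phi> (a * x))"
  have \<psi>: "dual_apply \<psi> x = dual_apply \<phi> (a * x)" for x
  proof -
    have "clinear (\<lambda>x. dual_apply \<phi> (a * x))"
      by (simp add: clinear_def distrib_left mult_scaleC_right scaleC_complex_def)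
    moreover have "cmod (dual_apply \<phi> (a * x)) \<le> (norm \<phi> * norm a) * norm x" for x
      by (rule bound_chain[OF norm_dual_apply norm_mult_ineq norm_ge_zero])
    ultimately show ?thesis unfolding \<psi>_def by (subst dual_apply_Dual) auto
  qed
  define \<psi>' where "\<psi>' = \<phi> - \<psi>"
  have \<psi>': "dual_apply \<psi>' x = dual_apply \<phi> (x - a * x)" for x
  proof -
    have "dual_apply \<phi> x = dual_apply (\<psi>' + \<psi>) x" by (simp add: \<psi>'_def)
    then show ?thesis by (simp only: dual_apply_add_left L \<psi>) (simp add: algebra_simps)
  qed
  have le1: "Re (\<omega> a) \<le> 1" if \<omega>: "character \<omega>" for \<omega>
    using order_trans[OF characterD(3)[OF \<omega>] a(2)] posD(3)[OF a(1) \<omega>] by simp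
  have pos\<psi>: "positive_functional (dual_apply \<psi>)"
    by (rule positive_functionalI[OF clinear_dual_apply])
      (simp add: \<psi> positive_functional_pos[OF p] pos_mult a(1))
  have pos\<psi>': "positive_functional (dual_apply \<psi>')"
  proof (rule positive_functionalI[OF clinear_dual_apply])
    fix b :: 'a assume b: "pos b"
    have "pos (b - a * b)"
    proof (rule posI)
      fix \<omega> :: "'a \<Rightarrow> complex" assume \<omega>: "character \<omega>"
      show "\<omega> (b - a * b) = of_real (Re (\<omega> b) * (1 - Re (\<omega> a)))"
        using posD(4)[OF a(1) \<omega>] posD(4)[OF b \<omega>] by (simp add: characterD[OF \<omega>] complex_eq_iff algebra_simps)
      show "0 \<le> Re (\<omega> b) * (1 - Re (\<omega> a))" using le1[OF \<omega>] posD(2)[OF b \<omega>] by simp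
    qed
    then show "Im (dual_apply \<psi>' b) = 0 \<and> 0 \<le> Re (dual_apply \<psi>' b)"
      by (simp add: \<psi>' positive_functional_pos[OF p])
  qed
  have sum: "\<psi> + \<psi>' = \<phi>" by (simp add: \<psi>'_def)
  then have ns: "norm \<psi> + norm \<psi>' = 1" using positive_norm_add[OF pos\<psi> pos\<psi>'] n by simp
  have "\<psi> = norm \<psi> *\<^sub>R \<phi>"
  proof (cases "norm \<psi> = 0 \<or> norm \<psi>' = 0")
    case True
    then show ?thesis using ns sum by auto
  next
    case False
    then have nz: "0 < norm \<psi>" "0 < norm \<psi>'" by auto
    have norml: "(1 / norm \<theta>) *\<^sub>R \<theta> \<in> states" if "positive_functional (dual_apply \<theta>)" "0 < norm \<theta>" for \<theta> :: "'a dual"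
      using that positive_functional_pos[OF that(1)] unfolding states_def
      by (auto intro!: positive_functionalI clinear_dual_apply simp: scaleR_scaleC[of "1 / norm \<theta>"] Im_divide_of_real norm_scaleC norm_divide)
    define \<sigma> where "\<sigma> = (1 / norm \<psi>) *\<^sub>R \<psi>"
    define \<sigma>' where "\<sigma>' = (1 / norm \<psi>') *\<^sub>R \<psi>'"
    have conv: "\<phi> = (1 - norm \<psi>') *\<^sub>R \<sigma> + norm \<psi>' *\<^sub>R \<sigma>'"
    proof -
      have "1 - norm \<psi>' = norm \<psi>" using ns by simp
      then show ?thesis using sum nz by (simp add: \<sigma>_def \<sigma>'_def)
    qed
    have "\<phi> \<notin> open_segment \<sigma> \<sigma>'"
      unfolding \<sigma>_def \<sigma>'_def by (rule ext[OF norml[OF pos\<psi> nz(1)] norml[OF pos\<psi>' nz(2)]])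
    then have "\<sigma> = \<sigma>'"
    proof (rule contrapos_np)
      assume "\<sigma> \<noteq> \<sigma>'"
      moreover have "norm \<psi>' < 1" using nz ns by linarith
      ultimately show "\<phi> \<in> open_segment \<sigma> \<sigma>'"
        unfolding in_segment using nz(2) conv by blast
    qed
    then have "\<phi> = \<sigma>" using conv by (simp add: scaleR_left_distrib[symmetric])
    then show ?thesis using nz by (simp add: \<sigma>_def)
  qed
  then have "dual_apply \<psi> x = of_real (norm \<psi>) * dual_apply \<phi> x" for x
    by (metis scaleR_scaleC dual_apply_scaleC_left)
  then show ?thesis by (intro exI[of _ "norm \<psi>"]) (simp add: \<psi>[symmetric])
qed

text \<open>By commutativity the splitting factor of \<open>a\<close> is proportional to the value
  at \<open>a\<close>; the ratio \<open>k\<close> is read off at one \<open>b\<close> of positive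
  value. So \<open>\<phi> (a * x) = k * \<phi> a * \<phi> x\<close>, and \<open>k \<phi>\<close> is
  multiplicative.\<close>

lemma pure_state_character:
  fixes \<phi> :: "'a::{cstar_algebra, comm_ring} dual"
  assumes \<phi>: "pure_state \<phi>"
  obtains c \<omega> where "0 \<le> c" "character \<omega>" "dual_apply \<phi> = (\<lambda>x. of_real c * \<omega> x)"
proof -
  have p: "positive_functional (dual_apply \<phi>)" and n: "norm \<phi> = 1"
    using \<phi> by (auto simp: pure_state_def extreme_point_of_def states_def)
  note L = clinearD[OF clinear_dual_apply]
  let ?f = "dual_apply \<phi>"
  obtain b where b: "pos b" "norm b \<le> 1" "norm \<phi> - 1/2 \<le> Re (?f b)"
    using positive_norm_approx[OF p, of "1/2"] by auto
  then have fb: "0 < Re (?f b)" using n by simp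
  obtain t where t: "0 \<le> t" "\<And>x. ?f (b * x) = of_real t * ?f x"
    using pure_state_split[OF \<phi> b(1,2)] by blast
  have fbr: "?f b = of_real (Re (?f b))" using positive_functional_pos(1)[OF p b(1)] by (simp add: complex_eq_iff)
  define k where "k = t / Re (?f b)"
  have k0: "0 \<le> k" using t fb by (simp add: k_def)
  have m1: "?f (a * x) = of_real k * ?f a * ?f x" if a: "pos a" for a x
  proof (cases "a = 0")
    case True
    then show ?thesis by (simp add: L)
  next
    case False
    define a' where "a' = (1 / norm a) *\<^sub>R a"
    have a': "pos a'" "norm a' \<le> 1" "a = norm a *\<^sub>R a'"
      using False a by (simp_all add: a'_def pos_scaleR)
    obtain s where s: "\<And>x. ?f (a' * x) = of_real s * ?f x" using pure_state_split[OF \<phi> a'(1,2)] by blast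
    have "of_real s * ?f b = of_real t * ?f a'" using s[of b] t(2)[of a'] by (simp add: mult.commute)
    then have "of_real s * of_real (Re (?f b)) = of_real t * ?f a'" using fbr by simp
    then have "of_real s = of_real k * ?f a'" using fb by (simp add: k_def field_simps)
    then have "?f (a' * x) = of_real k * ?f a' * ?f x" using s by simp
    then show ?thesis by (subst a'(3), subst (2) a'(3)) (simp add: L scaleR_conv_of_real)
  qed
  have mult: "?f (y * x) = of_real k * ?f y * ?f x" for x y
  proof (rule clinear_eq_on_pos[of "\<lambda>y. ?f (y * x)" "\<lambda>y. of_real k * ?f y * ?f x"])
    show "clinear (\<lambda>y. ?f (y * x))"
      by (simp add: clinear_def distrib_right mult_scaleC_left scaleC_complex_def)
    show "clinear (\<lambda>y. of_real k * ?f y * ?f x)"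
      by (simp add: clinear_def algebra_simps scaleC_complex_def)
  qed (rule m1)
  \<comment> \<open>Otherwise \<open>\<phi>\<close> would vanish on all products, among them
    \<open>b\<close>, which factors as \<open>adj c * c\<close>.\<close>
  have "k \<noteq> 0"
  proof
    assume "k = 0"
    then have "?f (y * x) = 0" for x y using mult by simp
    moreover obtain c where "b = adj c * c" using pos_square[OF b(1)] .
    ultimately show False using fb by simp
  qed
  define \<omega> where "\<omega> x = of_real k * ?f x" for x
  have \<omega>mult: "\<omega> (x * y) = \<omega> x * \<omega> y" for x y by (simp add: \<omega>_def mult)
  have "cmod (\<omega> x) \<le> k * norm x" for x
    using norm_dual_apply[of \<phi> x] n k0 by (simp add: \<omega>_def norm_mult mult_left_mono)
  then have "cmod (\<omega> x) \<le> norm x" for x by (rule multiplicative_contractive[where f = \<omega> and K = k, OF \<omega>mult])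
  moreover have "clinear \<omega>" by (simp add: clinear_def \<omega>_def algebra_simps scaleC_complex_def)
  moreover have "\<omega> b \<noteq> 0"
  proof
    assume "\<omega> b = 0"
    then have "?f b = 0" using \<open>k \<noteq> 0\<close> by (simp add: \<omega>_def)
    then show False using fb by simp
  qed
  ultimately have "character \<omega>" using \<omega>mult by (auto simp: character_def)
  moreover have "?f = (\<lambda>x. of_real (1 / k) * \<omega> x)" using \<open>k \<noteq> 0\<close> by (simp add: \<omega>_def fun_eq_iff)
  moreover have "0 \<le> 1 / k" using k0 by simp
  ultimately show thesis using that by blast
qed

lemma pure_functional_character:
  fixes p :: "'a::{cstar_algebra, comm_ring} \<Rightarrow> complex"
  assumes "pure_functional p"
  shows "\<exists>c \<omega>. 0 \<le> c \<and> character \<omega> \<and> p = (\<lambda>x. of_real c * \<omega> x)"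
proof -
  obtain r \<phi> where r: "0 \<le> r" "pure_state \<phi>" "p = dual_apply (r *\<^sub>R \<phi>)"
    using assms by (auto simp: pure_functional_def)
  obtain c \<omega> where c: "0 \<le> c" "character \<omega>" "dual_apply \<phi> = (\<lambda>x. of_real c * \<omega> x)"
    using pure_state_character[OF r(2)] .
  have "p = (\<lambda>x. of_real (r * c) * \<omega> x)"
    by (simp add: r(3) scaleR_scaleC c(3) fun_eq_iff)
  then show ?thesis using r(1) c by (intro exI[of _ "r * c"] exI[of _ \<omega>]) simp
qed

lemma character_pure_functional:
  fixes \<omega> :: "'a::{cstar_algebra, comm_ring} \<Rightarrow> complex"
  assumes "character \<omega>" "0 \<le> c"
  shows "pure_functional (\<lambda>x. of_real c * \<omega> x)"
  unfolding pure_functional_def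
  by (intro exI[of _ c] exI[of _ "Dual \<omega>"])
    (use assms character_pure_state[OF assms(1)] in \<open>simp add: scaleR_scaleC fun_eq_iff\<close>)

section \<open>Atomic and diffuse positive functionals\<close>

text \<open>Evaluated at a common bump of the \<open>\<omega> i\<close>, the left side of
  \<open>le\<close> is the total mass, while the right side is at most \<open>K\<close>.\<close>

lemma positive_sum_characters_le:
  fixes f :: "'a::{cstar_algebra, comm_ring} \<Rightarrow> complex" and n :: nat
  assumes f: "positive_functional f" and K: "\<And>x. cmod (f x) \<le> K * norm x" "0 \<le> K"
    and \<omega>: "\<And>i. i < n \<Longrightarrow> character (\<omega> i)"
    and le: "\<And>a. pos a \<Longrightarrow> (\<Sum>i<n. c i * Re (\<omega> i a)) \<le> Re (f a)"
  shows "(\<Sum>i<n. c i) \<le> K"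
proof -
  have F: "character \<theta>" if "\<theta> \<in> \<omega> ` {..<n}" for \<theta> using that \<omega> by auto
  have "\<exists>e. pos e \<and> norm e \<le> 1 \<and> (\<forall>\<theta>\<in>\<omega> ` {..<n}. \<theta> e = 1)"
    by (rule common_bump[OF finite_imageI[OF finite_lessThan] F])
  then obtain e where e: "pos e" "norm e \<le> 1" "\<forall>\<theta>\<in>\<omega> ` {..<n}. \<theta> e = 1" by (elim exE conjE)
  have "(\<Sum>i<n. c i) = (\<Sum>i<n. c i * Re (\<omega> i e))" using e(3) by (intro sum.cong) auto
  also have "\<dots> \<le> Re (f e)" by (rule le[OF e(1)])
  also have "\<dots> \<le> K * norm e" using complex_Re_le_cmod K(1) by (rule order_trans)
  also have "\<dots> \<le> K" using e(2) K(2) by (simp add: mult_left_le)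
  finally show ?thesis .
qed

definition diffuse :: "('a::{cstar_algebra, comm_ring} \<Rightarrow> complex) \<Rightarrow> bool"
  where "diffuse g \<longleftrightarrow> positive_functional g \<and>
    (\<forall>c>0. \<forall>\<omega>. character \<omega> \<longrightarrow> \<not> positive_functional (\<lambda>x. g x - of_real c * \<omega> x))"

text \<open>Greedy exhaustion: each step subtracts a multiple \<open>c n\<close> of a character that is at least half of the
  largest possible one. As \<open>\<Sum> c n\<close> converges, the remainder dominates no character.\<close>

lemma nonscattered_diffuse:
  assumes "\<not> scattered TYPE('a::{cstar_algebra, comm_ring})"
  obtains g :: "'a::{cstar_algebra, comm_ring} \<Rightarrow> complex" and a where "diffuse g" "pos a" "0 < Re (g a)"
proof -
  obtain f :: "'a \<Rightarrow> complex" where f: "positive_functional f"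
    and nofin: "\<And>p n. (\<forall>i<n::nat. pure_functional (p i)) \<Longrightarrow> \<exists>a. f a \<noteq> (\<Sum>i<n. p i a)"
    and noinf: "\<And>p. (\<forall>i::nat. pure_functional (p i)) \<Longrightarrow> \<exists>a. \<not> (\<lambda>i. p i a) sums f a"
    using assms unfolding scattered_def by blast
  \<comment> \<open>The empty sum is a finite sum, so \<open>f\<close> is nonzero and some character
    exists. With it the coefficient 0 is always available to the exhaustion.\<close>
  obtain a0 where "f a0 \<noteq> 0" using nofin[of 0] by auto
  then have "a0 \<noteq> 0" using clinearD(3)[OF positive_functional_clinear[OF f]] by auto
  then obtain \<omega>0 :: "'a \<Rightarrow> complex" where \<omega>0: "character \<omega>0" by (rule character_exists)
  define D :: "('a \<Rightarrow> complex) \<Rightarrow> real \<Rightarrow> ('a \<Rightarrow> complex) \<Rightarrow> bool"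
    where "D g c \<omega> \<longleftrightarrow> character \<omega> \<and> 0 \<le> c \<and> positive_functional (\<lambda>x. g x - of_real c * \<omega> x)" for g c \<omega>
  \<comment> \<open>The supremum of the admissible coefficients need not be attained, so half of it
    is used; a supremum 0 is treated apart, as half of it is not strictly below it.\<close>
  have best: "\<exists>c \<omega>. D g c \<omega> \<and> (\<forall>c' \<omega>'. D g c' \<omega>' \<longrightarrow> c' \<le> 2 * c)" if g: "positive_functional g" for g
  proof -
    define S where "S = {c. \<exists>\<omega>. D g c \<omega>}"
    obtain K where K: "0 \<le> K" "\<And>x. cmod (g x) \<le> K * norm x" by (rule positive_functional_bounded[OF g]) (rule that)
    have bd: "c \<le> K" if cS: "c \<in> S" for c
    proof -
      obtain \<omega> where d: "D g c \<omega>" using cS unfolding S_def by blast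
      have "(\<Sum>i<1::nat. c) \<le> K"
      proof (rule positive_sum_characters_le[OF g K(2,1), of 1 "\<lambda>_. \<omega>"])
        fix a :: 'a assume a: "pos a"
        have "positive_functional (\<lambda>x. g x - of_real c * \<omega> x)" using d by (simp add: D_def)
        then have "0 \<le> Re (g a - of_real c * \<omega> a)" by (rule positive_functional_pos(2)) (rule a)
        then show "(\<Sum>i<1::nat. c * Re (\<omega> a)) \<le> Re (g a)" by simp
      qed (use d in \<open>simp add: D_def\<close>)
      then show ?thesis by simp
    qed
    have S0: "0 \<in> S" using g \<omega>0 by (auto simp: S_def D_def)
    have bdd: "bdd_above S" using bd by (rule bdd_aboveI)
    have up: "c \<le> Sup S" if "c \<in> S" for c by (rule cSup_upper[OF that bdd])
    show ?thesis
    proof (cases "Sup S = 0")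
      case True
      have "D g 0 \<omega>0" using g \<omega>0 by (simp add: D_def)
      moreover have "c' \<le> 2 * 0" if d: "D g c' \<omega>'" for c' \<omega>'
      proof -
        have "c' \<in> S" using d unfolding S_def by blast
        then show ?thesis using up[of c'] True by simp
      qed
      ultimately show ?thesis by blast
    next
      case False
      then have "Sup S / 2 < Sup S" using up[OF S0] by simp
      then obtain c where c: "c \<in> S" "Sup S / 2 < c" using less_cSupD[of S "Sup S / 2"] S0 by auto
      then obtain \<omega> where "D g c \<omega>" by (auto simp: S_def)
      moreover have "c' \<le> 2 * c" if d: "D g c' \<omega>'" for c' \<omega>'
      proof -
        have "c' \<in> S" using d unfolding S_def by blast
        then show ?thesis using up[of c'] c(2) by simp
      qed
      ultimately show ?thesis by blast
    qed
  qed
  then obtain cc ww where best: "\<And>g. positive_functional g \<Longrightarrow> D g (cc g) (ww g)"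
    "\<And>g c' \<omega>'. positive_functional g \<Longrightarrow> D g c' \<omega>' \<Longrightarrow> c' \<le> 2 * cc g" by metis
  define step where "step g = (\<lambda>x. g x - of_real (cc g) * ww g x)" for g :: "'a \<Rightarrow> complex"
  define G where "G n = (step ^^ n) f" for n
  define c where "c n = cc (G n)" for n
  define \<omega> where "\<omega> n = ww (G n)" for n
  have GS: "G (Suc n) = (\<lambda>x. G n x - of_real (c n) * \<omega> n x)" for n
    by (simp add: G_def step_def c_def \<omega>_def)
  have Gpos: "positive_functional (G n)" for n
  proof (induction n)
    case (Suc n)
    show ?case unfolding GS using best(1)[OF Suc] by (simp add: D_def c_def \<omega>_def)
  qed (simp add: G_def f)
  have c: "0 \<le> c n" and \<omega>: "character (\<omega> n)" for n
    using best(1)[OF Gpos, of n] by (auto simp: D_def c_def \<omega>_def)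
  have fG: "f x = (\<Sum>i<n. of_real (c i) * \<omega> i x) + G n x" for n x
  proof (induction n)
    case (Suc n)
    then show ?case by (simp add: GS)
  qed (simp add: G_def)
  obtain K where K: "0 \<le> K" "\<And>x. cmod (f x) \<le> K * norm x" by (rule positive_functional_bounded[OF f]) (rule that)
  have "(\<Sum>i<n. c i) \<le> K" for n
  proof (rule positive_sum_characters_le[OF f K(2,1) \<omega>])
    fix a :: 'a assume a: "pos a"
    have "Re (f a) = (\<Sum>i<n. c i * Re (\<omega> i a)) + Re (G n a)" by (subst fG[of a n]) simp
    then show "(\<Sum>i<n. c i * Re (\<omega> i a)) \<le> Re (f a)" using positive_functional_pos(2)[OF Gpos a, of n] by simp
  qed
  then have sc: "summable c" by (intro summableI_nonneg_bounded[of c K] c)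
  have s: "summable (\<lambda>i. of_real (c i) * \<omega> i x)" for x
  proof (rule summable_comparison_test'[of "\<lambda>i. c i * norm x" 0])
    show "summable (\<lambda>i. c i * norm x)" by (rule summable_mult2[OF sc])
    show "norm (of_real (c i) * \<omega> i x) \<le> c i * norm x" for i
      using c[of i] characterD(3)[OF \<omega>, of i x] by (simp add: norm_mult mult_left_mono)
  qed
  define g where "g x = f x - (\<Sum>i. of_real (c i) * \<omega> i x)" for x
  have Glim: "(\<lambda>n. G n x) \<longlonglongrightarrow> g x" for x
  proof -
    have "(\<lambda>n. f x - (\<Sum>i<n. of_real (c i) * \<omega> i x)) \<longlonglongrightarrow> g x"
      unfolding g_def by (intro tendsto_intros summable_LIMSEQ s)
    moreover have "f x - (\<Sum>i<n. of_real (c i) * \<omega> i x) = G n x" for n using fG[of x n] by simp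
    ultimately show ?thesis by simp
  qed
  have lin: "clinear g"
    unfolding clinear_def
  proof (intro conjI allI)
    note GL = clinearD[OF positive_functional_clinear[OF Gpos]]
    fix x y k
    have "(\<lambda>n. G n (x + y)) \<longlonglongrightarrow> g x + g y" using tendsto_add[OF Glim Glim] by (simp add: GL)
    then show "g (x + y) = g x + g y" using Glim LIMSEQ_unique by blast
    have "(\<lambda>n. G n (k *\<^sub>C x)) \<longlonglongrightarrow> k * g x" using tendsto_mult_left[OF Glim] by (simp add: GL scaleC_complex_def)
    then show "g (k *\<^sub>C x) = k *\<^sub>C g x" using Glim LIMSEQ_unique unfolding scaleC_complex_def by blast
  qed
  have gpos: "positive_functional g"
  proof (rule positive_functionalI[OF lin])
    fix a :: 'a assume a: "pos a"
    have "(\<lambda>n. Im (G n a)) \<longlonglongrightarrow> Im (g a)" by (intro tendsto_Im Glim)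
    moreover have "Im (G n a) = 0" for n by (rule positive_functional_pos(1)[OF Gpos a])
    ultimately have "Im (g a) = 0" by (simp add: LIMSEQ_const_iff)
    moreover have "(\<lambda>n. Re (G n a)) \<longlonglongrightarrow> Re (g a)" by (intro tendsto_Re Glim)
    then have "0 \<le> Re (g a)" by (rule LIMSEQ_le_const) (use positive_functional_pos(2)[OF Gpos a] in auto)
    ultimately show "Im (g a) = 0 \<and> 0 \<le> Re (g a)" by simp
  qed
  have "diffuse g"
    unfolding diffuse_def
  proof (intro conjI allI impI notI)
    fix d :: real and \<theta> :: "'a \<Rightarrow> complex"
    assume d: "0 < d" and \<theta>: "character \<theta>" and pd: "positive_functional (\<lambda>x. g x - of_real d * \<theta> x)"
    \<comment> \<open>The remainder \<open>g\<close> lies below every \<open>G n\<close>, so a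
      character mass inside \<open>g\<close> was available at each stage of the exhaustion.\<close>
    have "d \<le> 2 * c n" for n
      unfolding c_def
    proof (rule best(2)[OF Gpos])
      show "D (G n) d \<theta>"
        unfolding D_def
      proof (intro conjI \<theta> less_imp_le[OF d], rule positive_functionalI)
        show "clinear (\<lambda>x. G n x - of_real d * \<theta> x)"
          by (simp add: clinear_def scaleC_complex_def clinearD(1)[OF positive_functional_clinear[OF Gpos]]
              clinear_complexD[OF positive_functional_clinear[OF Gpos]] characterD(4,8)[OF \<theta>] algebra_simps)
        fix a :: 'a assume a: "pos a"
        have "Re (g a) \<le> Re (G n a)"
        proof (rule LIMSEQ_le_const2[OF tendsto_Re[OF Glim]], intro exI[of _ n] allI impI)
          fix m assume "n \<le> m"
          then show "Re (G m a) \<le> Re (G n a)"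
          proof (induction m rule: dec_induct)
            case (step m)
            have "0 \<le> c m * Re (\<omega> m a)" using c posD(2)[OF a \<omega>] by simp
            then show ?case using step by (simp add: GS)
          qed simp
        qed
        moreover have "0 \<le> Re (g a - of_real d * \<theta> a)" by (rule positive_functional_pos(2)[OF pd a])
        ultimately show "Im (G n a - of_real d * \<theta> a) = 0 \<and> 0 \<le> Re (G n a - of_real d * \<theta> a)"
          using positive_functional_pos(1)[OF Gpos a, of n] posD(4)[OF a \<theta>] by simp
      qed
    qed
    moreover have "(\<lambda>n. 2 * c n) \<longlonglongrightarrow> 2 * 0" by (intro tendsto_intros summable_LIMSEQ_zero sc)
    ultimately have "d \<le> 0" using LIMSEQ_le_const by fastforce
    then show False using d by simp
  qed (rule gpos)
  moreover have "\<exists>x. g x \<noteq> 0"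
  proof (rule ccontr)
    assume "\<nexists>x. g x \<noteq> 0"
    then have "(\<lambda>i. of_real (c i) * \<omega> i x) sums f x" for x
      using summable_sums[OF s, of x] by (simp add: g_def)
    then show False
      using noinf[of "\<lambda>i x. of_real (c i) * \<omega> i x"] character_pure_functional[OF \<omega> c] by blast
  qed
  then obtain x where "g x \<noteq> 0" ..
  then have "0 < Re (g (vabs x))" using positive_functional_norm_le[OF gpos, of x] by (smt (verit) zero_less_norm_iff)
  ultimately show thesis using that pos_vabs by blast
qed

text \<open>The coefficients of the pure parts are summable, so the characters outside a suitable
  initial segment carry total mass below \<open>e\<close>. In the finite case all characters are
  kept and nothing remains.\<close>

lemma scattered_finite:
  fixes f :: "'a::{cstar_algebra, comm_ring} \<Rightarrow> complex"
  assumes sc: "scattered TYPE('a)" and f: "positive_functional f" and e: "0 < e"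
  obtains F where "finite F" "\<And>\<omega>. \<omega> \<in> F \<Longrightarrow> character \<omega>"
    "\<And>x. \<forall>\<omega>\<in>F. \<omega> x = 0 \<Longrightarrow> Re (f (vabs x)) \<le> e * norm x"
proof -
  have "(\<exists>p (n::nat). (\<forall>i<n. pure_functional (p i)) \<and> (\<forall>a. f a = (\<Sum>i<n. p i a))) \<or>
      (\<exists>p :: nat \<Rightarrow> 'a \<Rightarrow> complex. (\<forall>i. pure_functional (p i)) \<and> (\<forall>a. (\<lambda>i. p i a) sums f a))"
    by (rule sc[unfolded scattered_def, rule_format, OF f])
  then consider (fin) p and n :: nat where "\<forall>i<n. pure_functional (p i)" "\<forall>a. f a = (\<Sum>i<n. p i a)"
    | (inf) p :: "nat \<Rightarrow> 'a \<Rightarrow> complex" where "\<forall>i. pure_functional (p i)" "\<forall>a. (\<lambda>i. p i a) sums f a"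
    by (elim disjE exE conjE)
  then show thesis
  proof cases
    case fin': fin
    note fin = fin'(1)[rule_format] fin'(2)[rule_format]
    have "\<exists>cw. i < n \<longrightarrow> 0 \<le> fst cw \<and> character (snd cw) \<and> p i = (\<lambda>x. of_real (fst cw) * snd cw x)" for i
      using pure_functional_character[of "p i"] fin(1)[of i] by auto
    then have "\<forall>i. \<exists>cw. i < n \<longrightarrow> 0 \<le> fst cw \<and> character (snd cw) \<and> p i = (\<lambda>x. of_real (fst cw) * snd cw x)"
      by (rule allI)
    from choice[OF this] obtain cw where cw:
      "\<forall>i. i < n \<longrightarrow> 0 \<le> fst (cw i) \<and> character (snd (cw i)) \<and> p i = (\<lambda>x. of_real (fst (cw i)) * snd (cw i) x)" ..
    define c where "c i = fst (cw i)" for i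
    define \<omega> where "\<omega> i = snd (cw i)" for i
    have p: "0 \<le> c i \<and> character (\<omega> i) \<and> p i = (\<lambda>x. of_real (c i) * \<omega> i x)" if "i < n" for i
      using cw that by (simp add: c_def \<omega>_def)
    show thesis
    proof (rule that[of "\<omega> ` {..<n}"])
      fix x assume x: "\<forall>\<theta>\<in>\<omega> ` {..<n}. \<theta> x = 0"
      have "p i (vabs x) = 0" if "i < n" for i
        using p[OF that] x that by auto
      then show "Re (f (vabs x)) \<le> e * norm x" using e by (simp add: fin(2))
    qed (use p in auto)
  next
    case inf': inf
    note inf = inf'(1)[rule_format] inf'(2)[rule_format]
    have "\<exists>cw. 0 \<le> fst cw \<and> character (snd cw) \<and> p i = (\<lambda>x. of_real (fst cw) * snd cw x)" for i
      using pure_functional_character[of "p i"] inf(1)[of i] by auto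
    then have "\<forall>i. \<exists>cw. 0 \<le> fst cw \<and> character (snd cw) \<and> p i = (\<lambda>x. of_real (fst cw) * snd cw x)"
      by (rule allI)
    from choice[OF this] obtain cw where cw:
      "\<forall>i. 0 \<le> fst (cw i) \<and> character (snd (cw i)) \<and> p i = (\<lambda>x. of_real (fst (cw i)) * snd (cw i) x)" ..
    define c where "c i = fst (cw i)" for i
    define \<omega> where "\<omega> i = snd (cw i)" for i
    have p: "0 \<le> c i" "character (\<omega> i)" "p i = (\<lambda>x. of_real (c i) * \<omega> i x)" for i
      using cw by (simp_all add: c_def \<omega>_def)
    have sums: "(\<lambda>i. c i * Re (\<omega> i a)) sums Re (f a)" for a
      using sums_Re[OF inf(2)[of a]] by (simp add: p(3))
    obtain K where K: "0 \<le> K" "\<And>x. cmod (f x) \<le> K * norm x" by (rule positive_functional_bounded[OF f]) (rule that)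
    have "(\<Sum>i<n. c i) \<le> K" for n
    proof (rule positive_sum_characters_le[OF f K(2,1) p(2)])
      fix a :: 'a assume a: "pos a"
      have "(\<Sum>i<n. c i * Re (\<omega> i a)) \<le> (\<Sum>i. c i * Re (\<omega> i a))"
        by (rule sum_le_suminf[OF sums_summable[OF sums]]) (use p posD(2)[OF a] in auto)
      then show "(\<Sum>i<n. c i * Re (\<omega> i a)) \<le> Re (f a)" using sums_unique[OF sums, of a] by simp
    qed
    then have sc: "summable c" by (intro summableI_nonneg_bounded[of c K] p)
    obtain N where N: "norm (\<Sum>i. c (i + N)) < e" using suminf_exist_split[OF e sc] by blast
    show thesis
    proof (rule that[of "\<omega> ` {..<N}"])
      fix x assume x: "\<forall>\<theta>\<in>\<omega> ` {..<N}. \<theta> x = 0"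
      have s1: "summable (\<lambda>i. c i * cmod (\<omega> i x))"
        using sums_summable[OF sums[of "vabs x"]] by (simp add: p(2))
      have "Re (f (vabs x)) = (\<Sum>i. c i * cmod (\<omega> i x))"
        using sums_unique[OF sums[of "vabs x"]] by (simp add: p(2))
      also have "\<dots> = (\<Sum>i. c (i + N) * cmod (\<omega> (i + N) x)) + (\<Sum>i<N. c i * cmod (\<omega> i x))"
        by (rule suminf_split_initial_segment[OF s1])
      also have "(\<Sum>i<N. c i * cmod (\<omega> i x)) = 0" by (rule sum.neutral) (use x in auto)
      also have "(\<Sum>i. c (i + N) * cmod (\<omega> (i + N) x)) + 0 \<le> (\<Sum>i. c (i + N) * norm x)"
        unfolding add_0_right
      proof (rule suminf_le)
        show "summable (\<lambda>i. c (i + N) * cmod (\<omega> (i + N) x))" using s1 by (rule summable_ignore_initial_segment)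
        show "summable (\<lambda>i. c (i + N) * norm x)" by (intro summable_mult2 summable_ignore_initial_segment sc)
      qed (use p(1) characterD(3)[OF p(2)] in \<open>simp add: mult_left_mono\<close>)
      also have "\<dots> = (\<Sum>i. c (i + N)) * norm x"
        by (rule suminf_mult2[symmetric]) (intro summable_ignore_initial_segment sc)
      also have "\<dots> \<le> e * norm x" using N by (intro mult_right_mono) auto
      finally show "Re (f (vabs x)) \<le> e * norm x" .
    qed (use p in auto)
  qed
qed

section \<open>Dyadic splitting of a diffuse functional\<close>

lemma diffuse_positive: "diffuse g \<Longrightarrow> positive_functional g"
  by (simp add: diffuse_def)

text \<open>If no splitting existed, the mean \<open>h \<mapsto> g (b * h) / g b\<close> would be a point evaluation: the
  positive and negative parts of \<open>b * h - m *\<^sub>R b\<close>, with \<open>m\<close> the mean of \<open>h\<close>, have equal mass.\<close>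

lemma diffuse_split:
  fixes g :: "'a::{cstar_algebra, comm_ring} \<Rightarrow> complex"
  assumes g: "diffuse g" and b: "pos b" "0 < Re (g b)"
  obtains d e where "pos d" "pos e" "0 < Re (g d)" "0 < Re (g e)"
    "\<And>\<omega>. character \<omega> \<Longrightarrow> \<omega> d = 0 \<or> \<omega> e = 0"
    "\<And>\<omega>. character \<omega> \<Longrightarrow> \<omega> b = 0 \<Longrightarrow> \<omega> d = 0 \<and> \<omega> e = 0"
proof (rule ccontr)
  note split = that
  assume no: "\<not> thesis"
  note p = diffuse_positive[OF g]
  note L = clinearD[OF positive_functional_clinear[OF p]]
  define B where "B = Re (g b)"
  have B: "0 < B" "g b = of_real B"
    using b positive_functional_pos(1)[OF p b(1)] by (simp_all add: B_def complex_eq_iff)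
  \<comment> \<open>Zero variance of \<open>h\<close> under the mean with density \<open>b\<close>.
    Polarising this identity makes the mean multiplicative.\<close>
  have sq: "g (b * (h * h)) * g b = (g (b * h))\<^sup>2" if h: "adj h = h" for h
  proof -
    define m where "m = Re (g (b * h)) / B"
    define y where "y = b * h - m *\<^sub>R b"
    define t where "t s = max s 0" for s :: real
    have t: "continuous_on UNIV t" "t 0 = 0" "\<And>s. 0 \<le> t s"
      unfolding t_def by (auto intro!: continuous_intros)
    have hr: "Im (\<omega> h) = 0" if "character \<omega>" for \<omega> by (rule character_selfadjoint[OF that h])
    have y: "\<omega> y = of_real (Re (\<omega> b) * (Re (\<omega> h) - m))" if \<omega>: "character \<omega>" for \<omega>
      using posD(4)[OF b(1) \<omega>] hr[OF \<omega>] by (simp add: y_def characterD[OF \<omega>] complex_eq_iff algebra_simps)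
    define d where "d = fcalc t y"
    define e where "e = fcalc t (- y)"
    have de: "pos d" "pos e" unfolding d_def e_def by (rule pos_fcalc[OF t])+
    have \<omega>d: "\<omega> d = of_real (t (Re (\<omega> y)))" and \<omega>e: "\<omega> e = of_real (t (- Re (\<omega> y)))" if "character \<omega>" for \<omega>
      unfolding d_def e_def fcalc[OF that t(1,2)] by (simp_all add: characterD(6)[OF that])
    have "Re (g d) \<le> 0 \<or> Re (g e) \<le> 0"
    proof (rule ccontr)
      assume "\<not> ?thesis"
      then have "0 < Re (g d)" "0 < Re (g e)" by auto
      then have thesis
        by (rule split[OF de]) (simp_all add: \<omega>d \<omega>e t_def y max_def)
      then show False using no by simp
    qed
    moreover have "y = d - e"
      by (rule gelfand_eqI) (simp add: characterD \<omega>d \<omega>e y t_def max_def complex_eq_iff)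
    then have gy: "g y = g d - g e" by (simp add: L)
    then have "Im (g y) = 0" using positive_functional_pos(1)[OF p de(1)] positive_functional_pos(1)[OF p de(2)] by simp
    then have im: "Im (g (b * h)) = 0" by (simp add: y_def L B)
    then have gbh: "g (b * h) = of_real (m * B)" using B by (simp add: m_def complex_eq_iff)
    then have "g y = 0" by (simp add: y_def L B scaleR_conv_of_real)
    ultimately have z: "Re (g d) = 0" "Re (g e) = 0"
      using gy positive_functional_pos(2)[OF p de(1)] positive_functional_pos(2)[OF p de(2)] by auto
    \<comment> \<open>\<open>z\<close> is \<open>b\<close> times the square of \<open>h - m\<close>,
      whose mass is the variance up to the factor \<open>g b\<close>.\<close>
    define z where "z = b * (h * h) - (2 * m) *\<^sub>R (b * h) + (m * m) *\<^sub>R b"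
    have \<omega>z: "\<omega> z = of_real (Re (\<omega> b) * (Re (\<omega> h) - m)\<^sup>2)" if \<omega>: "character \<omega>" for \<omega>
      using posD(4)[OF b(1) \<omega>] hr[OF \<omega>]
      by (simp add: z_def characterD[OF \<omega>] complex_eq_iff algebra_simps power2_eq_square)
    have pz: "pos z" by (rule posI[OF \<omega>z]) (auto intro!: mult_nonneg_nonneg posD(2)[OF b(1)])
    \<comment> \<open>\<open>d + e\<close> is \<open>b\<close> times the modulus of
      \<open>h - m\<close>, and that modulus is at most \<open>norm h + \<bar>m\<bar>\<close>. Since
      \<open>d\<close> and \<open>e\<close> have mass 0, so has \<open>z\<close>.\<close>
    have "pos ((norm h + \<bar>m\<bar>) *\<^sub>R (d + e) - z)"
    proof (rule posI)
      fix \<omega> :: "'a \<Rightarrow> complex" assume \<omega>: "character \<omega>"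
      have abs: "t s + t (- s) = \<bar>s\<bar>" for s by (auto simp: t_def)
      let ?s = "Re (\<omega> h) - m"
      have sum: "\<omega> (d + e) = of_real (Re (\<omega> b) * \<bar>?s\<bar>)"
        using posD(2)[OF b(1) \<omega>] by (simp add: characterD(4)[OF \<omega>] \<omega>d[OF \<omega>] \<omega>e[OF \<omega>] y[OF \<omega>] of_real_add[symmetric] abs abs_mult del: of_real_add)
      have "Re (\<omega> b) * \<bar>?s\<bar> * ((norm h + \<bar>m\<bar>) - \<bar>?s\<bar>) = (norm h + \<bar>m\<bar>) * (Re (\<omega> b) * \<bar>?s\<bar>) - Re (\<omega> b) * \<bar>?s\<bar>\<^sup>2"
        by (simp only: power2_eq_square right_diff_distrib ac_simps)
      also have "\<dots> = (norm h + \<bar>m\<bar>) * (Re (\<omega> b) * \<bar>?s\<bar>) - Re (\<omega> b) * ?s\<^sup>2" by (simp only: power2_abs)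
      finally show "\<omega> ((norm h + \<bar>m\<bar>) *\<^sub>R (d + e) - z) = of_real (Re (\<omega> b) * \<bar>?s\<bar> * ((norm h + \<bar>m\<bar>) - \<bar>?s\<bar>))"
        unfolding characterD(5,9)[OF \<omega>] \<omega>z[OF \<omega>] sum by (simp only: of_real_diff of_real_mult)
      have "\<bar>?s\<bar> \<le> norm h + \<bar>m\<bar>"
        using order_trans[OF abs_Re_le_cmod characterD(3)[OF \<omega>], of h] by linarith
      then show "0 \<le> Re (\<omega> b) * \<bar>?s\<bar> * ((norm h + \<bar>m\<bar>) - \<bar>?s\<bar>)"
        using posD(2)[OF b(1) \<omega>] by simp
    qed
    from positive_functional_mono[OF p this] have "Re (g z) \<le> 0" by (simp add: L z)
    then have "g z = 0" using positive_functional_pos[OF p pz] by (simp add: complex_eq_iff)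
    then have "g (b * (h * h)) = of_real (m * m * B)"
      by (simp add: z_def L gbh B scaleR_conv_of_real algebra_simps)
    then show ?thesis by (simp add: gbh B power2_eq_square)
  qed
  define \<theta> where "\<theta> x = g (b * x) / of_real B" for x
  have \<theta>lin: "clinear \<theta>"
    by (simp add: \<theta>_def clinear_def distrib_left mult_scaleC_right L scaleC_complex_def add_divide_distrib)
  note T = clinearD[OF \<theta>lin]
  have \<theta>sq: "\<theta> (h * h) = \<theta> h * \<theta> h" if "adj h = h" for h
    using sq[OF that] B by (simp add: \<theta>_def power2_eq_square field_simps)
  have pos_adj: "adj a = a" if "pos a" for a :: 'a
    by (rule gelfand_eqI) (simp add: character_adj complex_eq_iff posD(4)[OF that])
  have \<theta>pos: "\<theta> (a * c) = \<theta> a * \<theta> c" if a: "pos a" and c: "pos c" for a c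
  proof -
    have "(a + c) * (a + c) = a * a + c * c + (a * c + a * c)" by (simp add: algebra_simps)
    then have "\<theta> ((a + c) * (a + c)) = \<theta> (a * a) + \<theta> (c * c) + 2 * \<theta> (a * c)" by (simp add: T)
    then show ?thesis
      using \<theta>sq[of "a + c"] \<theta>sq[of a] \<theta>sq[of c] pos_adj[OF a] pos_adj[OF c] pos_adj[OF pos_add[OF a c]]
      by (simp add: T algebra_simps)
  qed
  have \<theta>mult1: "\<theta> (x * c) = \<theta> x * \<theta> c" if c: "pos c" for x c
    by (rule clinear_eq_on_pos[of "\<lambda>x. \<theta> (x * c)" "\<lambda>x. \<theta> x * \<theta> c"])
      (simp_all add: clinear_def T distrib_right mult_scaleC_left scaleC_complex_def \<theta>pos c)
  have \<theta>mult: "\<theta> (x * y) = \<theta> x * \<theta> y" for x y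
    by (rule clinear_eq_on_pos[of "\<lambda>y. \<theta> (x * y)" "\<lambda>y. \<theta> x * \<theta> y"])
      (simp_all add: clinear_def T distrib_left mult_scaleC_right scaleC_complex_def \<theta>mult1)
  obtain K where K: "0 \<le> K" "\<And>x. cmod (g x) \<le> K * norm x" by (rule positive_functional_bounded[OF p]) (rule that)
  have "cmod (\<theta> x) \<le> (K * norm b / B) * norm x" for x
  proof -
    have "cmod (g (b * x)) \<le> K * norm b * norm x"
      by (rule bound_chain[OF K(2) norm_mult_ineq K(1)])
    then show ?thesis using B by (simp add: \<theta>_def norm_divide divide_right_mono)
  qed
  then have \<theta>1: "cmod (\<theta> x) \<le> norm x" for x
    by (rule multiplicative_contractive[where f = \<theta> and K = "K * norm b / B", OF \<theta>mult])
  \<comment> \<open>If \<open>g\<close> vanished on all multiples of \<open>b\<close>, it would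
    vanish at \<open>b\<close>, which is approximated by \<open>b\<close> times the local unit
    \<open>s / (s + \<epsilon>)\<close> evaluated at \<open>b\<close>.\<close>
  have "\<exists>x. \<theta> x \<noteq> 0"
  proof (rule ccontr)
    assume "\<nexists>x. \<theta> x \<noteq> 0"
    then have zero: "g (b * x) = 0" for x using B by (simp add: \<theta>_def)
    have "B \<le> K * \<epsilon>" if \<epsilon>: "0 < \<epsilon>" for \<epsilon>
    proof -
      define q where "q s = max s 0 / (max s 0 + \<epsilon>)" for s
      have q: "continuous_on UNIV q" "q 0 = 0"
        unfolding q_def using \<epsilon> by (auto intro!: continuous_intros simp: add_nonneg_pos order.strict_implies_not_eq[symmetric])
      have "norm (b - b * fcalc q b) \<le> \<epsilon>"
      proof (rule gelfand_norm_le)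
        fix \<omega> :: "'a \<Rightarrow> complex" assume \<omega>: "character \<omega>"
        let ?r = "Re (\<omega> b)"
        have r: "0 \<le> ?r" "0 < ?r + \<epsilon>" using posD(2)[OF b(1) \<omega>] \<epsilon> by auto
        have "\<omega> (b - b * fcalc q b) = of_real (?r - ?r * q ?r)"
          using posD(1)[OF b(1) \<omega>] by (simp add: characterD(2,5)[OF \<omega>] fcalc[OF \<omega> q])
        moreover have "?r - ?r * q ?r = \<epsilon> * (?r / (?r + \<epsilon>))"
          using r by (simp add: q_def field_simps)
        moreover have "\<bar>\<epsilon> * (?r / (?r + \<epsilon>))\<bar> \<le> \<epsilon>"
        proof -
          have "?r / (?r + \<epsilon>) \<le> 1" "0 \<le> ?r / (?r + \<epsilon>)" using r \<epsilon> by auto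
          then show ?thesis unfolding abs_mult using \<epsilon> by (simp only: abs_of_nonneg mult_left_le less_imp_le)
        qed
        ultimately show "cmod (\<omega> (b - b * fcalc q b)) \<le> \<epsilon>" by (simp only: norm_of_real)
      qed (use \<epsilon> in simp)
      then have "K * norm (b - b * fcalc q b) \<le> K * \<epsilon>" using K(1) by (rule mult_left_mono)
      moreover have "g (b - b * fcalc q b) = of_real B" by (simp add: L zero B)
      ultimately show ?thesis using K(2)[of "b - b * fcalc q b"] B(1) by simp
    qed
    from this[of "B / (2 * (K + 1))"] have "B \<le> K * (B / (2 * (K + 1)))" using B K by simp
    moreover have "K * (B / (2 * (K + 1))) \<le> B / 2" using B K by (simp add: field_simps)
    ultimately have "B \<le> B / 2" by (rule order_trans)
    then show False using B by simp
  qed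
  then have \<theta>: "character \<theta>" using \<theta>lin \<theta>mult \<theta>1 by (auto simp: character_def)
  have nb: "0 < norm b" using b(2) L(3) by auto
  \<comment> \<open>The multiple \<open>B / norm b\<close> of \<open>\<theta>\<close> is
    \<open>g\<close> applied to \<open>(b / norm b) * x\<close>, and \<open>b / norm b\<close> is at
    most 1 at every character. This is a point mass inside a diffuse functional.\<close>
  have "positive_functional (\<lambda>x. g x - of_real (B / norm b) * \<theta> x)"
  proof (rule positive_functionalI)
    show "clinear (\<lambda>x. g x - of_real (B / norm b) * \<theta> x)"
      by (simp add: clinear_def L T scaleC_complex_def algebra_simps add_divide_distrib)
    fix a :: 'a assume a: "pos a"
    have eq: "g a - of_real (B / norm b) * \<theta> a = g (a - (1 / norm b) *\<^sub>R (b * a))"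
      using B nb by (simp add: \<theta>_def L scaleR_conv_of_real)
    have "pos (a - (1 / norm b) *\<^sub>R (b * a))"
    proof (rule posI)
      fix \<omega> :: "'a \<Rightarrow> complex" assume \<omega>: "character \<omega>"
      show "\<omega> (a - (1 / norm b) *\<^sub>R (b * a)) = of_real (Re (\<omega> a) * (1 - Re (\<omega> b) / norm b))"
        using posD(4)[OF a \<omega>] posD(4)[OF b(1) \<omega>] by (simp add: characterD[OF \<omega>] complex_eq_iff algebra_simps)
      have "Re (\<omega> b) \<le> norm b" using characterD(3)[OF \<omega>, of b] posD(3)[OF b(1) \<omega>] by simp
      then show "0 \<le> Re (\<omega> a) * (1 - Re (\<omega> b) / norm b)" using nb posD(2)[OF a \<omega>] by simp
    qed
    then show "Im (g a - of_real (B / norm b) * \<theta> a) = 0 \<and> 0 \<le> Re (g a - of_real (B / norm b) * \<theta> a)"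
      unfolding eq using positive_functional_pos[OF p] by simp
  qed
  moreover have "0 < B / norm b" using B nb by simp
  ultimately show False using g \<theta> unfolding diffuse_def by blast
qed

section \<open>The dyadic tree and its independent signs\<close>

text \<open>A Urysohn pair cut out of \<open>b\<close>: \<open>a\<close> is a plateau function that
  is 1 wherever \<open>d\<close> lives and lives where \<open>b\<close> does, and \<open>d\<close>
  still carries mass, so the construction can continue inside the plateau.\<close>

lemma positive_refine:
  fixes g :: "'a::{cstar_algebra, comm_ring} \<Rightarrow> complex"
  assumes p: "positive_functional g" and b: "pos b" "0 < Re (g b)"
  obtains a d where "pos a" "pos d" "0 < Re (g d)" "\<And>\<omega>. character \<omega> \<Longrightarrow> Re (\<omega> a) \<le> 1"
    "\<And>\<omega>. character \<omega> \<Longrightarrow> \<omega> d \<noteq> 0 \<Longrightarrow> \<omega> a = 1" "\<And>\<omega>. character \<omega> \<Longrightarrow> \<omega> a \<noteq> 0 \<Longrightarrow> \<omega> b \<noteq> 0"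
proof -
  obtain K where K: "0 \<le> K" "\<And>x. cmod (g x) \<le> K * norm x" by (rule positive_functional_bounded[OF p]) (rule that)
  \<comment> \<open>Cutting \<open>b\<close> down to the part above height \<open>t\<close> removes
    an element of norm at most \<open>t\<close>, hence mass at most \<open>K * t\<close>, which is
    less than the mass of \<open>b\<close>.\<close>
  define t where "t = Re (g b) / (2 * (K + 1))"
  have t: "0 < t" using b K by (simp add: t_def)
  have Kt: "K * t < Re (g b)" using b K mult_nonneg_nonneg[of K "Re (g b)"] by (simp add: t_def field_simps add_nonneg_pos)
  define u where "u s = max (s - t) 0" for s
  define v where "v s = min (max s 0 / t) 1" for s
  have u: "continuous_on UNIV u" "u 0 = 0" "\<And>s. 0 \<le> u s"
    unfolding u_def using t by (auto intro!: continuous_intros)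
  have v: "continuous_on UNIV v" "v 0 = 0" "\<And>s. 0 \<le> v s" "\<And>s. v s \<le> 1"
    unfolding v_def using t by (auto intro!: continuous_intros)
  have \<omega>u: "\<omega> (fcalc u b) = of_real (u (Re (\<omega> b)))" and \<omega>v: "\<omega> (fcalc v b) = of_real (v (Re (\<omega> b)))"
    if "character \<omega>" for \<omega>
    by (rule fcalc[OF that u(1,2)] fcalc[OF that v(1,2)])+
  show thesis
  proof
    show "pos (fcalc v b)" by (rule pos_fcalc[OF v(1,2,3)])
    show "pos (fcalc u b)" by (rule pos_fcalc[OF u])
    have "norm (b - fcalc u b) \<le> t"
    proof (rule gelfand_norm_le)
      fix \<omega> :: "'a \<Rightarrow> complex" assume \<omega>: "character \<omega>"
      have "\<omega> (b - fcalc u b) = of_real (Re (\<omega> b) - u (Re (\<omega> b)))"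
        using posD(1)[OF b(1) \<omega>] by (simp add: characterD(5)[OF \<omega>] \<omega>u[OF \<omega>])
      moreover have "\<bar>Re (\<omega> b) - u (Re (\<omega> b))\<bar> \<le> t"
        using posD(2)[OF b(1) \<omega>] t by (auto simp: u_def)
      ultimately show "cmod (\<omega> (b - fcalc u b)) \<le> t" by (simp only: norm_of_real)
    qed (use t in simp)
    then have "K * norm (b - fcalc u b) \<le> K * t" using K(1) by (rule mult_left_mono)
    then have "Re (g (b - fcalc u b)) \<le> K * t"
      using K(2)[of "b - fcalc u b"] complex_Re_le_cmod[of "g (b - fcalc u b)"] by linarith
    then show "0 < Re (g (fcalc u b))"
      using Kt clinearD(5)[OF positive_functional_clinear[OF p]] by simp
    fix \<omega> :: "'a \<Rightarrow> complex" assume \<omega>: "character \<omega>"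
    show "Re (\<omega> (fcalc v b)) \<le> 1" using v(4) by (simp add: \<omega>v[OF \<omega>])
    show "\<omega> (fcalc v b) = 1" if "\<omega> (fcalc u b) \<noteq> 0"
    proof -
      have "u (Re (\<omega> b)) \<noteq> 0" using that by (simp add: \<omega>u[OF \<omega>])
      then have "t < Re (\<omega> b)" by (auto simp: u_def max_def split: if_splits)
      then have "v (Re (\<omega> b)) = 1" using t by (simp add: v_def)
      then show ?thesis by (simp add: \<omega>v[OF \<omega>])
    qed
    show "\<omega> b \<noteq> 0" if "\<omega> (fcalc v b) \<noteq> 0"
      using that by (auto simp: \<omega>v[OF \<omega>] v(2))
  qed
qed

lemma diffuse_branch:
  fixes g :: "'a::{cstar_algebra, comm_ring} \<Rightarrow> complex"
  assumes g: "diffuse g" and b: "pos b \<and> 0 < Re (g b)"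
  shows "\<exists>A D. (\<forall>x::bool. (pos (D x) \<and> 0 < Re (g (D x))) \<and> pos (A x) \<and>
      (\<forall>\<omega>. character \<omega> \<longrightarrow> Re (\<omega> (A x)) \<le> 1 \<and> (\<omega> (D x) \<noteq> 0 \<longrightarrow> \<omega> (A x) = 1) \<and> (\<omega> (A x) \<noteq> 0 \<longrightarrow> \<omega> b \<noteq> 0))) \<and>
    (\<forall>\<omega>. character \<omega> \<longrightarrow> \<omega> (A True) = 0 \<or> \<omega> (A False) = 0)"
proof -
  note p = diffuse_positive[OF g]
  obtain d e where de: "pos d" "pos e" "0 < Re (g d)" "0 < Re (g e)"
    "\<And>\<omega>. character \<omega> \<Longrightarrow> \<omega> d = 0 \<or> \<omega> e = 0"
    "\<And>\<omega>. character \<omega> \<Longrightarrow> \<omega> b = 0 \<Longrightarrow> \<omega> d = 0 \<and> \<omega> e = 0"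
    by (rule diffuse_split[OF g conjunct1[OF b] conjunct2[OF b]]) (rule that)
  obtain a1 d1 where 1: "pos a1" "pos d1" "0 < Re (g d1)" "\<And>\<omega>. character \<omega> \<Longrightarrow> Re (\<omega> a1) \<le> 1"
    "\<And>\<omega>. character \<omega> \<Longrightarrow> \<omega> d1 \<noteq> 0 \<Longrightarrow> \<omega> a1 = 1" "\<And>\<omega>. character \<omega> \<Longrightarrow> \<omega> a1 \<noteq> 0 \<Longrightarrow> \<omega> d \<noteq> 0"
    by (rule positive_refine[OF p de(1,3)]) (rule that)
  obtain a2 d2 where 2: "pos a2" "pos d2" "0 < Re (g d2)" "\<And>\<omega>. character \<omega> \<Longrightarrow> Re (\<omega> a2) \<le> 1"
    "\<And>\<omega>. character \<omega> \<Longrightarrow> \<omega> d2 \<noteq> 0 \<Longrightarrow> \<omega> a2 = 1" "\<And>\<omega>. character \<omega> \<Longrightarrow> \<omega> a2 \<noteq> 0 \<Longrightarrow> \<omega> e \<noteq> 0"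
    by (rule positive_refine[OF p de(2,4)]) (rule that)
  have s1: "\<omega> b \<noteq> 0" if "character \<omega>" "\<omega> a1 \<noteq> 0" for \<omega> using 1(6)[OF that] de(6)[OF that(1)] by blast
  have s2: "\<omega> b \<noteq> 0" if "character \<omega>" "\<omega> a2 \<noteq> 0" for \<omega> using 2(6)[OF that] de(6)[OF that(1)] by blast
  have s3: "\<omega> a1 = 0 \<or> \<omega> a2 = 0" if "character \<omega>" for \<omega> using 1(6)[OF that] 2(6)[OF that] de(5)[OF that] by blast
  show ?thesis
    by (rule exI[of _ "\<lambda>x. if x then a1 else a2"], rule exI[of _ "\<lambda>x. if x then d1 else d2"])
      (simp add: 1(1-5) 2(1-5) s1 s2 s3)
qed

text \<open>The \<open>w n\<close> are Rademacher functions on the tree: plus the plateau of the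
  \<open>True\<close> child and minus that of the \<open>False\<close> child, summed over generation
  \<open>n\<close>. \<open>X s\<close> is any character that sees the node \<open>s\<close>; it lies
  on the plateaus of all ancestors and so reads off the bits of \<open>s\<close>.\<close>

lemma independent_sequence:
  fixes g :: "'a::{cstar_algebra, comm_ring} \<Rightarrow> complex"
  assumes g: "diffuse g" and b0: "pos b0" "0 < Re (g b0)"
  obtains w :: "nat \<Rightarrow> 'a" and X :: "bool list \<Rightarrow> 'a \<Rightarrow> complex"
  where "\<And>n. norm (w n) \<le> 1" "\<And>s. character (X s)"
    "\<And>s n. n < length s \<Longrightarrow> X s (w n) = (if s ! n then 1 else - 1)"
proof -
  define P where "P b \<longleftrightarrow> pos b \<and> 0 < Re (g b)" for b
  define R where "R b A D \<longleftrightarrow> (\<forall>x::bool. P (D x) \<and> pos (A x) \<and>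
      (\<forall>\<omega>. character \<omega> \<longrightarrow> Re (\<omega> (A x)) \<le> 1 \<and> (\<omega> (D x) \<noteq> 0 \<longrightarrow> \<omega> (A x) = 1) \<and> (\<omega> (A x) \<noteq> 0 \<longrightarrow> \<omega> b \<noteq> 0))) \<and>
    (\<forall>\<omega>. character \<omega> \<longrightarrow> \<omega> (A True) = 0 \<or> \<omega> (A False) = 0)" for b A D
  have ex: "\<exists>A D. P b \<longrightarrow> R b A D" for b
    using diffuse_branch[OF g, of b] unfolding P_def R_def by blast
  then obtain A D where AD: "\<And>b. P b \<Longrightarrow> R b (A b) (D b)" by metis
  define node where "node s = foldl D b0 s" for s
  define u where "u s x = A (node s) x" for s x
  have node_snoc: "node (s @ [x]) = D (node s) x" for s x by (simp add: node_def)
  have Pn: "P (node s)" for s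
  proof (induction s rule: rev_induct)
    case (snoc x s)
    then show ?case using AD[OF snoc] unfolding node_snoc R_def by blast
  qed (simp add: node_def P_def b0)
  have Rn: "R (node s) (u s) (D (node s))" for s using AD[OF Pn] unfolding u_def .
  have u1: "\<omega> (u s x) = 1" if "character \<omega>" "\<omega> (node (s @ [x])) \<noteq> 0" for \<omega> s x
    using Rn[of s] that unfolding R_def node_snoc by blast
  have u2: "\<omega> (node s) \<noteq> 0" if "character \<omega>" "\<omega> (u s x) \<noteq> 0" for \<omega> s x
    using Rn[of s] that unfolding R_def by blast
  have u3: "\<omega> (u s x) = 0" if "character \<omega>" "\<omega> (u s y) \<noteq> 0" "x \<noteq> y" for \<omega> s x y
    using Rn[of s] that unfolding R_def by (cases x; cases y) auto
  have u4: "Re (\<omega> (u s x)) \<le> 1" "pos (u s x)" if "character \<omega>" for \<omega> s x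
    using Rn[of s] that unfolding R_def by blast+
  have prefix: "\<omega> (node s) \<noteq> 0" if \<omega>: "character \<omega>" and "\<omega> (node (s @ t)) \<noteq> 0" for \<omega> s t
    using that(2)
  proof (induction t rule: rev_induct)
    case (snoc x t)
    have "\<omega> (u (s @ t) x) = 1" by (rule u1[OF \<omega>]) (use snoc.prems in simp)
    then have "\<omega> (node (s @ t)) \<noteq> 0" using u2[OF \<omega>, of "s @ t" x] by simp
    then show ?case by (rule snoc.IH)
  qed simp
  \<comment> \<open>Nodes of one generation have disjoint supports, so at each character at most one
    summand of \<open>w n\<close> is nonzero.\<close>
  have uniq: "s = t" if \<omega>: "character \<omega>" and "\<omega> (node s) \<noteq> 0" "\<omega> (node t) \<noteq> 0" "length s = length t" for \<omega> s t
    using that(2-4)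
  proof (induction s arbitrary: t rule: rev_induct)
    case (snoc x s)
    obtain t' y where t: "t = t' @ [y]" using snoc.prems(3) by (cases t rule: rev_cases) auto
    have "s = t'"
      using snoc.IH[of t'] prefix[OF \<omega>, of s "[x]"] prefix[OF \<omega>, of t' "[y]"] snoc.prems t by simp
    moreover have "x = y"
    proof (rule ccontr)
      assume "x \<noteq> y"
      have "\<omega> (u s x) = 1" "\<omega> (u s y) = 1"
        using u1[OF \<omega>, of s x] u1[OF \<omega>, of s y] snoc.prems t \<open>s = t'\<close> by simp_all
      then show False using u3[OF \<omega>, of s y x] \<open>x \<noteq> y\<close> by simp
    qed
    ultimately show ?case using t by simp
  qed simp
  define S where "S n = {s :: bool list. length s = n}" for n
  have finS: "finite (S n)" for n
    using finite_lists_length_eq[of "UNIV :: bool set" n] by (simp add: S_def)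
  define w where "w n = (\<Sum>s\<in>S n. u s True - u s False)" for n
  have w1: "\<omega> (w n) = \<omega> (u s True) - \<omega> (u s False)"
    if \<omega>: "character \<omega>" and s: "s \<in> S n" "\<omega> (node s) \<noteq> 0" for \<omega> s n
  proof -
    have "\<omega> (u t True) - \<omega> (u t False) = 0" if "t \<in> S n - {s}" for t
    proof -
      have "\<omega> (node t) = 0" using uniq[OF \<omega>, of t s] that s by (auto simp: S_def)
      then have "\<omega> (u t x) = 0" for x using u2[OF \<omega>, of t x] by blast
      then show ?thesis by simp
    qed
    then have "(\<Sum>t\<in>S n - {s}. \<omega> (u t True) - \<omega> (u t False)) = 0" by (intro sum.neutral) auto
    moreover have "\<omega> (w n) = (\<Sum>t\<in>S n. \<omega> (u t True) - \<omega> (u t False))"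
      unfolding w_def characterD(5,10)[OF \<omega>] ..
    ultimately show ?thesis by (simp add: sum.remove[OF finS s(1)])
  qed
  have w0: "\<omega> (w n) = 0" if \<omega>: "character \<omega>" and "\<And>s. s \<in> S n \<Longrightarrow> \<omega> (node s) = 0" for \<omega> n
  proof -
    have "\<omega> (u s x) = 0" if "s \<in> S n" for s x using u2[OF \<omega>, of s x] \<open>\<And>s. s \<in> S n \<Longrightarrow> \<omega> (node s) = 0\<close>[OF that] by blast
    then show ?thesis unfolding w_def characterD(5,10)[OF \<omega>] by simp
  qed
  have norm: "norm (w n) \<le> 1" for n
  proof (rule gelfand_norm_le)
    fix \<omega> :: "'a \<Rightarrow> complex" assume \<omega>: "character \<omega>"
    show "cmod (\<omega> (w n)) \<le> 1"
    proof (cases "\<exists>s\<in>S n. \<omega> (node s) \<noteq> 0")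
      case True
      then obtain s where s: "s \<in> S n" "\<omega> (node s) \<noteq> 0" by blast
      have le: "cmod (\<omega> (u s x)) \<le> 1" for x using posD(3)[OF u4(2)[OF \<omega>] \<omega>, of s x] u4(1)[OF \<omega>, of s x] by simp
      have "\<omega> (u s True) = 0 \<or> \<omega> (u s False) = 0" using u3[OF \<omega>, of s True False] by auto
      then show ?thesis using w1[OF \<omega> s] le[of True] le[of False] by auto
    next
      case False
      then show ?thesis using w0[OF \<omega>, of n] by simp
    qed
  qed simp
  \<comment> \<open>Positive mass makes the node nonzero, and a nonzero element is seen by some
    character.\<close>
  have "\<exists>\<omega>. character \<omega> \<and> \<omega> (node s) \<noteq> 0" for s
  proof -
    have "node s \<noteq> 0"
    proof
      assume "node s = 0"
      then show False
        using Pn[of s] clinearD(3)[OF positive_functional_clinear[OF diffuse_positive[OF g]]] by (simp add: P_def)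
    qed
    then show ?thesis by (metis character_exists norm_eq_zero)
  qed
  then obtain X where X: "\<And>s. character (X s)" "\<And>s. X s (node s) \<noteq> 0" by metis
  have "X s (w n) = (if s ! n then 1 else - 1)" if n: "n < length s" for s n
  proof -
    have "X s (node (take n s @ drop n s)) \<noteq> 0" using X(2)[of s] by simp
    then have t0: "X s (node (take n s)) \<noteq> 0" by (rule prefix[OF X(1)])
    have "X s (node (take (Suc n) s @ drop (Suc n) s)) \<noteq> 0" unfolding append_take_drop_id by (rule X(2))
    then have "X s (node (take (Suc n) s)) \<noteq> 0" by (rule prefix[OF X(1)])
    then have t1: "X s (u (take n s) (s ! n)) = 1"
      using u1[OF X(1)] n by (simp add: take_Suc_conv_app_nth)
    then have t2: "X s (u (take n s) (\<not> s ! n)) = 0" by (intro u3[OF X(1)]) auto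
    have "take n s \<in> S n" using n by (simp add: S_def)
    from w1[OF X(1) this t0] show ?thesis using t1 t2 by (cases "s ! n") auto
  qed
  with norm X(1) show thesis by (rule that)
qed

section \<open>Functionals on the projective tensor product\<close>

lemma tensor_eval_bound:
  fixes B :: "'a::complex_normed_vector \<Rightarrow> 'b::complex_normed_vector \<Rightarrow> complex"
  assumes B: "bilinear_form B" and K: "0 \<le> K" "\<And>x y. cmod (B x y) \<le> K * norm x * norm y"
  shows "cmod (tensor_eval u B) \<le> K * gamma_norm u"
proof -
  have sum: "cmod (\<Sum>(x, y)\<leftarrow>xs. B x y) \<le> K * (\<Sum>(x, y)\<leftarrow>xs. norm x * norm y)" for xs
  proof (induction xs)
    case (Cons p xs)
    obtain x y where p: "p = (x, y)" by (cases p)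
    show ?case
      using norm_triangle_le[OF add_mono[OF K(2)[of x y] Cons]] by (simp add: p algebra_simps)
  qed simp
  have "cmod (tensor_eval u B) \<le> K * (gamma_norm u + e)" if e: "0 < e" for e
  proof -
    obtain xs where xs: "u = (\<Sum>(x, y)\<leftarrow>xs. x \<otimes> y)" "(\<Sum>(x, y)\<leftarrow>xs. norm x * norm y) < gamma_norm u + e"
      using gamma_norm_approx[OF e] .
    have "tensor_eval u B = (\<Sum>(x, y)\<leftarrow>xs. B x y)"
      unfolding xs(1) tensor_eval_sum_list tensor_sum_def using B by simp
    then have "cmod (tensor_eval u B) \<le> K * (\<Sum>(x, y)\<leftarrow>xs. norm x * norm y)" using sum by simp
    also have "\<dots> \<le> K * (gamma_norm u + e)" using xs(2) K(1) by (intro mult_left_mono) auto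
    finally show ?thesis .
  qed
  then have ev: "eventually (\<lambda>e. cmod (tensor_eval u B) \<le> K * (gamma_norm u + e)) (at_right 0)"
    using eventually_at_right_less[of "0::real"] by (rule eventually_mono[rotated]) auto
  have "((\<lambda>e. K * (gamma_norm u + e)) \<longlongrightarrow> K * (gamma_norm u + 0)) (at_right 0)"
    by (intro tendsto_intros)
  from tendsto_lowerbound[OF this ev] show ?thesis by simp
qed

lemma proj_embed_approx:
  obtains U where "(\<lambda>n. proj_embed (U n)) \<longlonglongrightarrow> (u :: ('a::complex_normed_vector, 'b::complex_normed_vector) proj_tensor)"
proof -
  have "u \<in> closure (range proj_embed)" by (simp add: proj_embed_dense)
  then obtain V where V: "\<And>n. V n \<in> range proj_embed" "V \<longlonglongrightarrow> u"
    unfolding closure_sequential by blast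
  then have "\<forall>n. \<exists>U. V n = proj_embed U" by blast
  then obtain U where "\<And>n. V n = proj_embed (U n)" by metis
  then have "V = (\<lambda>n. proj_embed (U n))" by auto
  with V(2) show thesis by (intro that[of U]) simp
qed

text \<open>Extension by continuity from the dense range of \<open>proj_embed\<close>.
  \<open>F'\<close> shows that the limit is independent of the approximating sequence, which gives
  linearity.\<close>

lemma proj_tensor_functional:
  fixes B :: "'a::complex_normed_vector \<Rightarrow> 'b::complex_normed_vector \<Rightarrow> complex"
  assumes B: "bilinear_form B" and K: "0 \<le> K" "\<And>x y. cmod (B x y) \<le> K * norm x * norm y"
  obtains f where "\<And>x y. dual_apply f (proj_embed (x \<otimes> y)) = B x y"
proof -
  have diff: "tensor_eval u B - tensor_eval v B = tensor_eval (u - v) B" for u v :: "('a, 'b) alg_tensor"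
    using tensor_eval_add[of "u - v" v B] by simp
  define U where "U u = (SOME U. (\<lambda>n. proj_embed (U n)) \<longlonglongrightarrow> u)" for u :: "('a, 'b) proj_tensor"
  have U: "(\<lambda>n. proj_embed (U u n)) \<longlonglongrightarrow> u" for u
  proof -
    have "\<exists>U. (\<lambda>n. proj_embed (U n)) \<longlonglongrightarrow> u" by (rule proj_embed_approx[of u]) (rule exI)
    from someI_ex[OF this] show ?thesis unfolding U_def .
  qed
  define F where "F u = lim (\<lambda>n. tensor_eval (U u n) B)" for u
  have le: "cmod (tensor_eval u B - tensor_eval v B) \<le> K * norm (proj_embed u - proj_embed v)" for u v :: "('a, 'b) alg_tensor"
    unfolding diff proj_embed_diff[symmetric] norm_proj_embed by (rule tensor_eval_bound[OF B K])
  have "Cauchy (\<lambda>n. tensor_eval (U u n) B)" for u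
  proof (rule CauchyI)
    fix e :: real assume e: "0 < e"
    have "Cauchy (\<lambda>n. proj_embed (U u n))" using U LIMSEQ_imp_Cauchy by blast
    moreover have "0 < e / (K + 1)" using e K by simp
    ultimately obtain N where N: "\<And>m n. m \<ge> N \<Longrightarrow> n \<ge> N \<Longrightarrow> norm (proj_embed (U u m) - proj_embed (U u n)) < e / (K + 1)"
      unfolding Cauchy_iff by blast
    have "cmod (tensor_eval (U u m) B - tensor_eval (U u n) B) < e" if "m \<ge> N" "n \<ge> N" for m n
    proof -
      have "cmod (tensor_eval (U u m) B - tensor_eval (U u n) B) \<le> (K + 1) * norm (proj_embed (U u m) - proj_embed (U u n))"
        using le[of "U u m" "U u n"] by (simp add: distrib_right add_increasing2)
      also have "\<dots> < e" using N[OF that] K by (simp add: pos_less_divide_eq mult.commute)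
      finally show ?thesis .
    qed
    then show "\<exists>M. \<forall>m\<ge>M. \<forall>n\<ge>M. cmod (tensor_eval (U u m) B - tensor_eval (U u n) B) < e" by blast
  qed
  then have F: "(\<lambda>n. tensor_eval (U u n) B) \<longlonglongrightarrow> F u" for u
    unfolding F_def using Cauchy_convergent convergent_LIMSEQ_iff by blast
  have F': "(\<lambda>n. tensor_eval (V n) B) \<longlonglongrightarrow> F u" if V: "(\<lambda>n. proj_embed (V n)) \<longlonglongrightarrow> u" for u V
  proof -
    have "(\<lambda>n. proj_embed (V n) - proj_embed (U u n)) \<longlonglongrightarrow> u - u" by (intro tendsto_diff V U)
    then have "(\<lambda>n. norm (proj_embed (V n) - proj_embed (U u n))) \<longlonglongrightarrow> 0"
      by (simp add: tendsto_norm_zero)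
    from tendsto_mult_left[OF this, of K]
    have "(\<lambda>n. K * norm (proj_embed (V n) - proj_embed (U u n))) \<longlonglongrightarrow> 0" by simp
    then have "(\<lambda>n. tensor_eval (V n) B - tensor_eval (U u n) B) \<longlonglongrightarrow> 0"
      by (rule Lim_null_comparison[rotated]) (intro always_eventually allI le)
    from tendsto_add[OF this F[of u]] show ?thesis by simp
  qed
  have lin: "clinear F"
    unfolding clinear_def
  proof (intro conjI allI)
    fix u v :: "('a, 'b) proj_tensor" and c
    have "(\<lambda>n. proj_embed (U u n + U v n)) \<longlonglongrightarrow> u + v"
      unfolding proj_embed_add by (intro tendsto_add U)
    from F'[OF this] have "(\<lambda>n. tensor_eval (U u n) B + tensor_eval (U v n) B) \<longlonglongrightarrow> F (u + v)"
      by (simp only: tensor_eval_add)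
    then show "F (u + v) = F u + F v" using tendsto_add[OF F F] LIMSEQ_unique by blast
    have "(\<lambda>n. proj_embed (c *\<^sub>C U u n)) \<longlonglongrightarrow> c *\<^sub>C u"
    proof -
      have "bounded_linear (\<lambda>x :: ('a, 'b) proj_tensor. c *\<^sub>C x)"
        by (rule bounded_linear_intro[of _ "cmod c"])
          (simp_all add: scaleC_add_right norm_scaleC scaleR_scaleC scaleC_scaleC mult.commute)
      from bounded_linear.tendsto[OF this U] show ?thesis by (simp only: proj_embed_scaleC)
    qed
    from F'[OF this] have "(\<lambda>n. c * tensor_eval (U u n) B) \<longlonglongrightarrow> F (c *\<^sub>C u)"
      by (simp only: tensor_eval_scaleC)
    then show "F (c *\<^sub>C u) = c *\<^sub>C F u"
      using tendsto_mult_left[OF F] LIMSEQ_unique unfolding scaleC_complex_def by blast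
  qed
  have bd: "cmod (F u) \<le> K * norm u" for u
  proof (rule LIMSEQ_le[OF tendsto_norm[OF F] tendsto_mult_left[OF tendsto_norm[OF U]]])
    show "\<exists>N. \<forall>n\<ge>N. cmod (tensor_eval (U u n) B) \<le> K * norm (proj_embed (U u n))"
      unfolding norm_proj_embed by (intro exI allI impI tensor_eval_bound[OF B K])
  qed
  have "F (proj_embed v) = tensor_eval v B" for v
    using F'[of "\<lambda>_. v" "proj_embed v"] by (simp add: LIMSEQ_const_iff)
  then show thesis
    by (intro that[of "Dual F"]) (simp add: dual_apply_Dual[OF lin bd] tensor_eval_tensor[OF B])
qed

lemma bounded_linear_dual_apply: "bounded_linear (dual_apply f)"
proof (rule bounded_linear_intro[of _ "norm f"])
  show "norm (dual_apply f x) \<le> norm x * norm f" for x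
    using norm_dual_apply[of f x] by (simp only: mult.commute)
qed (simp_all add: clinearD(6)[OF clinear_dual_apply])

text \<open>The infimum in \<open>gamma_norm\<close> carries a bound on elementary tensors to all
  tensors. Functionals on the product can thus be compared through their bilinear forms.\<close>

lemma norm_proj_tensor_dual_le:
  fixes f :: "('a::complex_normed_vector, 'b::complex_normed_vector) proj_tensor dual"
  assumes K: "0 \<le> K" "\<And>x y. cmod (dual_apply f (proj_embed (x \<otimes> y))) \<le> K * norm x * norm y"
  shows "norm f \<le> K"
proof (rule norm_dual_bound[OF K(1)])
  fix u :: "('a, 'b) proj_tensor"
  define B where "B x y = dual_apply f (proj_embed (x \<otimes> y))" for x y
  have B: "bilinear_form B"
    unfolding B_def by (rule bilinear_formI) (simp_all add: tensor_bilinear proj_embed_add proj_embed_scaleC)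
  have z: "dual_apply f (proj_embed 0) = 0"
    using proj_embed_scaleC[of 0 "0 :: ('a, 'b) alg_tensor"] by (simp add: clinearD(3)[OF clinear_dual_apply])
  have "dual_apply f (proj_embed (\<Sum>(x, y)\<leftarrow>xs. x \<otimes> y)) = (\<Sum>(x, y)\<leftarrow>xs. B x y)" for xs
    by (induction xs) (auto simp: z proj_embed_add B_def)
  then have ev: "dual_apply f (proj_embed v) = tensor_eval v B" for v
    using alg_tensor_repr[of v] by (auto simp: tensor_eval_sum_list tensor_sum_def B)
  obtain U where U: "(\<lambda>n. proj_embed (U n)) \<longlonglongrightarrow> u" by (rule proj_embed_approx)
  show "cmod (dual_apply f u) \<le> K * norm u"
  proof (rule LIMSEQ_le[OF tendsto_norm[OF bounded_linear.tendsto[OF bounded_linear_dual_apply U]]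
        tendsto_mult_left[OF tendsto_norm[OF U]]])
    show "\<exists>N. \<forall>n\<ge>N. cmod (dual_apply f (proj_embed (U n))) \<le> K * norm (proj_embed (U n))"
      unfolding norm_proj_embed ev
      by (intro exI allI impI tensor_eval_bound[OF B K(1)]) (simp add: B_def K(2))
  qed
qed

lemma norm_proj_embed_tensor_le: "norm (proj_embed (x \<otimes> y)) \<le> norm x * norm y"
  using gamma_norm_le[of "x \<otimes> y" "[(x, y)]"] by (simp add: norm_proj_embed)

section \<open>Arens regularity\<close>

lemma continuous_map_weak_star_apply:
  "continuous_map weak_star euclidean (\<lambda>\<phi>. dual_apply \<phi> x)"
proof -
  have "continuous_map (product_topology (\<lambda>_. euclidean) UNIV) euclidean (\<lambda>h :: 'a \<Rightarrow> complex. h x)"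
    by (rule continuous_map_product_projection) simp
  from continuous_map_pullback[OF this, of UNIV dual_apply] show ?thesis
    by (simp add: weak_star_def o_def)
qed

lemma continuous_map_weak_starI:
  assumes "\<And>x. continuous_map T euclidean (\<lambda>t. dual_apply (g t) x)"
  shows "continuous_map T weak_star g"
  unfolding weak_star_def
proof (rule continuous_map_pullback')
  show "continuous_map T (product_topology (\<lambda>_. euclidean) UNIV) (dual_apply \<circ> g)"
    by (rule continuous_map_coordinatewise_then_product) (simp_all add: assms)
qed simp

lemma limitin_weak_starI:
  assumes "\<And>x. ((\<lambda>n. dual_apply (\<phi> n) x) \<longlongrightarrow> dual_apply \<psi> x) F"
  shows "limitin weak_star \<phi> \<psi> F"
proof -
  have l: "limitin (product_topology (\<lambda>_. euclidean) UNIV) (\<lambda>n. dual_apply (\<phi> n)) (dual_apply \<psi>) F"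
    unfolding limitin_componentwise using assms by (simp add: extensional_def)
  show ?thesis
    unfolding limitin_def weak_star_def
  proof (intro conjI allI impI)
    show "\<psi> \<in> topspace (pullback_topology UNIV dual_apply (product_topology (\<lambda>_. euclidean) UNIV))"
      by (simp add: topspace_pullback_topology)
    fix U assume "openin (pullback_topology UNIV dual_apply (product_topology (\<lambda>_. euclidean) UNIV)) U \<and> \<psi> \<in> U"
    then obtain V where V: "openin (product_topology (\<lambda>_. euclidean) UNIV) V" "U = dual_apply -` V" "\<psi> \<in> U"
      unfolding openin_pullback_topology by auto
    then have "eventually (\<lambda>n. dual_apply (\<phi> n) \<in> V) F" using l unfolding limitin_def by blast
    then show "eventually (\<lambda>n. \<phi> n \<in> U) F" by (simp add: V(2))
  qed
qed

definition hat :: "'a::complex_normed_vector \<Rightarrow> 'a dual dual"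
  where "hat a = Dual (\<lambda>f. dual_apply f a)"

lemma hat_apply [simp]: "dual_apply (hat a) f = dual_apply f a"
  unfolding hat_def
  by (subst dual_apply_Dual[of _ "norm a"])
    (simp_all add: clinear_def scaleC_complex_def norm_dual_apply mult.commute[of "norm a"])

lemma norm_hat_le: "norm (hat a) \<le> norm a"
  by (rule norm_dual_bound) (simp_all add: norm_dual_apply mult.commute[of "norm a"])

text \<open>Banach-Alaoglu for a bounded sequence, with weak* convergence in the bidual along a
  filter.\<close>

lemma bidual_cluster:
  fixes v :: "nat \<Rightarrow> 'a::complex_normed_vector"
  assumes "\<And>n. norm (v n) \<le> M"
  obtains F Y where "F \<noteq> bot" "F \<le> sequentially" "\<And>f. ((\<lambda>n. dual_apply f (v n)) \<longlongrightarrow> dual_apply Y f) F"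
proof -
  have bd: "cmod (dual_apply f (v n)) \<le> norm f * M" for f n
    using norm_dual_apply[of f "v n"] mult_left_mono[OF assms[of n] norm_ge_zero[of f]] by linarith
  obtain F l where F: "F \<noteq> bot" "F \<le> sequentially" and l: "\<And>f. ((\<lambda>n. dual_apply f (v n)) \<longlongrightarrow> l f) F"
    by (rule pointwise_bounded_cluster[of "\<lambda>n f. dual_apply f (v n)" "\<lambda>f. norm f * M", OF bd]) (rule that)
  have lin: "clinear l"
    unfolding clinear_def
  proof (intro conjI allI)
    fix f g :: "'a dual" and c
    have "((\<lambda>n. dual_apply (f + g) (v n)) \<longlongrightarrow> l f + l g) F" using tendsto_add[OF l l] by simp
    then show "l (f + g) = l f + l g" using tendsto_unique[OF F(1) l] by blast
    have "((\<lambda>n. dual_apply (c *\<^sub>C f) (v n)) \<longlongrightarrow> c * l f) F" using tendsto_mult_left[OF l] by simp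
    then show "l (c *\<^sub>C f) = c *\<^sub>C l f" unfolding scaleC_complex_def using tendsto_unique[OF F(1) l] by blast
  qed
  have "cmod (l f) \<le> M * norm f" for f
    by (rule tendsto_upperbound[OF tendsto_norm[OF l] _ F(1)])
      (use bd in \<open>simp add: always_eventually mult.commute\<close>)
  then have "dual_apply (Dual l) = l" by (rule dual_apply_Dual[OF lin])
  then show thesis using that[of F "Dual l"] F l by simp
qed

text \<open>Grothendieck's double limit criterion, for sequences whose iterated limits are \<open>1\<close> and \<open>0\<close>.\<close>

lemma not_arens_regularI:
  fixes f :: "'a::complex_banach_algebra dual" and u v :: "nat \<Rightarrow> 'a"
  assumes u: "\<And>n. norm (u n) \<le> M" and v: "\<And>n. norm (v n) \<le> M"
    and 1: "\<And>m n. m \<le> n \<Longrightarrow> dual_apply f (u m * v n) = 1"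
    and 0: "\<And>m n. n < m \<Longrightarrow> dual_apply f (u m * v n) = 0"
  shows "\<not> arens_regular TYPE('a)"
proof
  assume reg: "arens_regular TYPE('a)"
  obtain F X where F: "F \<noteq> bot" "F \<le> sequentially"
    and X: "\<And>f. ((\<lambda>n. dual_apply f (u n)) \<longlongrightarrow> dual_apply X f) F"
    by (rule bidual_cluster[OF u]) (rule that)
  obtain G Y where G: "G \<noteq> bot" "G \<le> sequentially"
    and Y: "\<And>f. ((\<lambda>n. dual_apply f (v n)) \<longlongrightarrow> dual_apply Y f) G"
    by (rule bidual_cluster[OF v]) (rule that)
  have ev: "((\<lambda>n. h n) \<longlongrightarrow> c) H" if "\<And>n. n > k \<Longrightarrow> h n = c" "H \<le> sequentially" for h :: "nat \<Rightarrow> complex" and c k H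
  proof (rule tendsto_eventually)
    have "eventually (\<lambda>n. h n = c) sequentially" using that(1) eventually_gt_at_top by (rule eventually_mono[rotated])
    then show "eventually (\<lambda>n. h n = c) H" using that(2) by (rule filter_leD[rotated])
  qed
  \<comment> \<open>The limit over \<open>n\<close> is taken first here, and all
    \<open>n > m\<close> give the value 1.\<close>
  have "dual_apply (arens_Yf Y f) (u m) = 1" for m
    unfolding arens_Yf_apply
  proof (rule tendsto_unique[OF G(1) Y])
    show "((\<lambda>n. dual_apply (arens_fa f (u m)) (v n)) \<longlongrightarrow> 1) G"
      by (rule ev[of m, OF _ G(2)]) (simp add: arens_fa_apply 1)
  qed
  then have XY: "dual_apply (X \<box> Y) f = 1"
    using tendsto_unique[OF F(1) X[of "arens_Yf Y f"]] by (simp add: arens_mult_apply)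
  \<comment> \<open>For a fixed \<open>n\<close> only the limit over \<open>m\<close> is left, and
    it is 0. Weak* continuity would carry this 0 over to \<open>Y\<close>, the limit of the
    \<open>hat (v n)\<close>.\<close>
  have Xv: "dual_apply (X \<box> hat (v n)) f = 0" for n
    unfolding arens_mult_apply
  proof (rule tendsto_unique[OF F(1) X])
    show "((\<lambda>m. dual_apply (arens_Yf (hat (v n)) f) (u m)) \<longlongrightarrow> 0) F"
      by (rule ev[of n, OF _ F(2)]) (simp add: arens_Yf_apply arens_fa_apply 0)
  qed
  have "limitin weak_star (\<lambda>n. hat (v n)) Y G"
    by (rule limitin_weak_starI) (simp add: Y)
  then have "limitin weak_star ((\<lambda>Y. X \<box> Y) \<circ> (\<lambda>n. hat (v n))) (X \<box> Y) G"
    using reg unfolding arens_regular_def by (blast intro: continuous_map_limit)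
  from continuous_map_limit[OF continuous_map_weak_star_apply this, of f]
  have "((\<lambda>n. 0) \<longlongrightarrow> dual_apply (X \<box> Y) f) G"
    by (simp add: o_def Xv)
  then show False using XY tendsto_unique[OF G(1) tendsto_const] by fastforce
qed

section \<open>Functionals at which the Arens product is weak* continuous\<close>

text \<open>These are the weakly almost periodic functionals. Weak* continuity in \<open>Y\<close>
  is encoded by a representing element \<open>g\<close> of the dual, which reduces closure under
  linear combinations to algebra.\<close>

definition arens_wstar_cont :: "'a::complex_normed_algebra dual \<Rightarrow> bool"
  where "arens_wstar_cont f \<longleftrightarrow> (\<forall>X. \<exists>g. \<forall>Y. dual_apply (X \<box> Y) f = dual_apply Y g)"

lemma arens_wstar_cont_zero: "arens_wstar_cont 0"
  unfolding arens_wstar_cont_def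
  by (intro allI exI[of _ 0]) (simp add: clinearD(3)[OF clinear_dual_apply])

lemma arens_wstar_cont_add:
  assumes "arens_wstar_cont f" "arens_wstar_cont g"
  shows "arens_wstar_cont (f + g)"
  unfolding arens_wstar_cont_def
proof
  fix X :: "'a dual dual"
  obtain f' where f': "\<And>Y. dual_apply (X \<box> Y) f = dual_apply Y f'" using assms(1) unfolding arens_wstar_cont_def by blast
  obtain g' where g': "\<And>Y. dual_apply (X \<box> Y) g = dual_apply Y g'" using assms(2) unfolding arens_wstar_cont_def by blast
  show "\<exists>h. \<forall>Y. dual_apply (X \<box> Y) (f + g) = dual_apply Y h"
    by (rule exI[of _ "f' + g'"]) (simp add: f' g')
qed

lemma arens_wstar_cont_scaleC:
  assumes "arens_wstar_cont f"
  shows "arens_wstar_cont (c *\<^sub>C f)"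
  unfolding arens_wstar_cont_def
proof
  fix X :: "'a dual dual"
  obtain f' where f': "\<And>Y. dual_apply (X \<box> Y) f = dual_apply Y f'" using assms unfolding arens_wstar_cont_def by blast
  show "\<exists>h. \<forall>Y. dual_apply (X \<box> Y) (c *\<^sub>C f) = dual_apply Y h"
    by (rule exI[of _ "c *\<^sub>C f'"]) (simp add: f')
qed

lemma arens_wstar_cont_sum: "(\<And>i. i \<in> I \<Longrightarrow> arens_wstar_cont (f i)) \<Longrightarrow> arens_wstar_cont (sum f I)"
  by (induction I rule: infinite_finite_induct) (auto intro: arens_wstar_cont_zero arens_wstar_cont_add)

text \<open>Here \<open>arens_fa h a\<close> is \<open>h a\<close> times \<open>h\<close>, so the
  Arens product evaluates at \<open>h\<close> as the product of the values of \<open>X\<close> and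
  \<open>Y\<close> there.\<close>

lemma arens_wstar_cont_multiplicative:
  assumes h: "\<And>a b. dual_apply h (a * b) = dual_apply h a * dual_apply h b"
  shows "arens_wstar_cont h"
  unfolding arens_wstar_cont_def
proof
  fix X :: "'a dual dual"
  have fa: "arens_fa h a = dual_apply h a *\<^sub>C h" for a
    by (rule dual_eqI) (simp add: arens_fa_apply h)
  have Yf: "arens_Yf Y h = dual_apply Y h *\<^sub>C h" for Y
    by (rule dual_eqI) (simp add: arens_Yf_apply fa)
  show "\<exists>g. \<forall>Y. dual_apply (X \<box> Y) h = dual_apply Y g"
    by (rule exI[of _ "dual_apply X h *\<^sub>C h"]) (simp add: arens_mult_apply Yf)
qed

lemma norm_arens_mult_apply: "cmod (dual_apply (X \<box> Y) f) \<le> norm X * norm Y * norm f"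
  unfolding arens_mult_apply by (rule bound_chain[OF norm_dual_apply norm_arens_Yf norm_ge_zero])

text \<open>The representing functional depends on \<open>f\<close> with Lipschitz constant
  \<open>norm X\<close>. So representability survives norm limits in \<open>f\<close>, and a dense
  supply of representable functionals suffices.\<close>

lemma arens_regularI:
  assumes dense: "\<And>(f :: 'a::complex_banach_algebra dual) e. 0 < e \<Longrightarrow> \<exists>h. arens_wstar_cont h \<and> norm (f - h) \<le> e"
  shows "arens_regular TYPE('a)"
  unfolding arens_regular_def
proof (intro allI continuous_map_weak_starI)
  fix X :: "'a dual dual" and f :: "'a dual"
  \<comment> \<open>The only candidate: a representing functional is determined by its values at the
    \<open>hat a\<close>.\<close>
  define G where "G f = Dual (\<lambda>a. dual_apply (X \<box> hat a) f)" for f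
  have G: "dual_apply (G f) a = dual_apply (X \<box> hat a) f" for f a
  proof -
    have "arens_Yf (hat (a + b)) f = arens_Yf (hat a) f + arens_Yf (hat b) f" for a b
      by (rule dual_eqI) (simp add: arens_Yf_apply)
    moreover have "arens_Yf (hat (c *\<^sub>C a)) f = c *\<^sub>C arens_Yf (hat a) f" for a c
      by (rule dual_eqI) (simp add: arens_Yf_apply)
    ultimately have "clinear (\<lambda>a. dual_apply (X \<box> hat a) f)"
      by (simp add: clinear_def arens_mult_apply scaleC_complex_def)
    moreover have "cmod (dual_apply (X \<box> hat a) f) \<le> (norm X * norm f) * norm a" for a
    proof -
      have "cmod (dual_apply (X \<box> hat a) f) \<le> norm X * norm (hat a) * norm f" by (rule norm_arens_mult_apply)
      also have "\<dots> \<le> norm X * norm a * norm f"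
        by (intro mult_right_mono mult_left_mono norm_hat_le) auto
      finally show ?thesis by (simp add: ac_simps)
    qed
    ultimately show ?thesis unfolding G_def by (subst dual_apply_Dual) auto
  qed
  have Gn: "norm (G f - G h) \<le> norm X * norm (f - h)" for f h
  proof (rule norm_dual_bound)
    fix a
    have ml: "dual_apply \<phi> (x - y) = dual_apply \<phi> x - dual_apply \<phi> y" for \<phi> :: "'a dual dual" and x y
      by (rule clinearD(5)[OF clinear_dual_apply])
    have "dual_apply (G f - G h) a + dual_apply (G h) a = dual_apply (G f) a"
      by (simp only: dual_apply_add_left[symmetric] diff_add_cancel)
    then have "dual_apply (G f - G h) a = dual_apply (X \<box> hat a) (f - h)"
      by (simp add: G ml algebra_simps)
    then have "cmod (dual_apply (G f - G h) a) \<le> norm X * norm (hat a) * norm (f - h)"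
      using norm_arens_mult_apply by metis
    also have "\<dots> \<le> norm X * norm a * norm (f - h)"
      by (intro mult_right_mono mult_left_mono norm_hat_le) auto
    finally show "cmod (dual_apply (G f - G h) a) \<le> norm X * norm (f - h) * norm a" by (simp add: ac_simps)
  qed simp
  have "dual_apply (X \<box> Y) f = dual_apply Y (G f)" for Y
  proof -
    have "cmod (dual_apply (X \<box> Y) f - dual_apply Y (G f)) \<le> 2 * (norm X * norm Y) * e" if e: "0 < e" for e
    proof -
      obtain h where h: "arens_wstar_cont h" "norm (f - h) \<le> e" using dense[OF e, of f] by blast
      obtain g where g: "\<And>Y. dual_apply (X \<box> Y) h = dual_apply Y g" using h(1) unfolding arens_wstar_cont_def by blast
      have "g = G h" by (rule dual_eqI) (simp add: G g)
      then have "dual_apply (X \<box> Y) h = dual_apply Y (G h)" using g by simp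
      then have "dual_apply (X \<box> Y) f - dual_apply Y (G f)
          = dual_apply (X \<box> Y) (f - h) - dual_apply Y (G f - G h)"
        by (simp add: clinearD(5)[OF clinear_dual_apply])
      then have "cmod (dual_apply (X \<box> Y) f - dual_apply Y (G f))
          \<le> cmod (dual_apply (X \<box> Y) (f - h)) + cmod (dual_apply Y (G f - G h))"
        by (simp only: norm_triangle_ineq4)
      also have "\<dots> \<le> norm X * norm Y * norm (f - h) + norm Y * (norm X * norm (f - h))"
        by (intro add_mono norm_arens_mult_apply order_trans[OF norm_dual_apply] mult_left_mono Gn norm_ge_zero)
      also have "\<dots> = 2 * (norm X * norm Y) * norm (f - h)" by (simp add: algebra_simps)
      also have "\<dots> \<le> 2 * (norm X * norm Y) * e" using h(2) by (intro mult_left_mono) auto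
      finally show ?thesis .
    qed
    then have ev: "eventually (\<lambda>e. cmod (dual_apply (X \<box> Y) f - dual_apply Y (G f)) \<le> 2 * (norm X * norm Y) * e) (at_right 0)"
      using eventually_at_right_less[of "0::real"] by (rule eventually_mono[rotated]) auto
    have "((\<lambda>e. 2 * (norm X * norm Y) * e) \<longlongrightarrow> 2 * (norm X * norm Y) * 0) (at_right 0)"
      by (intro tendsto_intros)
    from tendsto_lowerbound[OF this ev] show ?thesis by simp
  qed
  then show "continuous_map weak_star euclidean (\<lambda>Y. dual_apply (X \<box> Y) f)"
    by (simp add: continuous_map_weak_star_apply)
qed

section \<open>Arens regularity forces scatteredness\<close>

text \<open>Bessel's inequality for an orthogonal family that is not normalised, every member having
  squared norm \<open>M\<close>; it is the expansion of the squared distance from \<open>v\<close>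
  to its projection \<open>u\<close>.\<close>

lemma bessel_finite:
  fixes e :: "'i \<Rightarrow> 's \<Rightarrow> real" and v :: "'s \<Rightarrow> complex"
  assumes fin: "finite P" "finite S" and M: "0 < M"
    and orth: "\<And>i j. i \<in> P \<Longrightarrow> j \<in> P \<Longrightarrow> (\<Sum>s\<in>S. e i s * e j s) = (if i = j then M else 0)"
  shows "(\<Sum>i\<in>P. (cmod ((\<Sum>s\<in>S. v s * of_real (e i s)) / of_real M))\<^sup>2) * M \<le> (\<Sum>s\<in>S. (cmod (v s))\<^sup>2)"
proof -
  define c where "c i = (\<Sum>s\<in>S. v s * of_real (e i s)) / of_real M" for i
  define u where "u s = (\<Sum>i\<in>P. c i * of_real (e i s))" for s
  define Q where "Q = (\<Sum>i\<in>P. (cmod (c i))\<^sup>2)"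
  have cm: "(\<Sum>s\<in>S. v s * of_real (e i s)) = c i * of_real M" for i using M by (simp add: c_def)
  have cc: "(\<Sum>i\<in>P. cnj (c i) * c i) = of_real Q"
    unfolding Q_def of_real_sum complex_norm_square by (simp only: mult.commute)
  have vu: "(\<Sum>s\<in>S. v s * cnj (u s)) = of_real (Q * M)"
  proof -
    have "(\<Sum>s\<in>S. v s * cnj (u s)) = (\<Sum>s\<in>S. \<Sum>i\<in>P. cnj (c i) * (v s * of_real (e i s)))"
      by (simp add: u_def sum_distrib_left ac_simps)
    also have "\<dots> = (\<Sum>i\<in>P. cnj (c i) * (\<Sum>s\<in>S. v s * of_real (e i s)))"
      by (subst sum.swap) (simp add: sum_distrib_left)
    also have "\<dots> = (\<Sum>i\<in>P. cnj (c i) * c i) * of_real M"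
      by (simp add: cm sum_distrib_right mult.assoc)
    finally show ?thesis by (simp add: cc)
  qed
  have uu: "(\<Sum>s\<in>S. u s * cnj (u s)) = of_real (Q * M)"
  proof -
    have "(\<Sum>s\<in>S. u s * cnj (u s)) = (\<Sum>s\<in>S. \<Sum>i\<in>P. \<Sum>j\<in>P. c i * cnj (c j) * of_real (e i s * e j s))"
      by (simp add: u_def sum_product ac_simps)
    also have "\<dots> = (\<Sum>i\<in>P. \<Sum>j\<in>P. \<Sum>s\<in>S. c i * cnj (c j) * of_real (e i s * e j s))"
      by (subst sum.swap) (intro sum.cong refl sum.swap)
    also have "\<dots> = (\<Sum>i\<in>P. \<Sum>j\<in>P. c i * cnj (c j) * of_real (\<Sum>s\<in>S. e i s * e j s))"
      by (simp only: sum_distrib_left of_real_sum)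
    also have "\<dots> = (\<Sum>i\<in>P. \<Sum>j\<in>P. if i = j then c i * cnj (c i) * of_real M else 0)"
      by (intro sum.cong refl) (simp add: orth)
    also have "\<dots> = (\<Sum>i\<in>P. c i * cnj (c i) * of_real M)" using fin(1) by simp
    also have "\<dots> = (\<Sum>i\<in>P. cnj (c i) * c i) * of_real M" by (simp only: sum_distrib_left sum_distrib_right mult.commute)
    finally show ?thesis by (simp add: cc)
  qed
  have "0 \<le> (\<Sum>s\<in>S. (cmod (v s - u s))\<^sup>2)" by (intro sum_nonneg) simp
  also have "\<dots> = (\<Sum>s\<in>S. (cmod (v s))\<^sup>2 - 2 * Re (v s * cnj (u s)) + Re (u s * cnj (u s)))"
    by (intro sum.cong refl) (simp add: cmod_power2, simp add: power2_eq_square algebra_simps)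
  also have "\<dots> = (\<Sum>s\<in>S. (cmod (v s))\<^sup>2) - 2 * Re (\<Sum>s\<in>S. v s * cnj (u s)) + Re (\<Sum>s\<in>S. u s * cnj (u s))"
    by (simp add: sum.distrib sum_subtractf sum_distrib_left)
  also have "\<dots> = (\<Sum>s\<in>S. (cmod (v s))\<^sup>2) - Q * M"
    unfolding vu uu by simp
  finally show ?thesis by (simp add: Q_def c_def)
qed

section \<open>Walsh functions on sign lists\<close>

definition sign_lists :: "nat \<Rightarrow> bool list set"
  where "sign_lists N = {s. length s = N}"

definition sgn_at :: "nat \<Rightarrow> bool list \<Rightarrow> real"
  where "sgn_at k s = (if s ! k then 1 else - 1)"

lemma finite_sign_lists [simp]: "finite (sign_lists N)"
  using finite_lists_length_eq[of "UNIV :: bool set" N] by (simp add: sign_lists_def)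

lemma card_sign_lists: "card (sign_lists N) = 2 ^ N"
  using card_lists_length_eq[of "UNIV :: bool set" N] by (simp add: sign_lists_def)

lemma sum_sign_flip:
  fixes h :: "bool list \<Rightarrow> real"
  assumes j: "j < N" and h: "\<And>s. s \<in> sign_lists N \<Longrightarrow> h (s[j := \<not> s ! j]) = - h s"
  shows "(\<Sum>s\<in>sign_lists N. h s) = 0"
proof -
  have "(\<Sum>s\<in>sign_lists N. h s) = (\<Sum>s\<in>sign_lists N. - h s)"
    by (rule sum.reindex_bij_witness[of _ "\<lambda>s. s[j := \<not> s ! j]" "\<lambda>s. s[j := \<not> s ! j]"])
      (use j h in \<open>auto simp: sign_lists_def\<close>)
  then show ?thesis by (simp add: sum_negf)
qed

lemma sgn_at_flip:
  "j < length s \<Longrightarrow> sgn_at k (s[j := \<not> s ! j]) = (if k = j then - sgn_at k s else sgn_at k s)"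
  by (simp add: sgn_at_def)

text \<open>If the index pairs differ, flipping one bit reverses exactly one of the four factors:
  bit \<open>2 * i\<close>, or bit \<open>2 * j + 1\<close> when \<open>i = i'\<close>. Even and odd
  positions never interfere.\<close>

lemma walsh_orthogonal:
  assumes "2 * i < N" "2 * j + 1 < N" "2 * i' < N" "2 * j' + 1 < N"
  shows "(\<Sum>s\<in>sign_lists N. (sgn_at (2 * i) s * sgn_at (2 * j + 1) s) * (sgn_at (2 * i') s * sgn_at (2 * j' + 1) s))
    = (if (i, j) = (i', j') then 2 ^ N else 0)"
proof -
  have par: "2 * a \<noteq> 2 * b + 1" "2 * b + 1 \<noteq> 2 * a" for a b :: nat by presburger+
  consider "i \<noteq> i'" | "i = i'" "j \<noteq> j'" | "i = i'" "j = j'" by blast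
  then show ?thesis
  proof cases
    case 1
    have "(\<Sum>s\<in>sign_lists N. (sgn_at (2 * i) s * sgn_at (2 * j + 1) s) * (sgn_at (2 * i') s * sgn_at (2 * j' + 1) s)) = 0"
      by (rule sum_sign_flip[OF assms(1)])
        (use 1 par assms(1) in \<open>simp add: sgn_at_flip sign_lists_def del: One_nat_def add_2_eq_Suc'\<close>)
    then show ?thesis using 1 by simp
  next
    case 2
    have "(\<Sum>s\<in>sign_lists N. (sgn_at (2 * i) s * sgn_at (2 * j + 1) s) * (sgn_at (2 * i') s * sgn_at (2 * j' + 1) s)) = 0"
      by (rule sum_sign_flip[OF assms(2)])
        (use 2 par assms(2) in \<open>simp add: sgn_at_flip sign_lists_def del: One_nat_def add_2_eq_Suc'\<close>)
    then show ?thesis using 2 by simp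
  next
    case 3
    have "(sgn_at (2 * i) s * sgn_at (2 * j + 1) s) * (sgn_at (2 * i') s * sgn_at (2 * j' + 1) s) = 1" for s
      using 3 by (simp add: sgn_at_def)
    then have "(\<Sum>s\<in>sign_lists N. (sgn_at (2 * i) s * sgn_at (2 * j + 1) s) * (sgn_at (2 * i') s * sgn_at (2 * j' + 1) s))
        = real (card (sign_lists N))" by (simp only: sum_constant mult_1_right)
    then show ?thesis using 3 by (simp add: card_sign_lists)
  qed
qed

lemma nonscattered_not_arens_regular:
  assumes "\<not> scattered TYPE('a::{cstar_algebra, comm_ring})"
  shows "\<not> arens_regular TYPE('a varopoulos)"
proof -
  obtain g :: "'a \<Rightarrow> complex" and b where g: "diffuse g" "pos b" "0 < Re (g b)"
    by (rule nonscattered_diffuse[OF assms]) (rule that)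
  obtain w :: "nat \<Rightarrow> 'a" and X where w: "\<And>n. norm (w n) \<le> 1" and X: "\<And>s. character (X s)"
    and Xw: "\<And>s n. n < length s \<Longrightarrow> X s (w n) = (if s ! n then 1 else - 1)"
    by (rule independent_sequence[OF g]) (rule that)
  define e where "e = (\<lambda>(i, j) s. sgn_at (2 * i) s * sgn_at (2 * j + 1) s)"
  \<comment> \<open>For \<open>i \<le> j\<close> the bound \<open>2 * j + 1 < N\<close> keeps both
    bits within lists of length \<open>N\<close>. The restriction to a triangle is what separates
    the two iterated limits.\<close>
  define P where "P N = {(i, j). i \<le> j \<and> 2 * j + 1 < N}" for N :: nat
  have finP: "finite (P N)" for N
    by (rule finite_subset[of _ "{..N} \<times> {..N}"]) (auto simp: P_def)
  \<comment> \<open>The Walsh coefficient of \<open>x\<close>, sampled at the \<open>2 ^ N\<close>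
    characters \<open>X s\<close> with equal weights.\<close>
  define c where "c N p x = (\<Sum>s\<in>sign_lists N. X s x * of_real (e p s)) / of_real (2 ^ N)" for N p x
  have orth: "(\<Sum>s\<in>sign_lists N. e p s * e q s) = (if p = q then 2 ^ N else 0)"
    if pq: "p \<in> {(i, j). 2 * i < N \<and> 2 * j + 1 < N}" "q \<in> {(i, j). 2 * i < N \<and> 2 * j + 1 < N}" for N p q
  proof -
    obtain i j i' j' where "p = (i, j)" "q = (i', j')" by (cases p; cases q)
    then show ?thesis using walsh_orthogonal[of i N j i' j'] pq by (simp add: e_def)
  qed
  have PN: "p \<in> {(i, j). 2 * i < N \<and> 2 * j + 1 < N}" if "p \<in> P N" for p N
    using that by (auto simp: P_def)
  have bessel: "(\<Sum>p\<in>P N. (cmod (c N p x))\<^sup>2) \<le> (norm x)\<^sup>2" for N x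
  proof -
    have "(\<Sum>p\<in>P N. (cmod (c N p x))\<^sup>2) * 2 ^ N \<le> (\<Sum>s\<in>sign_lists N. (cmod (X s x))\<^sup>2)"
      unfolding c_def by (rule bessel_finite[OF finP finite_sign_lists _ orth[OF PN PN]]) simp_all
    also have "\<dots> \<le> (\<Sum>s\<in>sign_lists N. (norm x)\<^sup>2)"
      by (intro sum_mono power_mono characterD(3)[OF X]) simp
    also have "\<dots> = (norm x)\<^sup>2 * 2 ^ N" by (simp add: card_sign_lists)
    finally show ?thesis by simp
  qed
  \<comment> \<open>No conjugate appears, so \<open>BN\<close> is bilinear. Bessel and
    Cauchy-Schwarz bound it by 1 for all \<open>N\<close>, which permits passing to a cluster
    point.\<close>
  define BN where "BN N x y = (\<Sum>p\<in>P N. c N p x * c N p y)" for N x y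
  have BN: "cmod (BN N x y) \<le> norm x * norm y" for N x y
  proof -
    have "cmod (BN N x y) \<le> (\<Sum>p\<in>P N. \<bar>cmod (c N p x)\<bar> * \<bar>cmod (c N p y)\<bar>)"
      unfolding BN_def by (rule order_trans[OF norm_sum]) (simp add: norm_mult)
    also have "\<dots> \<le> L2_set (\<lambda>p. cmod (c N p x)) (P N) * L2_set (\<lambda>p. cmod (c N p y)) (P N)"
      by (rule L2_set_mult_ineq)
    also have "\<dots> \<le> norm x * norm y"
      unfolding L2_set_def by (intro mult_mono real_le_lsqrt bessel) (auto simp: sum_nonneg)
    finally show ?thesis .
  qed
  obtain F l where F: "F \<noteq> bot" "F \<le> sequentially" and l: "\<And>xy. ((\<lambda>N. BN N (fst xy) (snd xy)) \<longlongrightarrow> l xy) F"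
    by (rule pointwise_bounded_cluster[of "\<lambda>N xy. BN N (fst xy) (snd xy)" "\<lambda>xy. norm (fst xy) * norm (snd xy)", OF BN]) (rule that)
  define B where "B x y = l (x, y)" for x y
  have B: "((\<lambda>N. BN N x y) \<longlongrightarrow> B x y) F" for x y using l[of "(x, y)"] by (simp add: B_def)
  have cadd: "c N p (x + y) = c N p x + c N p y" for N p x y
    by (simp add: c_def characterD(4)[OF X] distrib_right sum.distrib add_divide_distrib)
  have cscale: "c N p (k *\<^sub>C x) = k * c N p x" for N p x k
    by (simp add: c_def characterD(8)[OF X] sum_distrib_left mult.assoc)
  have "bilinear_form B"
  proof (rule bilinear_formI)
    fix x x' y y' :: 'a and k :: complex
    have "((\<lambda>N. BN N (x + x') y) \<longlongrightarrow> B x y + B x' y) F"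
      using tendsto_add[OF B[of x y] B[of x' y]] by (simp add: BN_def cadd distrib_right sum.distrib)
    then show "B (x + x') y = B x y + B x' y" by (rule tendsto_unique[OF F(1) B])
    have "((\<lambda>N. BN N x (y + y')) \<longlongrightarrow> B x y + B x y') F"
      using tendsto_add[OF B[of x y] B[of x y']] by (simp add: BN_def cadd distrib_left sum.distrib)
    then show "B x (y + y') = B x y + B x y'" by (rule tendsto_unique[OF F(1) B])
    have "((\<lambda>N. BN N (k *\<^sub>C x) y) \<longlongrightarrow> k * B x y) F"
      using tendsto_mult_left[OF B[of x y], of k] by (simp add: BN_def cscale sum_distrib_left mult.assoc)
    then show "B (k *\<^sub>C x) y = k * B x y" by (rule tendsto_unique[OF F(1) B])
    have "((\<lambda>N. BN N x (k *\<^sub>C y)) \<longlongrightarrow> k * B x y) F"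
      using tendsto_mult_left[OF B[of x y], of k] by (simp add: BN_def cscale sum_distrib_left ac_simps)
    then show "B x (k *\<^sub>C y) = k * B x y" by (rule tendsto_unique[OF F(1) B])
  qed
  moreover have "cmod (B x y) \<le> 1 * norm x * norm y" for x y
    by (rule tendsto_upperbound[OF tendsto_norm[OF B] _ F(1)]) (simp add: BN)
  ultimately obtain f where f: "\<And>x y. dual_apply f (proj_embed (x \<otimes> y)) = B x y"
    using proj_tensor_functional[of B 1] by auto
  define u where "u m = proj_embed (w (2 * m) \<otimes> w (2 * m))" for m
  define v where "v n = proj_embed (w (2 * n + 1) \<otimes> w (2 * n + 1))" for n
  define z where "z m n = w (2 * m) * w (2 * n + 1)" for m n
  have fuv: "dual_apply f (u m * v n) = B (z m n) (z m n)" for m n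
    unfolding u_def v_def proj_embed_mult[symmetric] tensor_mult z_def by (rule f)
  have Bz: "B (z m n) (z m n) = (if m \<le> n then 1 else 0)" for m n
  proof -
    \<comment> \<open>For such \<open>N\<close> both bits occur, so \<open>z m n\<close> restricts
      to the Walsh function \<open>e (m, n)\<close> at the sampled characters. Its only possibly
      nonzero coefficient over \<open>P N\<close> is its own.\<close>
    have "BN N (z m n) (z m n) = (if m \<le> n then 1 else 0)" if N: "N > 2 * m + 2 * n + 1" for N
    proof -
      have Xz: "X s (z m n) = of_real (e (m, n) s)" if "s \<in> sign_lists N" for s
        using that N by (simp add: z_def characterD(2)[OF X] Xw e_def sgn_at_def sign_lists_def)
      have "c N p (z m n) = (if p = (m, n) then 1 else 0)" if p: "p \<in> P N" for p
      proof -
        have "(\<Sum>s\<in>sign_lists N. X s (z m n) * of_real (e p s)) = of_real (\<Sum>s\<in>sign_lists N. e (m, n) s * e p s)"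
          by (simp add: Xz)
        also have "(\<Sum>s\<in>sign_lists N. e (m, n) s * e p s) = (if (m, n) = p then 2 ^ N else 0)"
          by (rule orth) (use N PN[OF p] in auto)
        finally show ?thesis by (auto simp: c_def)
      qed
      then have "BN N (z m n) (z m n) = (\<Sum>p\<in>P N. if p = (m, n) then 1 else 0)"
        unfolding BN_def by (intro sum.cong) auto
      also have "\<dots> = (if (m, n) \<in> P N then 1 else 0)" using finP by simp
      finally show ?thesis using N by (simp add: P_def)
    qed
    then have "eventually (\<lambda>N. BN N (z m n) (z m n) = (if m \<le> n then 1 else 0)) sequentially"
      using eventually_gt_at_top by (rule eventually_mono[rotated])
    then have "eventually (\<lambda>N. BN N (z m n) (z m n) = (if m \<le> n then 1 else 0)) F"
      using F(2) by (rule filter_leD[rotated])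
    from tendsto_eventually[OF this] show ?thesis by (rule tendsto_unique[OF F(1) B])
  qed
  have nrm: "norm (proj_embed (w k \<otimes> w k)) \<le> 1" for k
    using norm_proj_embed_tensor_le[of "w k" "w k"] mult_le_one[OF w[of k] norm_ge_zero w[of k]] by simp
  show ?thesis
  proof (rule not_arens_regularI[of u 1 v f])
    show "norm (u n) \<le> 1" "norm (v n) \<le> 1" for n unfolding u_def v_def by (rule nrm)+
    show "dual_apply f (u m * v n) = 1" if "m \<le> n" for m n unfolding fuv Bz using that by simp
    show "dual_apply f (u m * v n) = 0" if "n < m" for m n unfolding fuv Bz using that by simp
  qed
qed

section \<open>Domination of bilinear forms by positive functionals\<close>

text \<open>The average over all signs \<open>s\<close> of \<open>F (\<Sum> s\<^sub>i x\<^sub>i) (\<Prod> (1 + s\<^sub>i v\<^sub>i) - 1)\<close>, a Riesz product. It is used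
  with purely imaginary \<open>v\<^sub>i\<close>, for which the products are uniformly bounded by \<open>exp (\<Sum> |v\<^sub>i|\<^sup>2 / 2)\<close>.\<close>

fun riesz_mean :: "('a::ring \<times> 'a) list \<Rightarrow> ('a \<Rightarrow> 'a \<Rightarrow> complex) \<Rightarrow> complex" where
  "riesz_mean [] F = F 0 0"
| "riesz_mean ((x, v) # L) F =
    (riesz_mean L (\<lambda>X P. F (x + X) (v + P + v * P)) + riesz_mean L (\<lambda>X P. F (- x + X) (- v + P - v * P))) / 2"

lemma riesz_mean_add: "riesz_mean L (\<lambda>X P. F X P + G X P) = riesz_mean L F + riesz_mean L G"
  by (induction L F arbitrary: G rule: riesz_mean.induct) (simp_all add: add_divide_distrib)

lemma riesz_mean_scale: "riesz_mean L (\<lambda>X P. c * F X P) = c * riesz_mean L F"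
  by (induction L F rule: riesz_mean.induct) (simp_all add: distrib_left)

lemma riesz_mean_const: "riesz_mean L (\<lambda>X P. c) = c"
  by (induction L) auto

text \<open>The random product has mean 1, since each factor does independently of the
  others.\<close>

lemma riesz_mean_linear:
  fixes L :: "('a::complex_normed_algebra \<times> 'a) list"
  assumes "clinear h"
  shows "riesz_mean L (\<lambda>X P. h P) = 0"
proof (induction L)
  case (Cons p L)
  obtain x v where p: "p = (x, v)" by (cases p)
  have "riesz_mean (p # L) (\<lambda>X P. h P) =
      riesz_mean L (\<lambda>X P. h (v + P + v * P) + h (- v + P - v * P)) / 2"
    by (simp add: p riesz_mean_add)
  also have "(\<lambda>(X::'a) P. h (v + P + v * P) + h (- v + P - v * P)) = (\<lambda>X P. 2 * h P)"
    by (simp add: clinearD[OF assms] fun_eq_iff)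
  finally show ?case by (simp add: riesz_mean_scale Cons)
qed (simp add: clinearD(3)[OF assms])

text \<open>Expand the product over subsets of the signs: paired with the term
  \<open>s\<^sub>i x\<^sub>i\<close>, only the subset consisting of \<open>i\<close> alone has
  nonzero mean.\<close>

lemma riesz_mean_bilinear:
  fixes L :: "('a::complex_normed_algebra \<times> 'a) list"
  assumes B: "bilinear_form B"
  shows "riesz_mean L B = (\<Sum>(x, v)\<leftarrow>L. B x v)"
proof (induction L)
  case (Cons p L)
  obtain x v where p: "p = (x, v)" by (cases p)
  note D = bilinear_formD[OF B]
  have Bx: "clinear (\<lambda>P. B x (v * P))"
    by (simp add: clinear_def distrib_left mult_scaleC_right D scaleC_complex_def)
  have Bd: "B y (a - b) = B y a - B y b" for y a b
    using D(2)[of y a "- b"] by (simp add: D(6))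
  have Bd': "B (a - b) y = B a y - B b y" for y a b
    using D(1)[of a "- b" y] by (simp add: D(5))
  have "riesz_mean (p # L) B =
      riesz_mean L (\<lambda>X P. B (x + X) (v + P + v * P) + B (- x + X) (- v + P - v * P)) / 2"
    by (simp add: p riesz_mean_add)
  also have "(\<lambda>X P. B (x + X) (v + P + v * P) + B (- x + X) (- v + P - v * P))
      = (\<lambda>X P. 2 * ((B X P + B x v) + B x (v * P)))"
    by (simp add: D Bd Bd' fun_eq_iff algebra_simps)
  finally have "riesz_mean (p # L) B = riesz_mean L (\<lambda>X P. 2 * ((B X P + B x v) + B x (v * P))) / 2" .
  also have "\<dots> = riesz_mean L B + B x v"
    by (simp only: riesz_mean_scale riesz_mean_add riesz_mean_const riesz_mean_linear[OF Bx]) simp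
  finally show ?case using Cons by (simp add: p del: riesz_mean.simps)
qed (simp add: bilinear_formD[OF B])

text \<open>A mean is bounded by the bound on its values. \<open>P\<close> stands for a product
  minus the missing unit, so \<open>1 + \<omega> P\<close> is the product itself; purely imaginary
  \<open>\<omega> v\<close> give both sign choices the same modulus, with square
  \<open>1 + |\<omega> v|\<^sup>2\<close>.\<close>

lemma riesz_mean_bound:
  fixes L :: "('a::{cstar_algebra, comm_ring} \<times> 'a) list"
  assumes "\<And>X P. (\<And>\<omega>. character \<omega> \<Longrightarrow> cmod (\<omega> X) \<le> (\<Sum>(x, v)\<leftarrow>L. cmod (\<omega> x))) \<Longrightarrow>
      (\<And>\<omega>. character \<omega> \<Longrightarrow> (cmod (1 + \<omega> P))\<^sup>2 \<le> (\<Prod>(x, v)\<leftarrow>L. 1 + (cmod (\<omega> v))\<^sup>2)) \<Longrightarrow> cmod (F X P) \<le> M"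
    and "\<And>x v \<omega>. (x, v) \<in> set L \<Longrightarrow> character \<omega> \<Longrightarrow> Re (\<omega> v) = 0"
  shows "cmod (riesz_mean L F) \<le> M"
  using assms
proof (induction L arbitrary: F)
  case Nil
  have "cmod (F 0 0) \<le> M" by (rule Nil.prems(1)) (simp_all add: characterD(7))
  then show ?case by simp
next
  case (Cons p L)
  obtain x v where p: "p = (x, v)" by (cases p)
  have imv: "Re (\<omega> v) = 0" if "character \<omega>" for \<omega> using Cons.prems(2)[of x v \<omega>] that p by simp
  have imL: "Re (\<omega> v') = 0" if "(x', v') \<in> set L" "character \<omega>" for x' v' \<omega>
    using Cons.prems(2)[of x' v' \<omega>] that by simp
  have n1: "(cmod (1 + \<omega> v))\<^sup>2 = 1 + (cmod (\<omega> v))\<^sup>2" "(cmod (1 - \<omega> v))\<^sup>2 = 1 + (cmod (\<omega> v))\<^sup>2"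
    if "character \<omega>" for \<omega> using imv[OF that] by (simp_all add: cmod_power2)
  have 1: "cmod (riesz_mean L (\<lambda>X P. F (x + X) (v + P + v * P))) \<le> M"
  proof (rule Cons.IH[where F = "\<lambda>X P. F (x + X) (v + P + v * P)"])
    fix X P
    assume X: "\<And>\<omega>. character \<omega> \<Longrightarrow> cmod (\<omega> X) \<le> (\<Sum>(x, v)\<leftarrow>L. cmod (\<omega> x))"
      and P: "\<And>\<omega>. character \<omega> \<Longrightarrow> (cmod (1 + \<omega> P))\<^sup>2 \<le> (\<Prod>(x, v)\<leftarrow>L. 1 + (cmod (\<omega> v))\<^sup>2)"
    show "cmod (F (x + X) (v + P + v * P)) \<le> M"
    proof (rule Cons.prems(1))
      fix \<omega> :: "'a \<Rightarrow> complex" assume \<omega>: "character \<omega>"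
      show "cmod (\<omega> (x + X)) \<le> (\<Sum>(x, v)\<leftarrow>p # L. cmod (\<omega> x))"
        using norm_triangle_le[OF add_left_mono[OF X[OF \<omega>], of "cmod (\<omega> x)"]] by (simp add: p characterD(4)[OF \<omega>])
      have "1 + \<omega> (v + P + v * P) = (1 + \<omega> v) * (1 + \<omega> P)" by (simp add: characterD[OF \<omega>] algebra_simps)
      then have "(cmod (1 + \<omega> (v + P + v * P)))\<^sup>2 = (1 + (cmod (\<omega> v))\<^sup>2) * (cmod (1 + \<omega> P))\<^sup>2"
        by (simp only: norm_mult power_mult_distrib n1[OF \<omega>])
      then show "(cmod (1 + \<omega> (v + P + v * P)))\<^sup>2 \<le> (\<Prod>(x, v)\<leftarrow>p # L. 1 + (cmod (\<omega> v))\<^sup>2)"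
        using mult_left_mono[OF P[OF \<omega>], of "1 + (cmod (\<omega> v))\<^sup>2"] by (simp add: p)
    qed
  next
    fix x' v' and \<omega> :: "'a \<Rightarrow> complex" assume "(x', v') \<in> set L" "character \<omega>"
    then show "Re (\<omega> v') = 0" by (rule imL)
  qed
  have 2: "cmod (riesz_mean L (\<lambda>X P. F (- x + X) (- v + P - v * P))) \<le> M"
  proof (rule Cons.IH[where F = "\<lambda>X P. F (- x + X) (- v + P - v * P)"])
    fix X P
    assume X: "\<And>\<omega>. character \<omega> \<Longrightarrow> cmod (\<omega> X) \<le> (\<Sum>(x, v)\<leftarrow>L. cmod (\<omega> x))"
      and P: "\<And>\<omega>. character \<omega> \<Longrightarrow> (cmod (1 + \<omega> P))\<^sup>2 \<le> (\<Prod>(x, v)\<leftarrow>L. 1 + (cmod (\<omega> v))\<^sup>2)"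
    show "cmod (F (- x + X) (- v + P - v * P)) \<le> M"
    proof (rule Cons.prems(1))
      fix \<omega> :: "'a \<Rightarrow> complex" assume \<omega>: "character \<omega>"
      have "cmod (- \<omega> x) + cmod (\<omega> X) \<le> cmod (\<omega> x) + (\<Sum>(x, v)\<leftarrow>L. cmod (\<omega> x))" using X[OF \<omega>] by simp
      from norm_triangle_le[OF this]
      show "cmod (\<omega> (- x + X)) \<le> (\<Sum>(x, v)\<leftarrow>p # L. cmod (\<omega> x))" by (simp add: p characterD(4,5,6)[OF \<omega>])
      have "1 + \<omega> (- v + P - v * P) = (1 - \<omega> v) * (1 + \<omega> P)" by (simp add: characterD[OF \<omega>] algebra_simps)
      then have "(cmod (1 + \<omega> (- v + P - v * P)))\<^sup>2 = (1 + (cmod (\<omega> v))\<^sup>2) * (cmod (1 + \<omega> P))\<^sup>2"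
        by (simp only: norm_mult power_mult_distrib n1[OF \<omega>])
      then show "(cmod (1 + \<omega> (- v + P - v * P)))\<^sup>2 \<le> (\<Prod>(x, v)\<leftarrow>p # L. 1 + (cmod (\<omega> v))\<^sup>2)"
        using mult_left_mono[OF P[OF \<omega>], of "1 + (cmod (\<omega> v))\<^sup>2"] by (simp add: p)
    qed
  next
    fix x' v' and \<omega> :: "'a \<Rightarrow> complex" assume "(x', v') \<in> set L" "character \<omega>"
    then show "Re (\<omega> v') = 0" by (rule imL)
  qed
  show ?case
    using norm_triangle_le[OF add_mono[OF 1 2]] by (simp add: p norm_divide)
qed

section \<open>From Riesz products to a (2,1)-summing estimate\<close>

lemma sum_list_divide: "(\<Sum>p\<leftarrow>L. f p / c) = (\<Sum>p\<leftarrow>L. f p) / (c :: 'a::field)"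
  by (induction L) (simp_all add: add_divide_distrib)

lemma prod_list_le_exp: "(\<And>x. x \<in> set L \<Longrightarrow> 0 \<le> f x) \<Longrightarrow> (\<Prod>x\<leftarrow>L. 1 + f x) \<le> exp (\<Sum>x\<leftarrow>L. f x :: real)"
proof (induction L)
  case (Cons x L)
  have "(1 + f x) * (\<Prod>x\<leftarrow>L. 1 + f x) \<le> exp (f x) * exp (\<Sum>x\<leftarrow>L. f x)"
    using Cons by (intro mult_mono) (auto intro!: prod_list_nonneg add_nonneg_nonneg)
  then show ?case by (simp add: exp_add)
qed simp

text \<open>The Riesz product has squared modulus at most \<open>exp 1\<close>, hence modulus at
  most 2, and subtracting the missing 1 gives \<open>norm P\<close> at most 3. This is the constant
  3.\<close>

lemma bilinear_sum_bound:
  fixes B :: "'a::{cstar_algebra, comm_ring} \<Rightarrow> 'a \<Rightarrow> complex"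
  assumes B: "bilinear_form B" and K: "0 \<le> K" "\<And>x y. cmod (B x y) \<le> K * norm x * norm y"
    and x: "\<And>\<omega>. character \<omega> \<Longrightarrow> (\<Sum>(x, u)\<leftarrow>L. cmod (\<omega> x)) \<le> 1"
    and u: "\<And>\<omega>. character \<omega> \<Longrightarrow> (\<Sum>(x, u)\<leftarrow>L. (cmod (\<omega> u))\<^sup>2) \<le> 1"
    and real: "\<And>x u. (x, u) \<in> set L \<Longrightarrow> adj u = u"
  shows "cmod (\<Sum>(x, u)\<leftarrow>L. B x u) \<le> 3 * K"
proof -
  \<comment> \<open>The factor \<open>i\<close> makes the values of the self-adjoint
    \<open>u\<close> purely imaginary and changes the sum only by a phase.\<close>
  define L' where "L' = map (\<lambda>(x, u). (x, \<i> *\<^sub>C u)) L"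
  have "(\<Sum>(x, v)\<leftarrow>L'. B x v) = \<i> * (\<Sum>(x, u)\<leftarrow>L. B x u)"
    unfolding L'_def by (induction L) (auto simp: bilinear_formD[OF B] algebra_simps)
  then have "cmod (\<Sum>(x, u)\<leftarrow>L. B x u) = cmod (riesz_mean L' B)"
    by (simp add: riesz_mean_bilinear[OF B] norm_mult)
  also have "\<dots> \<le> 3 * K"
  proof (rule riesz_mean_bound)
    fix X P
    assume X: "\<And>\<omega>. character \<omega> \<Longrightarrow> cmod (\<omega> X) \<le> (\<Sum>(x, v)\<leftarrow>L'. cmod (\<omega> x))"
      and P: "\<And>\<omega>. character \<omega> \<Longrightarrow> (cmod (1 + \<omega> P))\<^sup>2 \<le> (\<Prod>(x, v)\<leftarrow>L'. 1 + (cmod (\<omega> v))\<^sup>2)"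
    have "norm X \<le> 1"
    proof (rule gelfand_norm_le)
      fix \<omega> :: "'a \<Rightarrow> complex" assume \<omega>: "character \<omega>"
      have "(\<Sum>(x, v)\<leftarrow>L'. cmod (\<omega> x)) = (\<Sum>(x, u)\<leftarrow>L. cmod (\<omega> x))"
        unfolding L'_def by (simp add: o_def split_def)
      then show "cmod (\<omega> X) \<le> 1" using X[OF \<omega>] x[OF \<omega>] by simp
    qed simp
    moreover have "norm P \<le> 3"
    proof (rule gelfand_norm_le)
      fix \<omega> :: "'a \<Rightarrow> complex" assume \<omega>: "character \<omega>"
      have "(\<Sum>(x, v)\<leftarrow>L'. (cmod (\<omega> v))\<^sup>2) = (\<Sum>(x, u)\<leftarrow>L. (cmod (\<omega> u))\<^sup>2)"
        unfolding L'_def by (simp add: o_def split_def characterD(8)[OF \<omega>] norm_mult)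
      then have le1: "(\<Sum>p\<leftarrow>L'. (cmod (\<omega> (snd p)))\<^sup>2) \<le> 1" using u[OF \<omega>] by (simp add: split_def)
      have "(cmod (1 + \<omega> P))\<^sup>2 \<le> (\<Prod>p\<leftarrow>L'. 1 + (cmod (\<omega> (snd p)))\<^sup>2)"
        using P[OF \<omega>] by (simp add: split_def)
      also have "\<dots> \<le> exp (\<Sum>p\<leftarrow>L'. (cmod (\<omega> (snd p)))\<^sup>2)" by (rule prod_list_le_exp) simp
      also have "\<dots> \<le> exp 1" using le1 by simp
      also have "\<dots> \<le> 2\<^sup>2" using exp_le by simp
      finally have "cmod (1 + \<omega> P) \<le> 2" by (rule power2_le_imp_le) simp
      then show "cmod (\<omega> P) \<le> 3" using norm_triangle_ineq4[of "1 + \<omega> P" 1] by simp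
    qed simp
    ultimately have "K * norm X * norm P \<le> K * 1 * 3" using K(1) by (intro mult_mono) auto
    then show "cmod (B X P) \<le> 3 * K" using K(2)[of X P] by simp
  next
    fix x v and \<omega> :: "'a \<Rightarrow> complex"
    assume "(x, v) \<in> set L'" and \<omega>: "character \<omega>"
    then obtain u where "(x, u) \<in> set L" "v = \<i> *\<^sub>C u" by (auto simp: L'_def)
    then show "Re (\<omega> v) = 0" using character_selfadjoint[OF \<omega> real] by (simp add: characterD(8)[OF \<omega>])
  qed
  finally show ?thesis .
qed

text \<open>Duality in l2: weights \<open>|B x u| / t\<close>, with \<open>t\<close> the root of the
  square sum, and phases moved into \<open>x\<close> turn the sum of
  \<open>bilinear_sum_bound\<close> into \<open>t\<close>. So \<open>t\<close> is at most
  \<open>3 * K\<close>.\<close>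

lemma selfadjoint_square_sum_bound:
  fixes B :: "'a::{cstar_algebra, comm_ring} \<Rightarrow> 'a \<Rightarrow> complex"
  assumes B: "bilinear_form B" and K: "0 \<le> K" "\<And>x y. cmod (B x y) \<le> K * norm x * norm y"
    and x: "\<And>\<omega>. character \<omega> \<Longrightarrow> (\<Sum>(x, u)\<leftarrow>L. cmod (\<omega> x)) \<le> 1"
    and real: "\<And>x u. (x, u) \<in> set L \<Longrightarrow> adj u = u \<and> norm u \<le> 1"
  shows "(\<Sum>(x, u)\<leftarrow>L. (cmod (B x u))\<^sup>2) \<le> 9 * K\<^sup>2"
proof -
  define T where "T = (\<Sum>(x, u)\<leftarrow>L. (cmod (B x u))\<^sup>2)"
  have T0: "0 \<le> T" unfolding T_def by (rule sum_list_nonneg) auto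
  show ?thesis
  proof (cases "T = 0")
    case True
    then show ?thesis by (simp add: T_def)
  next
    case False
    define t where "t = sqrt T"
    have t: "0 < t" "t * t = T" using False T0 by (simp_all add: t_def)
    \<comment> \<open>Division by zero makes the phase 0 where \<open>B x u\<close> vanishes, so its
      modulus is only known to be at most 1.\<close>
    define ph where "ph x u = cnj (B x u) / of_real (cmod (B x u))" for x u
    have ph1: "cmod (ph x u) \<le> 1" for x u by (simp add: ph_def norm_divide)
    have phB: "ph x u * B x u = of_real (cmod (B x u))" for x u
    proof (cases "B x u = 0")
      case False
      have "cnj (B x u) * B x u = of_real (cmod (B x u)) * of_real (cmod (B x u))"
        using complex_norm_square[of "B x u"] by (simp add: power2_eq_square mult.commute)
      then show ?thesis using False by (simp add: ph_def)
    qed (simp add: ph_def)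
    define L' where "L' = map (\<lambda>(x, u). (ph x u *\<^sub>C x, (cmod (B x u) / t) *\<^sub>R u)) L"
    have Bs: "B y (r *\<^sub>R u) = of_real r * B y u" for y r u by (simp add: scaleR_scaleC bilinear_formD[OF B])
    have "(\<Sum>(x, u)\<leftarrow>L'. B x u) = of_real (T / t)"
    proof -
      have "B (ph x u *\<^sub>C x) ((cmod (B x u) / t) *\<^sub>R u) = of_real ((cmod (B x u))\<^sup>2 / t)" for x u
      proof -
        have "B (ph x u *\<^sub>C x) ((cmod (B x u) / t) *\<^sub>R u) = of_real (cmod (B x u) / t) * (ph x u * B x u)"
          by (simp add: Bs bilinear_formD[OF B])
        then show ?thesis unfolding phB by (simp add: power2_eq_square)
      qed
      then have "(\<Sum>(x, u)\<leftarrow>L'. B x u) = (\<Sum>(x, u)\<leftarrow>L. of_real ((cmod (B x u))\<^sup>2 / t))"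
        unfolding L'_def by (simp add: o_def split_def)
      also have "\<dots> = of_real (T / t)"
        unfolding T_def by (induction L) (auto simp: add_divide_distrib)
      finally show ?thesis .
    qed
    moreover have "T / t = t" using t by (metis nonzero_mult_div_cancel_left less_irrefl)
    moreover have "cmod (\<Sum>(x, u)\<leftarrow>L'. B x u) \<le> 3 * K"
    proof (rule bilinear_sum_bound[OF B K])
      fix \<omega> :: "'a \<Rightarrow> complex" assume \<omega>: "character \<omega>"
      have "(\<Sum>(x, u)\<leftarrow>L'. cmod (\<omega> x)) = (\<Sum>(x, u)\<leftarrow>L. cmod (ph x u) * cmod (\<omega> x))"
        unfolding L'_def by (simp add: o_def split_def characterD(8)[OF \<omega>] norm_mult)
      also have "\<dots> \<le> (\<Sum>(x, u)\<leftarrow>L. cmod (\<omega> x))"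
        by (rule sum_list_mono) (auto simp: ph1 mult_left_le_one_le)
      also have "\<dots> \<le> 1" by (rule x[OF \<omega>])
      finally show "(\<Sum>(x, u)\<leftarrow>L'. cmod (\<omega> x)) \<le> 1" .
      have "(\<Sum>(x, u)\<leftarrow>L'. (cmod (\<omega> u))\<^sup>2) = (\<Sum>(x, u)\<leftarrow>L. (cmod (B x u))\<^sup>2 / T * (cmod (\<omega> u))\<^sup>2)"
        unfolding L'_def t(2)[symmetric] using t(1)
        by (simp add: o_def split_def characterD(9)[OF \<omega>] norm_mult norm_divide power_mult_distrib power_divide power2_eq_square[of t])
      also have "\<dots> \<le> (\<Sum>(x, u)\<leftarrow>L. (cmod (B x u))\<^sup>2 / T)"
      proof (rule sum_list_mono)
        fix p assume p: "p \<in> set L"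
        obtain x u where xu: "p = (x, u)" by (cases p)
        have "cmod (\<omega> u) \<le> 1" using characterD(3)[OF \<omega>, of u] real[of x u] p xu by simp
        then have "(cmod (\<omega> u))\<^sup>2 \<le> 1" by (simp add: power_le_one)
        then have "(cmod (B x u))\<^sup>2 / T * (cmod (\<omega> u))\<^sup>2 \<le> (cmod (B x u))\<^sup>2 / T"
          by (rule mult_left_le) (use T0 in simp)
        then show "(case p of (x, u) \<Rightarrow> (cmod (B x u))\<^sup>2 / T * (cmod (\<omega> u))\<^sup>2) \<le> (case p of (x, u) \<Rightarrow> (cmod (B x u))\<^sup>2 / T)"
          by (simp only: xu case_prod_conv)
      qed
      also have "\<dots> = T / T" by (subst (2) T_def) (simp add: split_def sum_list_divide)
      also have "\<dots> = 1" using False by simp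
      finally show "(\<Sum>(x, u)\<leftarrow>L'. (cmod (\<omega> u))\<^sup>2) \<le> 1" .
    next
      fix x u assume "(x, u) \<in> set L'"
      then obtain x' u' where u': "(x', u') \<in> set L" "u = (cmod (B x' u') / t) *\<^sub>R u'" by (auto simp: L'_def)
      then show "adj u = u" using real[OF u'(1)] by (simp add: scaleR_scaleC adj_scaleC)
    qed
    ultimately have "t \<le> 3 * K" using t(1) by simp
    then have "t * t \<le> (3 * K) * (3 * K)" using t(1) by (intro mult_mono) auto
    then show ?thesis unfolding t(2) by (simp add: T_def power2_eq_square)
  qed
qed

text \<open>Real and imaginary parts of \<open>y\<close> each contribute at most
  \<open>9 * K\<^sup>2\<close>, and squaring their sum costs a factor 2 for each; hence 36.\<close>

lemma square_sum_bound:
  fixes B :: "'a::{cstar_algebra, comm_ring} \<Rightarrow> 'a \<Rightarrow> complex" and L :: "('a \<times> 'a) list"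
  assumes B: "bilinear_form B" and K: "0 \<le> K" "\<And>x y. cmod (B x y) \<le> K * norm x * norm y"
    and x: "\<And>\<omega>. character \<omega> \<Longrightarrow> (\<Sum>(x, y)\<leftarrow>L. cmod (\<omega> x)) \<le> 1"
    and y: "\<And>x y. (x, y) \<in> set L \<Longrightarrow> norm y \<le> 1"
  shows "(\<Sum>(x, y)\<leftarrow>L. (cmod (B x y))\<^sup>2) \<le> 36 * K\<^sup>2"
proof -
  define re where "re y = (1/2) *\<^sub>R (y + adj y)" for y :: 'a
  define im where "im y = (1/2) *\<^sub>R ((- \<i>) *\<^sub>C (y - adj y))" for y :: 'a
  have adj_diff: "adj (a - b) = adj a - adj b" for a b :: 'a
    using adj_add[of "a - b" b] by simp
  have re: "adj (re y) = re y" for y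
    by (simp add: re_def scaleR_scaleC adj_scaleC adj_add adj_adj add.commute)
  have im: "adj (im y) = im y" for y
  proof -
    have "\<i> *\<^sub>C (a - b) = (- \<i>) *\<^sub>C (b - a)" for a b :: 'a
      using scaleC_scaleC[of "- \<i>" "-1" "a - b"] by (simp add: scaleC_minus1)
    then show ?thesis by (simp add: im_def scaleR_scaleC adj_scaleC adj_diff adj_adj)
  qed
  have nre: "norm (re y) \<le> norm y" for y
    using norm_triangle_ineq[of y "adj y"] by (simp add: re_def)
  have nim: "norm (im y) \<le> norm y" for y
    using norm_triangle_ineq4[of y "adj y"] by (simp add: im_def norm_scaleC)
  have dec: "y = re y + \<i> *\<^sub>C im y" for y
  proof (rule gelfand_eqI)
    fix \<omega> :: "'a \<Rightarrow> complex" assume \<omega>: "character \<omega>"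
    show "\<omega> y = \<omega> (re y + \<i> *\<^sub>C im y)"
      by (simp add: re_def im_def characterD[OF \<omega>] algebra_simps)
  qed
  have part: "(\<Sum>(x, y)\<leftarrow>L. (cmod (B x (q y)))\<^sup>2) \<le> 9 * K\<^sup>2"
    if q: "\<And>y. adj (q y) = q y" "\<And>y. norm (q y) \<le> norm y" for q
  proof -
    have "(\<Sum>(x, u)\<leftarrow>map (\<lambda>(x, y). (x, q y)) L. (cmod (B x u))\<^sup>2) \<le> 9 * K\<^sup>2"
    proof (rule selfadjoint_square_sum_bound[OF B K])
      show "(\<Sum>(x, u)\<leftarrow>map (\<lambda>(x, y). (x, q y)) L. cmod (\<omega> x)) \<le> 1" if "character \<omega>" for \<omega>
        using x[OF that] by (simp add: o_def split_def)
      show "adj u = u \<and> norm u \<le> 1" if "(x, u) \<in> set (map (\<lambda>(x, y). (x, q y)) L)" for x u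
        using that y order_trans[OF q(2)] by (auto simp: q(1))
    qed
    then show ?thesis by (simp add: o_def split_def)
  qed
  have "(\<Sum>(x, y)\<leftarrow>L. (cmod (B x y))\<^sup>2) \<le> (\<Sum>(x, y)\<leftarrow>L. 2 * (cmod (B x (re y)))\<^sup>2 + 2 * (cmod (B x (im y)))\<^sup>2)"
  proof (rule sum_list_mono)
    fix p :: "'a \<times> 'a"
    obtain x y where p: "p = (x, y)" by (cases p)
    have "B x y = B x (re y) + \<i> * B x (im y)"
      by (subst dec[of y]) (simp only: bilinear_formD[OF B])
    then have "cmod (B x y) \<le> cmod (B x (re y)) + cmod (B x (im y))"
      using norm_triangle_ineq[of "B x (re y)" "\<i> * B x (im y)"] by (simp add: norm_mult)
    then have "(cmod (B x y))\<^sup>2 \<le> (cmod (B x (re y)) + cmod (B x (im y)))\<^sup>2" by (rule power_mono) simp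
    also have "\<dots> \<le> 2 * (cmod (B x (re y)))\<^sup>2 + 2 * (cmod (B x (im y)))\<^sup>2"
      using zero_le_power2[of "cmod (B x (re y)) - cmod (B x (im y))"] unfolding power2_sum power2_diff by linarith
    finally show "(case p of (x, y) \<Rightarrow> (cmod (B x y))\<^sup>2) \<le> (case p of (x, y) \<Rightarrow> 2 * (cmod (B x (re y)))\<^sup>2 + 2 * (cmod (B x (im y)))\<^sup>2)"
      by (simp add: p)
  qed
  also have "\<dots> = 2 * (\<Sum>(x, y)\<leftarrow>L. (cmod (B x (re y)))\<^sup>2) + 2 * (\<Sum>(x, y)\<leftarrow>L. (cmod (B x (im y)))\<^sup>2)"
    by (induction L) auto
  also have "\<dots> \<le> 2 * (9 * K\<^sup>2) + 2 * (9 * K\<^sup>2)"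
    by (intro add_mono mult_left_mono part re im nre nim) auto
  finally show ?thesis by simp
qed

text \<open>Pisier's argument for \<open>(2,1)\<close>-summing operators: \<open>f\<close> is a limit of the functionals
  \<open>a \<mapsto> \<Sum> cnj (B x\<^sub>i y\<^sub>i) B (a x\<^sub>i) y\<^sub>i\<close> over families \<open>(x\<^sub>i, y\<^sub>i)\<close> that nearly attain the best constant.\<close>

lemma bilinear_domination:
  fixes B :: "'a::{cstar_algebra, comm_ring} \<Rightarrow> 'a \<Rightarrow> complex"
  assumes B: "bilinear_form B" and K: "0 \<le> K" "\<And>x y. cmod (B x y) \<le> K * norm x * norm y"
  obtains f where "positive_functional f"
    "\<And>x y. norm x \<le> 1 \<Longrightarrow> norm y \<le> 1 \<Longrightarrow> (cmod (B x y))\<^sup>2 \<le> 2 * Re (f (vabs x))"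
proof -
  note D = bilinear_formD[OF B]
  \<comment> \<open>The condition at the characters bounds the weak l1 norm of the first components,
    so the supremum \<open>C\<close> of \<open>V\<close> is the square of the (2,1)-summing constant
    of \<open>B\<close>, finite by \<open>square_sum_bound\<close>.\<close>
  define adm :: "('a \<times> 'a) list \<Rightarrow> bool" where
    "adm L \<longleftrightarrow> (\<forall>\<omega>. character \<omega> \<longrightarrow> (\<Sum>p\<leftarrow>L. cmod (\<omega> (fst p))) \<le> 1) \<and> (\<forall>p\<in>set L. norm (snd p) \<le> 1)" for L
  define V where "V L = (\<Sum>p\<leftarrow>L. (cmod (B (fst p) (snd p)))\<^sup>2)" for L
  define C where "C = Sup (V ` Collect adm)"
  have bd: "V L \<le> 36 * K\<^sup>2" if "adm L" for L
    using square_sum_bound[OF B K, of L] that by (fastforce simp: adm_def V_def split_def)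
  have bdd: "bdd_above (V ` Collect adm)"
    by (rule bdd_aboveI[of _ "36 * K\<^sup>2"]) (use bd in auto)
  have VC: "V L \<le> C" if "adm L" for L
    unfolding C_def by (rule cSup_upper[OF _ bdd]) (use that in simp)
  have adm0: "adm []" by (simp add: adm_def)
  have C0: "0 \<le> C" using VC[OF adm0] by (simp add: V_def)
  have V0: "0 \<le> V L" for L unfolding V_def by (rule sum_list_nonneg) auto
  have single: "adm [(x, y)]" if "norm x \<le> 1" "norm y \<le> 1" for x y
    using that order_trans[OF characterD(3)] by (auto simp: adm_def)
  show thesis
  proof (cases "C = 0")
    case True
    show thesis
    proof (rule that[of "\<lambda>_. 0"])
      show "positive_functional (\<lambda>_::'a. 0)" by (rule positive_functionalI) (simp_all add: clinear_def)
      fix x y :: 'a assume "norm x \<le> 1" "norm y \<le> 1"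
      from VC[OF single[OF this]] show "(cmod (B x y))\<^sup>2 \<le> 2 * Re 0" using True by (simp add: V_def)
    qed
  next
    case False
    with C0 have C: "0 < C" by simp
    have "\<exists>L. adm L \<and> C - 1 / real (Suc k) < V L" for k
    proof -
      have "C - 1 / real (Suc k) < Sup (V ` Collect adm)" by (simp add: C_def)
      then show ?thesis using less_cSupD[of "V ` Collect adm"] adm0 by auto
    qed
    then obtain L where L: "\<And>k. adm (L k)" "\<And>k. C - 1 / real (Suc k) < V (L k)" by metis
    define lam where "lam k a = (\<Sum>p\<leftarrow>L k. cnj (B (fst p) (snd p)) * B (a * fst p) (snd p))" for k a
    have CS: "(cmod (\<Sum>p\<leftarrow>l. cnj (B (fst p) (snd p)) * B (T (fst p)) (snd p)))\<^sup>2
        \<le> V l * (\<Sum>p\<leftarrow>l. (cmod (B (T (fst p)) (snd p)))\<^sup>2)" for l and T :: "'a \<Rightarrow> 'a"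
    proof -
      let ?a = "\<lambda>i. cmod (B (fst (l ! i)) (snd (l ! i)))"
      let ?b = "\<lambda>i. cmod (B (T (fst (l ! i))) (snd (l ! i)))"
      have "(\<Sum>p\<leftarrow>l. cnj (B (fst p) (snd p)) * B (T (fst p)) (snd p))
          = (\<Sum>i<length l. cnj (B (fst (l ! i)) (snd (l ! i))) * B (T (fst (l ! i))) (snd (l ! i)))"
        by (simp add: sum_list_sum_nth atLeast0LessThan)
      then have "cmod (\<Sum>p\<leftarrow>l. cnj (B (fst p) (snd p)) * B (T (fst p)) (snd p)) \<le> (\<Sum>i<length l. ?a i * ?b i)"
        by (simp only:) (rule order_trans[OF norm_sum], simp add: norm_mult)
      then have "(cmod (\<Sum>p\<leftarrow>l. cnj (B (fst p) (snd p)) * B (T (fst p)) (snd p)))\<^sup>2 \<le> (\<Sum>i<length l. ?a i * ?b i)\<^sup>2"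
        by (rule power_mono) simp
      also have "\<dots> \<le> (\<Sum>i<length l. (?a i)\<^sup>2) * (\<Sum>i<length l. (?b i)\<^sup>2)" by (rule Cauchy_Schwarz_ineq_sum)
      finally show ?thesis by (simp add: V_def sum_list_sum_nth atLeast0LessThan)
    qed
    \<comment> \<open>\<open>s\<close> together with \<open>a\<close> acts as an element of the
      unitisation. Multiplying the family by it and dividing by \<open>r\<close> preserves
      admissibility, so the new square sum is at most \<open>C * r\<^sup>2\<close>; Cauchy-Schwarz
      against \<open>V (L k)\<close> finishes.\<close>
    have E1: "cmod (of_real (s * V (L k)) + lam k a) \<le> C * r"
      if r: "0 < r" "\<And>\<omega>. character \<omega> \<Longrightarrow> cmod (of_real s + \<omega> a) \<le> r" for s a r k
    proof -
      define T where "T x = s *\<^sub>R x + a * x" for x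
      have eq: "of_real (s * V (L k)) + lam k a = (\<Sum>p\<leftarrow>L k. cnj (B (fst p) (snd p)) * B (T (fst p)) (snd p))"
      proof -
        have "cnj (B x y) * B (T x) y = of_real (s * (cmod (B x y))\<^sup>2) + cnj (B x y) * B (a * x) y" for x y
          unfolding of_real_mult complex_norm_square by (simp add: T_def D scaleR_scaleC algebra_simps)
        then have "(\<Sum>p\<leftarrow>l. cnj (B (fst p) (snd p)) * B (T (fst p)) (snd p))
          = of_real (s * V l) + (\<Sum>p\<leftarrow>l. cnj (B (fst p) (snd p)) * B (a * fst p) (snd p))" for l
          by (induction l) (auto simp: V_def distrib_left)
        then show ?thesis unfolding lam_def by simp
      qed
      have "adm (map (\<lambda>p. ((1 / r) *\<^sub>R T (fst p), snd p)) (L k))"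
        unfolding adm_def
      proof (intro conjI allI impI)
        fix \<omega> :: "'a \<Rightarrow> complex" assume \<omega>: "character \<omega>"
        have "cmod (\<omega> ((1 / r) *\<^sub>R T x)) \<le> cmod (\<omega> x)" for x
        proof -
          have "\<omega> ((1 / r) *\<^sub>R T x) = of_real (1 / r) * ((of_real s + \<omega> a) * \<omega> x)"
            by (simp add: T_def characterD[OF \<omega>] algebra_simps)
          then have "cmod (\<omega> ((1 / r) *\<^sub>R T x)) = cmod (of_real s + \<omega> a) / r * cmod (\<omega> x)"
            using r(1) by (simp add: norm_mult norm_divide)
          also have "\<dots> \<le> 1 * cmod (\<omega> x)" using r(1) r(2)[OF \<omega>] by (intro mult_right_mono) auto
          finally show ?thesis by simp
        qed
        then have "(\<Sum>p\<leftarrow>L k. cmod (\<omega> ((1 / r) *\<^sub>R T (fst p)))) \<le> (\<Sum>p\<leftarrow>L k. cmod (\<omega> (fst p)))"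
          by (intro sum_list_mono)
        also have "\<dots> \<le> 1" using L(1)[of k] \<omega> by (simp add: adm_def)
        finally show "(\<Sum>p\<leftarrow>map (\<lambda>p. ((1 / r) *\<^sub>R T (fst p), snd p)) (L k). cmod (\<omega> (fst p))) \<le> 1"
          by (simp add: o_def)
      qed (use L(1)[of k] in \<open>auto simp: adm_def\<close>)
      from VC[OF this] have "(\<Sum>p\<leftarrow>L k. (cmod (B (T (fst p)) (snd p)))\<^sup>2 / r\<^sup>2) \<le> C"
        using r(1) by (simp add: V_def o_def scaleR_scaleC D norm_divide power_divide)
      then have "(\<Sum>p\<leftarrow>L k. (cmod (B (T (fst p)) (snd p)))\<^sup>2) \<le> C * r\<^sup>2"
        using r(1) by (simp add: sum_list_divide pos_divide_le_eq)
      then have "V (L k) * (\<Sum>p\<leftarrow>L k. (cmod (B (T (fst p)) (snd p)))\<^sup>2) \<le> C * (C * r\<^sup>2)"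
        using VC[OF L(1)] V0 C by (intro mult_mono) (auto intro!: sum_list_nonneg)
      with CS[where l = "L k" and T = T] have "(cmod (of_real (s * V (L k)) + lam k a))\<^sup>2 \<le> (C * r)\<^sup>2"
        unfolding eq by (simp add: power2_eq_square ac_simps)
      then show ?thesis using C r(1) by (simp add: power2_le_iff_abs_le)
    qed
    have bdlam: "cmod (lam k a) \<le> C * norm a" for k a
    proof (cases "a = 0")
      case True
      then show ?thesis by (simp add: lam_def D)
    next
      case False
      have "cmod (of_real (0 * V (L k)) + lam k a) \<le> C * norm a"
        by (rule E1) (use False in \<open>simp_all add: characterD(3)\<close>)
      then show ?thesis by simp
    qed
    obtain F f where F: "F \<noteq> bot" "F \<le> sequentially" and f: "\<And>a. ((\<lambda>k. lam k a) \<longlongrightarrow> f a) F"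
      by (rule pointwise_bounded_cluster[of lam "\<lambda>a. C * norm a", OF bdlam]) (rule that)
    have "(\<lambda>k. C - 1 / real (Suc k)) \<longlonglongrightarrow> C - 0"
      by (intro tendsto_intros LIMSEQ_Suc[OF lim_1_over_n])
    then have l: "(\<lambda>k. C - 1 / real (Suc k)) \<longlonglongrightarrow> C" by simp
    have "(\<lambda>k. V (L k)) \<longlonglongrightarrow> C"
    proof (rule tendsto_sandwich[OF _ _ l tendsto_const])
      show "eventually (\<lambda>k. C - 1 / real (Suc k) \<le> V (L k)) sequentially"
        by (intro always_eventually allI less_imp_le L(2))
      show "eventually (\<lambda>k. V (L k) \<le> C) sequentially"
        by (intro always_eventually allI VC L(1))
    qed
    then have VF: "((\<lambda>k. V (L k)) \<longlongrightarrow> C) F" using F(2) by (rule tendsto_mono[rotated])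
    have lin: "clinear f"
      unfolding clinear_def scaleC_complex_def
    proof (intro conjI allI)
      fix a b :: 'a and c :: complex
      have "lam k (a + b) = lam k a + lam k b" for k
        unfolding lam_def by (induction "L k") (auto simp: distrib_right distrib_left D sum_list_addf)
      then have "((\<lambda>k. lam k (a + b)) \<longlongrightarrow> f a + f b) F" using tendsto_add[OF f f] by simp
      then show "f (a + b) = f a + f b" by (rule tendsto_unique[OF F(1) f])
      have "lam k (c *\<^sub>C a) = c * lam k a" for k
        unfolding lam_def mult_scaleC_left D(3) sum_list_const_mult[symmetric] by (simp only: mult.left_commute)
      then have "((\<lambda>k. lam k (c *\<^sub>C a)) \<longlongrightarrow> c * f a) F" using tendsto_mult_left[OF f] by simp
      then show "f (c *\<^sub>C a) = c * f a" by (rule tendsto_unique[OF F(1) f])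
    qed
    \<comment> \<open>In the limit, \<open>f\<close> extended by the value \<open>C\<close> at a
      formal unit has norm at most \<open>C\<close>. A functional attaining its norm at the unit is
      positive; the rest verifies this without forming the unitisation.\<close>
    have E1': "cmod (of_real (s * C) + f a) \<le> C * r"
      if r: "0 < r" "\<And>\<omega>. character \<omega> \<Longrightarrow> cmod (of_real s + \<omega> a) \<le> r" for s a r
    proof (rule tendsto_upperbound[OF _ _ F(1)])
      show "((\<lambda>k. cmod (of_real (s * V (L k)) + lam k a)) \<longlongrightarrow> cmod (of_real (s * C) + f a)) F"
        by (intro tendsto_intros VF f)
    qed (intro always_eventually allI E1 r)
    have "positive_functional f"
    proof (rule positive_functionalI[OF lin])
      fix a :: 'a assume a: "pos a"
      show "Im (f a) = 0 \<and> 0 \<le> Re (f a)"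
      proof (cases "a = 0")
        case True
        then show ?thesis by (simp add: clinearD(3)[OF lin])
      next
        case False
        define n where "n = norm a"
        have n: "0 < n" using False by (simp add: n_def)
        have an: "Re (\<omega> a) \<le> n" if "character \<omega>" for \<omega>
          using characterD(3)[OF that, of a] posD(3)[OF a that] by (simp add: n_def)
        have "cmod (of_real (1 * C) + f ((- 1 / n) *\<^sub>R a)) \<le> C * 1"
        proof (rule E1')
          fix \<omega> :: "'a \<Rightarrow> complex" assume \<omega>: "character \<omega>"
          have "of_real 1 + \<omega> ((- 1 / n) *\<^sub>R a) = of_real (1 - Re (\<omega> a) / n)"
            using posD(4)[OF a \<omega>] by (simp add: characterD(6,9)[OF \<omega>] complex_eq_iff)
          moreover have "\<bar>1 - Re (\<omega> a) / n\<bar> \<le> 1" using an[OF \<omega>] posD(2)[OF a \<omega>] n by (simp add: abs_le_iff)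
          ultimately show "cmod (of_real 1 + \<omega> ((- 1 / n) *\<^sub>R a)) \<le> 1" by (simp only: norm_of_real)
        qed simp
        then have "Re (of_real C + f ((- 1 / n) *\<^sub>R a)) \<le> C"
          using complex_Re_le_cmod order_trans by fastforce
        then have re: "0 \<le> Re (f a)" using n by (simp add: clinearD(4,6)[OF lin] field_simps)
        have im: "Im (f a) = 0"
        proof (rule ccontr)
          assume I: "Im (f a) \<noteq> 0"
          \<comment> \<open>With this \<open>t\<close> the cross term on the left is twice
            \<open>(Im (f a))\<^sup>2 / n\<^sup>2\<close>, while the right side grows by this amount
            only once.\<close>
          define t where "t = - Im (f a) / (C * n\<^sup>2)"
          have "cmod (of_real (1 * C) + f ((\<i> * of_real t) *\<^sub>C a)) \<le> C * sqrt (1 + t\<^sup>2 * n\<^sup>2)"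
          proof (rule E1')
            show "0 < sqrt (1 + t\<^sup>2 * n\<^sup>2)" by (simp add: add_pos_nonneg)
            fix \<omega> :: "'a \<Rightarrow> complex" assume \<omega>: "character \<omega>"
            have "(Re (\<omega> a))\<^sup>2 \<le> n\<^sup>2" using an[OF \<omega>] posD(2)[OF a \<omega>] by (intro power_mono) auto
            then have "1 + t\<^sup>2 * (Re (\<omega> a))\<^sup>2 \<le> 1 + t\<^sup>2 * n\<^sup>2" by (simp add: mult_left_mono)
            moreover have "cmod (of_real 1 + \<omega> ((\<i> * of_real t) *\<^sub>C a)) = sqrt (1 + t\<^sup>2 * (Re (\<omega> a))\<^sup>2)"
              using posD(4)[OF a \<omega>] by (simp add: characterD(8)[OF \<omega>] cmod_def power_mult_distrib)
            ultimately show "cmod (of_real 1 + \<omega> ((\<i> * of_real t) *\<^sub>C a)) \<le> sqrt (1 + t\<^sup>2 * n\<^sup>2)" by simp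
          qed
          then have "(cmod (of_real C + \<i> * of_real t * f a))\<^sup>2 \<le> (C * sqrt (1 + t\<^sup>2 * n\<^sup>2))\<^sup>2"
            by (intro power_mono) (simp_all add: clinear_complexD[OF lin])
          then have "(C - t * Im (f a))\<^sup>2 + (t * Re (f a))\<^sup>2 \<le> C\<^sup>2 * (1 + t\<^sup>2 * n\<^sup>2)"
            by (simp add: cmod_power2 power_mult_distrib add_nonneg_nonneg)
          then have "(C - t * Im (f a))\<^sup>2 \<le> C\<^sup>2 * (1 + t\<^sup>2 * n\<^sup>2)"
            using zero_le_power2[of "t * Re (f a)"] by linarith
          moreover have "C - t * Im (f a) = C + (Im (f a))\<^sup>2 / (C * n\<^sup>2)" by (simp add: t_def power2_eq_square)
          moreover have "C\<^sup>2 * (1 + t\<^sup>2 * n\<^sup>2) = C\<^sup>2 + (Im (f a))\<^sup>2 / n\<^sup>2"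
            using C n by (simp add: t_def power_divide power_mult_distrib power2_eq_square distrib_left)
          ultimately have "(C + (Im (f a))\<^sup>2 / (C * n\<^sup>2))\<^sup>2 \<le> C\<^sup>2 + (Im (f a))\<^sup>2 / n\<^sup>2" by (simp only:)
          moreover have "(C + (Im (f a))\<^sup>2 / (C * n\<^sup>2))\<^sup>2 = C\<^sup>2 + 2 * ((Im (f a))\<^sup>2 / n\<^sup>2) + ((Im (f a))\<^sup>2 / (C * n\<^sup>2))\<^sup>2"
            using C by (simp add: power2_sum)
          moreover have "0 < (Im (f a))\<^sup>2 / n\<^sup>2" using I n by simp
          ultimately show False using zero_le_power2[of "(Im (f a))\<^sup>2 / (C * n\<^sup>2)"] by linarith
        qed
        show ?thesis using re im by simp
      qed
    qed
    moreover have "(cmod (B x y))\<^sup>2 \<le> 2 * Re (f (vabs x))" if x: "norm x \<le> 1" and y: "norm y \<le> 1" for x y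
    proof -
      \<comment> \<open>Multiplying the near-optimal family by 1 - |x| leaves exactly enough room to
        adjoin \<open>(x, y)\<close>. The shrunken family then has square sum at most
        \<open>C\<close> minus \<open>|B x y|\<^sup>2\<close>, and Cauchy-Schwarz gives
        \<open>k\<close>; the 2 in the conclusion is the cross term of its square.\<close>
      define T where "T z = z - vabs x * z" for z
      have x1: "cmod (\<omega> x) \<le> 1" if "character \<omega>" for \<omega> using order_trans[OF characterD(3)[OF that] x] .
      have k: "(cmod (of_real (V (L k)) - lam k (vabs x)))\<^sup>2 \<le> C * (C - (cmod (B x y))\<^sup>2)" for k
      proof -
        have eq: "of_real (V (L k)) - lam k (vabs x) = (\<Sum>p\<leftarrow>L k. cnj (B (fst p) (snd p)) * B (T (fst p)) (snd p))"
        proof -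
          have BT: "B (T z) y = B z y - B (vabs x * z) y" for z y
            using D(1)[of "T z" "vabs x * z" y] by (simp add: T_def)
          have "cnj (B z y) * B (T z) y = of_real ((cmod (B z y))\<^sup>2) - cnj (B z y) * B (vabs x * z) y" for z y
            unfolding complex_norm_square BT by (simp only: right_diff_distrib mult.commute)
          then have "(\<Sum>p\<leftarrow>l. cnj (B (fst p) (snd p)) * B (T (fst p)) (snd p))
            = of_real (V l) - (\<Sum>p\<leftarrow>l. cnj (B (fst p) (snd p)) * B (vabs x * fst p) (snd p))" for l
            by (induction l) (auto simp: V_def)
          then show ?thesis unfolding lam_def by simp
        qed
        have "adm ((x, y) # map (\<lambda>p. (T (fst p), snd p)) (L k))"
          unfolding adm_def
        proof (intro conjI allI impI)
          fix \<omega> :: "'a \<Rightarrow> complex" assume \<omega>: "character \<omega>"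
          have "cmod (\<omega> (T z)) = (1 - cmod (\<omega> x)) * cmod (\<omega> z)" for z
          proof -
            have "\<omega> (T z) = of_real (1 - cmod (\<omega> x)) * \<omega> z"
              by (simp add: T_def characterD[OF \<omega>] \<omega> algebra_simps)
            then show ?thesis using x1[OF \<omega>] by (simp only: norm_mult norm_of_real)
          qed
          then have "(\<Sum>p\<leftarrow>L k. cmod (\<omega> (T (fst p)))) = (1 - cmod (\<omega> x)) * (\<Sum>p\<leftarrow>L k. cmod (\<omega> (fst p)))"
            by (simp add: sum_list_const_mult)
          also have "\<dots> \<le> (1 - cmod (\<omega> x)) * 1"
            using L(1)[of k] \<omega> x1[OF \<omega>] by (intro mult_left_mono) (auto simp: adm_def)
          finally show "(\<Sum>p\<leftarrow>(x, y) # map (\<lambda>p. (T (fst p), snd p)) (L k). cmod (\<omega> (fst p))) \<le> 1"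
            by (simp add: o_def)
        qed (use L(1)[of k] y in \<open>auto simp: adm_def\<close>)
        from VC[OF this] have "(\<Sum>p\<leftarrow>L k. (cmod (B (T (fst p)) (snd p)))\<^sup>2) \<le> C - (cmod (B x y))\<^sup>2"
          by (simp add: V_def o_def)
        then have "V (L k) * (\<Sum>p\<leftarrow>L k. (cmod (B (T (fst p)) (snd p)))\<^sup>2) \<le> C * (C - (cmod (B x y))\<^sup>2)"
          using VC[OF L(1)] V0 C by (intro mult_mono) (auto intro!: sum_list_nonneg)
        then show ?thesis using CS[where l = "L k" and T = T] unfolding eq by linarith
      qed
      have "(cmod (of_real C - f (vabs x)))\<^sup>2 \<le> C * (C - (cmod (B x y))\<^sup>2)"
      proof (rule tendsto_upperbound[OF _ _ F(1)])
        show "((\<lambda>k. (cmod (of_real (V (L k)) - lam k (vabs x)))\<^sup>2) \<longlongrightarrow> (cmod (of_real C - f (vabs x)))\<^sup>2) F"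
          by (intro tendsto_intros VF f)
      qed (intro always_eventually allI k)
      then have "C\<^sup>2 - 2 * C * Re (f (vabs x)) + (Re (f (vabs x)))\<^sup>2 + (Im (f (vabs x)))\<^sup>2 \<le> C\<^sup>2 - C * (cmod (B x y))\<^sup>2"
        by (simp add: cmod_power2 power2_diff power2_eq_square[of C] algebra_simps)
      then have "C * (cmod (B x y))\<^sup>2 \<le> C * (2 * Re (f (vabs x)))"
      proof -
        have "C * (2 * Re (f (vabs x))) = 2 * C * Re (f (vabs x))" by simp
        moreover note \<open>C\<^sup>2 - 2 * C * Re (f (vabs x)) + (Re (f (vabs x)))\<^sup>2 + (Im (f (vabs x)))\<^sup>2 \<le> C\<^sup>2 - C * (cmod (B x y))\<^sup>2\<close>
          zero_le_power2[of "Re (f (vabs x))"] zero_le_power2[of "Im (f (vabs x))"]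
        ultimately show ?thesis by linarith
      qed
      then show ?thesis using C by simp
    qed
    ultimately show thesis by (rule that)
  qed
qed

section \<open>Scatteredness forces Arens regularity\<close>

lemma characters_separated:
  fixes \<omega> :: "'a::{cstar_algebra, comm_ring} \<Rightarrow> complex"
  assumes "finite G" and \<omega>: "character \<omega>" and "\<And>\<theta>. \<theta> \<in> G \<Longrightarrow> character \<theta>" and "\<omega> \<notin> G"
  shows "\<exists>z. \<omega> z = 1 \<and> (\<forall>\<theta>\<in>G. \<theta> z = 0)"
  using assms(1,3,4)
proof (induction G)
  case empty
  obtain e where "\<omega> e = 1" by (rule character_bump[OF \<omega>])
  then show ?case by auto
next
  case (insert \<theta> G)
  then obtain z where z: "\<omega> z = 1" "\<forall>\<theta>\<in>G. \<theta> z = 0" by auto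
  have \<theta>: "character \<theta>" using insert.prems by simp
  have "\<omega> \<noteq> \<theta>" using insert.prems by blast
  then obtain x where x: "\<omega> x \<noteq> \<theta> x" by (auto simp: fun_eq_iff)
  define y where "y = (1 / (\<omega> x - \<theta> x)) *\<^sub>C (x * z - \<theta> x *\<^sub>C z)"
  have "\<omega> y = 1" using x z(1) by (simp add: y_def characterD[OF \<omega>])
  moreover have "\<theta> y = 0" by (simp add: y_def characterD[OF \<theta>])
  moreover have "\<theta>' y = 0" if "\<theta>' \<in> G" for \<theta>'
    using characterD[OF insert.prems(1)[of \<theta>']] that z(2) by (simp add: y_def)
  ultimately show ?case by (intro exI[of _ y]) auto
qed

text \<open>\<open>e \<omega>\<close> is nonzero only where the modulus of \<open>z \<omega>\<close>
  exceeds the sum of the moduli of the other \<open>z \<theta>\<close>. Two different bumps would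
  require opposite strict inequalities at a common character.\<close>

lemma disjoint_bumps:
  fixes G :: "('a::{cstar_algebra, comm_ring} \<Rightarrow> complex) set"
  assumes fin: "finite G" and ch: "\<And>\<omega>. \<omega> \<in> G \<Longrightarrow> character \<omega>"
  obtains e where "\<And>\<omega>. \<omega> \<in> G \<Longrightarrow> \<omega> (e \<omega>) = 1"
    "\<And>\<omega> \<eta>. character \<eta> \<Longrightarrow> cmod (\<eta> (e \<omega>)) \<le> 1"
    "\<And>\<omega> \<theta> \<eta>. \<omega> \<in> G \<Longrightarrow> \<theta> \<in> G \<Longrightarrow> \<omega> \<noteq> \<theta> \<Longrightarrow> character \<eta> \<Longrightarrow> \<eta> (e \<omega>) = 0 \<or> \<eta> (e \<theta>) = 0"
proof -
  have "\<exists>z. \<omega> z = 1 \<and> (\<forall>\<theta>\<in>G - {\<omega>}. \<theta> z = 0)" if "\<omega> \<in> G" for \<omega>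
    by (rule characters_separated) (use fin ch that in auto)
  then obtain z where z: "\<And>\<omega>. \<omega> \<in> G \<Longrightarrow> \<omega> (z \<omega>) = 1"
    "\<And>\<omega> \<theta>. \<omega> \<in> G \<Longrightarrow> \<theta> \<in> G - {\<omega>} \<Longrightarrow> \<theta> (z \<omega>) = 0" by metis
  define q where "q s = min (max s 0) 1" for s :: real
  have q: "continuous_on UNIV q" "q 0 = 0" unfolding q_def by (auto intro!: continuous_intros)
  define y where "y \<omega> = vabs (z \<omega>) - (\<Sum>\<theta>\<in>G - {\<omega>}. vabs (z \<theta>))" for \<omega>
  have y: "Re (\<eta> (y \<omega>)) = cmod (\<eta> (z \<omega>)) - (\<Sum>\<theta>\<in>G - {\<omega>}. cmod (\<eta> (z \<theta>)))" if "character \<eta>" for \<eta> \<omega>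
    by (simp add: y_def characterD(5,10)[OF that] that)
  define e where "e \<omega> = fcalc q (y \<omega>)" for \<omega>
  have e: "\<eta> (e \<omega>) = of_real (q (Re (\<eta> (y \<omega>))))" if "character \<eta>" for \<eta> \<omega>
    unfolding e_def by (rule fcalc[OF that q])
  show thesis
  proof
    fix \<omega> assume \<omega>: "\<omega> \<in> G"
    have "(\<Sum>\<theta>\<in>G - {\<omega>}. cmod (\<omega> (z \<theta>))) = 0"
      by (rule sum.neutral) (use z(2) \<omega> in auto)
    then show "\<omega> (e \<omega>) = 1" by (simp add: e[OF ch[OF \<omega>]] y[OF ch[OF \<omega>]] z(1)[OF \<omega>] q_def)
  next
    fix \<omega> \<eta> :: "'a \<Rightarrow> complex" assume "character \<eta>"
    then show "cmod (\<eta> (e \<omega>)) \<le> 1" by (simp add: e q_def)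
  next
    fix \<omega> \<theta> \<eta> :: "'a \<Rightarrow> complex"
    assume G: "\<omega> \<in> G" "\<theta> \<in> G" "\<omega> \<noteq> \<theta>" and \<eta>: "character \<eta>"
    have le: "cmod (\<eta> (z \<beta>)) < cmod (\<eta> (z \<alpha>))" if "\<alpha> \<in> G" "\<beta> \<in> G" "\<alpha> \<noteq> \<beta>" "\<eta> (e \<alpha>) \<noteq> 0" for \<alpha> \<beta>
    proof -
      have "0 < Re (\<eta> (y \<alpha>))" using that(4) by (auto simp: e[OF \<eta>] q_def min_def max_def split: if_splits)
      moreover have "cmod (\<eta> (z \<beta>)) \<le> (\<Sum>\<theta>\<in>G - {\<alpha>}. cmod (\<eta> (z \<theta>)))"
        by (rule member_le_sum) (use that fin in auto)
      ultimately show ?thesis using y[OF \<eta>, of \<alpha>] by linarith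
    qed
    show "\<eta> (e \<omega>) = 0 \<or> \<eta> (e \<theta>) = 0"
      using le[of \<omega> \<theta>] le[of \<theta> \<omega>] G by force
  qed
qed

text \<open>At each character at most one bump is nonzero, so the interpolation is contractive no
  matter how many characters \<open>G\<close> has.\<close>

lemma interpolating_projection:
  fixes G :: "('a::{cstar_algebra, comm_ring} \<Rightarrow> complex) set"
  assumes fin: "finite G" and ch: "\<And>\<omega>. \<omega> \<in> G \<Longrightarrow> character \<omega>"
  obtains e where "\<And>x \<omega>. \<omega> \<in> G \<Longrightarrow> \<omega> (x - (\<Sum>\<theta>\<in>G. \<theta> x *\<^sub>C e \<theta>)) = 0"
    "\<And>x. norm (\<Sum>\<theta>\<in>G. \<theta> x *\<^sub>C e \<theta>) \<le> norm x"
proof -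
  obtain e where e: "\<And>\<omega>. \<omega> \<in> G \<Longrightarrow> \<omega> (e \<omega>) = 1"
    "\<And>\<omega> \<eta>. character \<eta> \<Longrightarrow> cmod (\<eta> (e \<omega>)) \<le> 1"
    "\<And>\<omega> \<theta> \<eta>. \<omega> \<in> G \<Longrightarrow> \<theta> \<in> G \<Longrightarrow> \<omega> \<noteq> \<theta> \<Longrightarrow> character \<eta> \<Longrightarrow> \<eta> (e \<omega>) = 0 \<or> \<eta> (e \<theta>) = 0"
    by (rule disjoint_bumps[OF fin ch]) (assumption, rule that)
  have single: "\<eta> (\<Sum>\<theta>\<in>G. \<theta> x *\<^sub>C e \<theta>) = \<omega> x * \<eta> (e \<omega>)"
    if \<eta>: "character \<eta>" and \<omega>: "\<omega> \<in> G" "\<eta> (e \<omega>) \<noteq> 0" for \<eta> \<omega> x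
  proof -
    have "(\<Sum>\<theta>\<in>G - {\<omega>}. \<theta> x * \<eta> (e \<theta>)) = 0"
      by (rule sum.neutral) (use e(3)[OF \<omega>(1) _ _ \<eta>] \<omega> in auto)
    moreover have "\<eta> (\<Sum>\<theta>\<in>G. \<theta> x *\<^sub>C e \<theta>) = (\<Sum>\<theta>\<in>G. \<theta> x * \<eta> (e \<theta>))"
      by (simp add: characterD(8,10)[OF \<eta>])
    ultimately show ?thesis by (simp add: sum.remove[OF fin \<omega>(1)])
  qed
  show thesis
  proof
    fix x \<omega> assume \<omega>: "\<omega> \<in> G"
    show "\<omega> (x - (\<Sum>\<theta>\<in>G. \<theta> x *\<^sub>C e \<theta>)) = 0"
      using single[OF ch[OF \<omega>] \<omega>] e(1)[OF \<omega>] by (simp add: characterD(5)[OF ch[OF \<omega>]])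
  next
    fix x
    show "norm (\<Sum>\<theta>\<in>G. \<theta> x *\<^sub>C e \<theta>) \<le> norm x"
    proof (rule gelfand_norm_le)
      fix \<eta> :: "'a \<Rightarrow> complex" assume \<eta>: "character \<eta>"
      show "cmod (\<eta> (\<Sum>\<theta>\<in>G. \<theta> x *\<^sub>C e \<theta>)) \<le> norm x"
      proof (cases "\<exists>\<omega>\<in>G. \<eta> (e \<omega>) \<noteq> 0")
        case True
        then obtain \<omega> where \<omega>: "\<omega> \<in> G" "\<eta> (e \<omega>) \<noteq> 0" by blast
        have "cmod (\<omega> x) * cmod (\<eta> (e \<omega>)) \<le> norm x * 1"
          by (intro mult_mono characterD(3)[OF ch[OF \<omega>(1)]] e(2)[OF \<eta>]) auto
        then show ?thesis by (simp add: single[OF \<eta> \<omega>] norm_mult)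
      next
        case False
        then show ?thesis by (simp add: characterD(8,10)[OF \<eta>])
      qed
    qed simp
  qed
qed

text \<open>Both sides are bilinear and continuous in \<open>u\<close> and \<open>v\<close>, so
  elementary tensors, where \<open>tensor_mult\<close> applies, decide.\<close>

lemma character_tensor_multiplicative:
  fixes h :: "('a::complex_normed_algebra, 'b::complex_normed_algebra) proj_tensor dual"
  assumes \<omega>: "character \<omega>" and \<theta>: "character \<theta>"
    and h: "\<And>x y. dual_apply h (proj_embed (x \<otimes> y)) = \<omega> x * \<theta> y"
  shows "dual_apply h (u * v) = dual_apply h u * dual_apply h v"
proof -
  have z: "proj_embed 0 = (0 :: ('a, 'b) proj_tensor)"
    using proj_embed_scaleC[of 0 "0 :: ('a, 'b) alg_tensor"] by simp
  note L = clinearD[OF clinear_dual_apply]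
  have 1: "dual_apply h (proj_embed ((x \<otimes> y) * (\<Sum>(x, y)\<leftarrow>ys. x \<otimes> y)))
      = dual_apply h (proj_embed (x \<otimes> y)) * dual_apply h (proj_embed (\<Sum>(x, y)\<leftarrow>ys. x \<otimes> y))" for x y ys
  proof (induction ys)
    case (Cons p ys)
    obtain a b where "p = (a, b)" by (cases p)
    then show ?case
      using Cons by (simp add: distrib_left tensor_mult proj_embed_add h characterD(2)[OF \<omega>] characterD(2)[OF \<theta>])
  qed (simp add: z L)
  have 2: "dual_apply h (proj_embed ((\<Sum>(x, y)\<leftarrow>xs. x \<otimes> y) * V))
      = dual_apply h (proj_embed (\<Sum>(x, y)\<leftarrow>xs. x \<otimes> y)) * dual_apply h (proj_embed V)" for xs V
  proof (induction xs)
    case (Cons p xs)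
    obtain a b where "p = (a, b)" by (cases p)
    moreover obtain ys where "V = (\<Sum>(x, y)\<leftarrow>ys. x \<otimes> y)" using alg_tensor_repr by blast
    ultimately show ?case
      using Cons 1[of a b ys] by (simp add: distrib_right proj_embed_add)
  qed (simp add: z L)
  have 3: "dual_apply h (proj_embed U * proj_embed V) = dual_apply h (proj_embed U) * dual_apply h (proj_embed V)" for U V
    using 2 alg_tensor_repr[of U] by (metis proj_embed_mult)
  obtain U where U: "(\<lambda>n. proj_embed (U n)) \<longlonglongrightarrow> u" by (rule proj_embed_approx)
  obtain V where V: "(\<lambda>n. proj_embed (V n)) \<longlonglongrightarrow> v" by (rule proj_embed_approx)
  note lim = bounded_linear.tendsto[OF bounded_linear_dual_apply[of h]]
  have "(\<lambda>n. dual_apply h (proj_embed (U n) * proj_embed (V n))) \<longlonglongrightarrow> dual_apply h (u * v)"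
    by (intro lim tendsto_mult U V)
  moreover have "(\<lambda>n. dual_apply h (proj_embed (U n)) * dual_apply h (proj_embed (V n))) \<longlonglongrightarrow> dual_apply h u * dual_apply h v"
    by (intro tendsto_mult lim U V)
  ultimately show ?thesis unfolding 3 by (rule LIMSEQ_unique)
qed

lemma scattered_vanishing:
  fixes B :: "'a::{cstar_algebra, comm_ring} \<Rightarrow> 'a \<Rightarrow> complex"
  assumes sc: "scattered TYPE('a)" and B: "bilinear_form B"
    and K: "0 \<le> K" "\<And>x y. cmod (B x y) \<le> K * norm x * norm y" and e: "0 < e"
  obtains G where "finite G" "\<And>\<omega>. \<omega> \<in> G \<Longrightarrow> character \<omega>"
    "\<And>x y. \<forall>\<omega>\<in>G. \<omega> x = 0 \<Longrightarrow> cmod (B x y) \<le> e * norm x * norm y"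
proof -
  obtain f where f: "positive_functional f"
    "\<And>x y. norm x \<le> 1 \<Longrightarrow> norm y \<le> 1 \<Longrightarrow> (cmod (B x y))\<^sup>2 \<le> 2 * Re (f (vabs x))"
    by (rule bilinear_domination[OF B K]) (rule that)
  \<comment> \<open>Chosen so that the factor 2 in the domination leaves \<open>e\<^sup>2\<close>,
    after both arguments are normalised.\<close>
  have "0 < e\<^sup>2 / 2" using e by simp
  then obtain G where G: "finite G" "\<And>\<omega>. \<omega> \<in> G \<Longrightarrow> character \<omega>"
    "\<And>x. \<forall>\<omega>\<in>G. \<omega> x = 0 \<Longrightarrow> Re (f (vabs x)) \<le> e\<^sup>2 / 2 * norm x"
    by (rule scattered_finite[OF sc f(1)]) (rule that)
  show thesis
  proof (rule that[OF G(1,2)])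
    fix x y assume x: "\<forall>\<omega>\<in>G. \<omega> x = 0"
    show "cmod (B x y) \<le> e * norm x * norm y"
    proof (cases "x = 0 \<or> y = 0")
      case True
      then show ?thesis by (auto simp: bilinear_formD[OF B])
    next
      case False
      then have n: "0 < norm x" "0 < norm y" by auto
      define x' where "x' = (1 / norm x) *\<^sub>R x"
      define y' where "y' = (1 / norm y) *\<^sub>R y"
      have n': "norm x' = 1" "norm y' = 1" using n by (simp_all add: x'_def y'_def)
      have "\<forall>\<omega>\<in>G. \<omega> x' = 0" using x by (simp add: x'_def characterD(9)[OF G(2)])
      then have "Re (f (vabs x')) \<le> e\<^sup>2 / 2 * norm x'" by (rule G(3))
      then have "(cmod (B x' y'))\<^sup>2 \<le> e\<^sup>2" using f(2)[of x' y'] n' by simp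
      then have "cmod (B x' y') \<le> e" using e by (simp add: power2_le_iff_abs_le)
      moreover have "B x' y' = B x y / of_real (norm x * norm y)"
        by (simp add: x'_def y'_def scaleR_scaleC bilinear_formD[OF B])
      ultimately show ?thesis using n by (simp add: norm_divide norm_mult pos_divide_le_eq mult.assoc)
    qed
  qed
qed

lemma scattered_arens_regular:
  assumes sc: "scattered TYPE('a::{cstar_algebra, comm_ring})"
  shows "arens_regular TYPE('a varopoulos)"
proof (rule arens_regularI)
  fix f :: "'a varopoulos dual" and e :: real assume e: "0 < e"
  define B where "B x y = dual_apply f (proj_embed (x \<otimes> y))" for x y
  have B: "bilinear_form B"
    unfolding B_def by (rule bilinear_formI) (simp_all add: tensor_bilinear proj_embed_add proj_embed_scaleC)
  note D = bilinear_formD[OF B]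
  have K: "cmod (B x y) \<le> norm f * norm x * norm y" for x y
    unfolding B_def by (rule bound_chain[OF norm_dual_apply norm_proj_embed_tensor_le norm_ge_zero])
  \<comment> \<open>The domination controls only the first argument; the transposed form yields a
    finite set \<open>H\<close> for the second.\<close>
  have B': "bilinear_form (\<lambda>y x. B x y)" by (rule bilinear_formI) (simp_all add: D)
  have K': "cmod (B x y) \<le> norm f * norm y * norm x" for x y using K[of x y] by (simp add: ac_simps)
  \<comment> \<open>There are two error terms, and each carries a factor 2 because
    \<open>x - P x\<close> and \<open>y - Q y\<close> may have twice the original norm.\<close>
  have e4: "0 < e / 4" using e by simp
  obtain G where G: "finite G" "\<And>\<omega>. \<omega> \<in> G \<Longrightarrow> character \<omega>"
    "\<And>x y. \<forall>\<omega>\<in>G. \<omega> x = 0 \<Longrightarrow> cmod (B x y) \<le> e / 4 * norm x * norm y"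
    by (rule scattered_vanishing[OF sc B norm_ge_zero K e4]) (rule that)
  obtain H where H: "finite H" "\<And>\<omega>. \<omega> \<in> H \<Longrightarrow> character \<omega>"
    "\<And>y x. \<forall>\<omega>\<in>H. \<omega> y = 0 \<Longrightarrow> cmod (B x y) \<le> e / 4 * norm y * norm x"
    by (rule scattered_vanishing[OF sc B' norm_ge_zero K' e4]) (rule that)
  obtain a where a: "\<And>x \<omega>. \<omega> \<in> G \<Longrightarrow> \<omega> (x - (\<Sum>\<theta>\<in>G. \<theta> x *\<^sub>C a \<theta>)) = 0"
    "\<And>x. norm (\<Sum>\<theta>\<in>G. \<theta> x *\<^sub>C a \<theta>) \<le> norm x"
    by (rule interpolating_projection[OF G(1,2)]) (assumption, rule that)
  obtain b where b: "\<And>x \<omega>. \<omega> \<in> H \<Longrightarrow> \<omega> (x - (\<Sum>\<theta>\<in>H. \<theta> x *\<^sub>C b \<theta>)) = 0"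
    "\<And>x. norm (\<Sum>\<theta>\<in>H. \<theta> x *\<^sub>C b \<theta>) \<le> norm x"
    by (rule interpolating_projection[OF H(1,2)]) (assumption, rule that)
  define P where "P x = (\<Sum>\<theta>\<in>G. \<theta> x *\<^sub>C a \<theta>)" for x
  define Q where "Q x = (\<Sum>\<theta>\<in>H. \<theta> x *\<^sub>C b \<theta>)" for x
  have PQ: "cmod (B x y - B (P x) (Q y)) \<le> e * norm x * norm y" for x y
  proof -
    have "B x y = B (x - P x) y + B (P x) (y - Q y) + B (P x) (Q y)"
      using D(1)[of "x - P x" "P x" y] D(2)[of "P x" "y - Q y" "Q y"] by simp
    then have "cmod (B x y - B (P x) (Q y)) \<le> cmod (B (x - P x) y) + cmod (B (P x) (y - Q y))"
      using norm_triangle_ineq by simp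
    also have "\<dots> \<le> e / 4 * norm (x - P x) * norm y + e / 4 * norm (y - Q y) * norm (P x)"
      by (intro add_mono G(3) H(3)) (simp_all add: P_def Q_def a(1) b(1))
    also have "\<dots> \<le> e / 4 * (2 * norm x) * norm y + e / 4 * (2 * norm y) * norm x"
    proof -
      have "norm (x - P x) \<le> 2 * norm x" using norm_triangle_ineq4[of x "P x"] a(2)[of x] by (simp add: P_def)
      moreover have "norm (y - Q y) \<le> 2 * norm y" using norm_triangle_ineq4[of y "Q y"] b(2)[of y] by (simp add: Q_def)
      moreover have "norm (P x) \<le> norm x" using a(2) by (simp add: P_def)
      ultimately show ?thesis using e by (intro add_mono mult_mono) auto
    qed
    also have "\<dots> = e * norm x * norm y" by simp
    finally show ?thesis .
  qed
  have "\<exists>h. \<forall>x y. dual_apply h (proj_embed (x \<otimes> y)) = \<omega> x * \<theta> y"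
    if "character \<omega>" "character \<theta>" for \<omega> \<theta> :: "'a \<Rightarrow> complex"
  proof -
    note W = characterD[OF that(1)] and T = characterD[OF that(2)]
    have "bilinear_form (\<lambda>x y. \<omega> x * \<theta> y)"
      by (rule bilinear_formI) (simp_all add: W T algebra_simps)
    moreover have "cmod (\<omega> x * \<theta> y) \<le> 1 * norm x * norm y" for x y
      by (simp add: norm_mult mult_mono W T)
    ultimately show ?thesis using proj_tensor_functional[of "\<lambda>x y. \<omega> x * \<theta> y" 1] by (metis zero_le_one)
  qed
  then obtain k :: "('a \<Rightarrow> complex) \<Rightarrow> ('a \<Rightarrow> complex) \<Rightarrow> 'a varopoulos dual"
    where k: "\<And>\<omega> \<theta> x y. character \<omega> \<Longrightarrow> character \<theta> \<Longrightarrow> dual_apply (k \<omega> \<theta>) (proj_embed (x \<otimes> y)) = \<omega> x * \<theta> y"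
    by metis
  \<comment> \<open>The functional whose bilinear form is \<open>B (P x) (Q y)\<close>, written as a
    finite combination of multiplicative functionals of the tensor algebra.\<close>
  define h where "h = (\<Sum>\<omega>\<in>G. \<Sum>\<theta>\<in>H. B (a \<omega>) (b \<theta>) *\<^sub>C k \<omega> \<theta>)"
  have "arens_wstar_cont h"
    unfolding h_def
    by (intro arens_wstar_cont_sum arens_wstar_cont_scaleC arens_wstar_cont_multiplicative
        character_tensor_multiplicative[OF G(2) H(2) k[OF G(2) H(2)]])
  moreover have "norm (f - h) \<le> e"
  proof (rule norm_proj_tensor_dual_le)
    fix x y
    have sum_left: "dual_apply (sum g I) u = (\<Sum>i\<in>I. dual_apply (g i) u)" for g :: "_ \<Rightarrow> 'a varopoulos dual" and I u
    proof (induction I rule: infinite_finite_induct)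
      case (insert i I)
      then show ?case by simp
    qed (simp_all add: zero_dual.rep_eq dual_apply.rep_eq)
    have B1: "B (sum g I) y = (\<Sum>i\<in>I. B (g i) y)" for g :: "('a \<Rightarrow> complex) \<Rightarrow> 'a" and I y
      by (induction I rule: infinite_finite_induct) (simp_all add: D)
    have B2: "B x (sum g I) = (\<Sum>i\<in>I. B x (g i))" for g :: "('a \<Rightarrow> complex) \<Rightarrow> 'a" and I x
      by (induction I rule: infinite_finite_induct) (simp_all add: D)
    have "dual_apply h (proj_embed (x \<otimes> y)) = (\<Sum>\<omega>\<in>G. \<Sum>\<theta>\<in>H. B (a \<omega>) (b \<theta>) * (\<omega> x * \<theta> y))"
      unfolding h_def sum_left by (intro sum.cong refl) (simp add: k G(2) H(2))
    also have "\<dots> = (\<Sum>\<omega>\<in>G. \<Sum>\<theta>\<in>H. B (\<omega> x *\<^sub>C a \<omega>) (\<theta> y *\<^sub>C b \<theta>))"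
      by (intro sum.cong refl) (simp add: D ac_simps)
    also have "\<dots> = B (P x) (Q y)"
      by (simp only: P_def B1) (simp only: Q_def B2)
    finally have hPQ: "dual_apply h (proj_embed (x \<otimes> y)) = B (P x) (Q y)" .
    have "dual_apply (f - h) u + dual_apply h u = dual_apply f u" for u
      by (simp only: dual_apply_add_left[symmetric] diff_add_cancel)
    then have "dual_apply (f - h) u = dual_apply f u - dual_apply h u" for u by (simp add: eq_diff_eq)
    then have "dual_apply (f - h) (proj_embed (x \<otimes> y)) = B x y - B (P x) (Q y)"
      by (simp only: hPQ B_def)
    then show "cmod (dual_apply (f - h) (proj_embed (x \<otimes> y))) \<le> e * norm x * norm y"
      using PQ by simp
  qed (use e in simp)
  ultimately show "\<exists>h. arens_wstar_cont h \<and> norm (f - h) \<le> e" by blast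
qed

theorem corollary4p5:
  shows "arens_regular TYPE('a::{cstar_algebra, comm_ring} varopoulos) \<longleftrightarrow> scattered TYPE('a)"
  using nonscattered_not_arens_regular scattered_arens_regular by blast


end
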